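(* There is a universal constant $C>0$ such that for every $n\ge 2$ and every centrally symmetric convex body $K\subset\mathbb{R}^n$ in isotropic position with $\mathrm{Vol}(K)=\mathrm{Vol}(D_n)$, $$L_K\le C\,\inf\left\{\mathcal{L}_k\,\widetilde{M}_k(L)\;:\;K\subset L,\ L\in BP_k^n,\ k=1,\dots,n-1\right\}.$$
   Context: $D_n$ is the Euclidean unit ball of $\mathbb{R}^n$ and $\sigma$ is the Haar probability measure on $S^{n-1}$. A convex body is a compact convex set with non-empty interior; it is centrally symmetric if $K=-K$. A centrally symmetric convex body $K\subset\mathbb{R}^n$ is in isotropic position if $\int_K\langle x,\theta\rangle^2dx$ is the same for all $\theta\in S^{n-1}$. Every such body has an invertible linear image of volume 1 in isotropic position, unique up to rotation; $L_K$ is the number with $\int_{K'}\langle x,\theta\rangle^2dx=L_K^2$ for all $\theta\in S^{n-1}$, where $K'$ is such an image of $K$. $\mathcal{L}_k$ denotes the maximal (supremal) isotropic constant of centrally symmetric convex bodies in $\mathbb{R}^k$. A (centrally symmetric) star-body $L\subset\mathbb{R}^n$ is a compact set with $L=-L$, $tL\subset L$ for $t\in[0,1]$, whose radial function $\rho_L(\theta)=\max\{r\ge0:r\theta\in L\}$ is continuous on $S^{n-1}$. $\widetilde{M}_k(L)=\left(\int_{S^{n-1}}\rho_L(x)^k\,d\sigma(x)\right)^{1/k}$. $k$-Busemann-Petty bodies: $G(n,m)$ is the Grassmannian of $m$-dimensional linear subspaces of $\mathbb{R}^n$; $R_m:C(S^{n-1})\to C(G(n,m))$ is $R_m(f)(E)=\int_{S^{n-1}\cap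 E}f\,d\sigma_E$, where $\sigma_E$ is the rotation-invariant probability measure on $S^{n-1}\cap E$; $R_m^*$ is the dual map from signed Borel measures on $G(n,m)$ to signed Borel measures on $S^{n-1}$, $\int_{S^{n-1}}f\,R_m^*(d\mu)=\int_{G(n,m)}R_m(f)\,d\mu$ for all $f\in C(S^{n-1})$. A star-body $L$ belongs to $BP_k^n$ if $\rho_L^k=R_{n-k}^*(d\mu)$ for some non-negative Borel measure $\mu$ on $G(n,n-k)$ (where the function $\rho_L^k$ is identified with the measure of density $\rho_L^k$ with respect to $\sigma$). *)

theory Defs
  imports "HOL-Probability.Probability" "HOL-Library.Function_Algebras"
begin

text \<open>
  The dimension is quantified inside the statement, so \<open>\<real>\<^sup>n\<close> is rendered as a subspace of the
  single type \<^typ>\<open>nat \<Rightarrow> real\<close>, namely the functions vanishing outside \<open>{..<n}\<close>.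
  The vector space structure is pointwise. The topology is the product topology of the
  library; on each \<open>\<real>\<^sup>n\<close> it coincides with the Euclidean one. The library metric on
  \<^typ>\<open>nat \<Rightarrow> real\<close> is not Euclidean and is never used; the Euclidean norm of \<open>x \<in> \<real>\<^sup>n\<close>
  is \<open>L2_set x {..<n}\<close>.
\<close>

instantiation "fun" :: (type, real_vector) real_vector
begin

definition scaleR_fun :: "real \<Rightarrow> ('a \<Rightarrow> 'b) \<Rightarrow> 'a \<Rightarrow> 'b"
  where "scaleR_fun r f = (\<lambda>x. r *\<^sub>R f x)"

instance
  by standard (simp_all add: scaleR_fun_def fun_eq_iff scaleR_add_right scaleR_add_left)

end

definition Rn :: "nat \<Rightarrow> (nat \<Rightarrow> real) set"
  where "Rn n = {x. \<forall>i\<ge>n. x i = 0}"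

definition ip :: "nat \<Rightarrow> (nat \<Rightarrow> real) \<Rightarrow> (nat \<Rightarrow> real) \<Rightarrow> real"
  where "ip n x y = (\<Sum>i<n. x i * y i)"

definition unit_ball :: "nat \<Rightarrow> (nat \<Rightarrow> real) set"
  where "unit_ball n = {x \<in> Rn n. L2_set x {..<n} \<le> 1}"

text \<open>The unit sphere of a linear subspace \<open>E\<close> of \<open>\<real>\<^sup>n\<close>; \<open>S\<^sup>n\<^sup>-\<^sup>1\<close> is the case \<open>E = Rn n\<close>.\<close>

definition unit_sphere :: "nat \<Rightarrow> (nat \<Rightarrow> real) set \<Rightarrow> (nat \<Rightarrow> real) set"
  where "unit_sphere n E = {x \<in> E. L2_set x {..<n} = 1}"

text \<open>
  Lebesgue measure on \<open>\<real>\<^sup>n\<close>, as a measure on the Borel sets of \<^typ>\<open>nat \<Rightarrow> real\<close> carried by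
  \<open>Rn n\<close>. The elements of \<open>Pi\<^sub>M {..<n}\<close> are \<^const>\<open>undefined\<close> outside \<open>{..<n}\<close>, hence the
  push-forward.
\<close>

definition lebesgue_Rn :: "nat \<Rightarrow> (nat \<Rightarrow> real) measure"
  where "lebesgue_Rn n =
    distr (Pi\<^sub>M {..<n} (\<lambda>_. lborel)) borel (\<lambda>x i. if i < n then x i else 0)"

definition vol :: "nat \<Rightarrow> (nat \<Rightarrow> real) set \<Rightarrow> real"
  where "vol n A = measure (lebesgue_Rn n) A"

text \<open>
  The rotation-invariant Borel probability measure on the unit sphere of a subspace \<open>E\<close> of
  dimension at least 1. Invariance is required under all linear isometries of \<open>E\<close>, not only
  the orientation preserving ones; this matters only if \<open>E\<close> is a line.
\<close>

definition sphere_measure :: "nat \<Rightarrow> (nat \<Rightarrow> real) set \<Rightarrow> (nat \<Rightarrow> real) measure"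
  where "sphere_measure n E = (THE \<mu>.
    prob_space \<mu> \<and> sets \<mu> = sets (restrict_space borel (unit_sphere n E)) \<and>
    (\<forall>T. linear T \<and> T ` E = E \<and> (\<forall>x\<in>E. L2_set (T x) {..<n} = L2_set x {..<n})
      \<longrightarrow> distr \<mu> \<mu> T = \<mu>))"

definition sym_convex_body :: "nat \<Rightarrow> (nat \<Rightarrow> real) set \<Rightarrow> bool"
  where "sym_convex_body n K \<longleftrightarrow>
    K \<subseteq> Rn n \<and> compact K \<and> convex K \<and> (top_of_set (Rn n)) interior_of K \<noteq> {} \<and>
    uminus ` K = K"

definition isotropic :: "nat \<Rightarrow> (nat \<Rightarrow> real) set \<Rightarrow> bool"
  where "isotropic n K \<longleftrightarrow>
    (\<forall>\<theta>\<in>unit_sphere n (Rn n). \<forall>\<phi>\<in>unit_sphere n (Rn n).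
      (LINT x:K|lebesgue_Rn n. (ip n x \<theta>)\<^sup>2) = (LINT x:K|lebesgue_Rn n. (ip n x \<phi>)\<^sup>2))"

definition isotropic_const :: "nat \<Rightarrow> (nat \<Rightarrow> real) set \<Rightarrow> real"
  where "isotropic_const n K = (THE c. c \<ge> 0 \<and>
    (\<exists>T. linear T \<and> bij_betw T (Rn n) (Rn n) \<and> vol n (T ` K) = 1 \<and> isotropic n (T ` K) \<and>
      (\<forall>\<theta>\<in>unit_sphere n (Rn n). (LINT x:T ` K|lebesgue_Rn n. (ip n x \<theta>)\<^sup>2) = c\<^sup>2)))"

definition max_isotropic_const :: "nat \<Rightarrow> ennreal"
  where "max_isotropic_const k = (SUP K\<in>{K. sym_convex_body k K}. ennreal (isotropic_const k K))"

definition radial :: "(nat \<Rightarrow> real) set \<Rightarrow> (nat \<Rightarrow> real) \<Rightarrow> real"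
  where "radial L \<theta> = (GREATEST r. 0 \<le> r \<and> r *\<^sub>R \<theta> \<in> L)"

text \<open>Nonemptiness is implicit in the existence of the maximum defining the radial function.\<close>

definition star_body :: "nat \<Rightarrow> (nat \<Rightarrow> real) set \<Rightarrow> bool"
  where "star_body n L \<longleftrightarrow>
    L \<subseteq> Rn n \<and> L \<noteq> {} \<and> compact L \<and> uminus ` L = L \<and>
    (\<forall>t\<in>{0..1}. (\<lambda>x. t *\<^sub>R x) ` L \<subseteq> L) \<and>
    continuous_on (unit_sphere n (Rn n)) (radial L)"

definition mean_radius :: "nat \<Rightarrow> nat \<Rightarrow> (nat \<Rightarrow> real) set \<Rightarrow> real"
  where "mean_radius n k L = root k (LINT \<theta>|sphere_measure n (Rn n). radial L \<theta> ^ k)"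

definition grassmannian :: "nat \<Rightarrow> nat \<Rightarrow> (nat \<Rightarrow> real) set set"
  where "grassmannian n m = {E. subspace E \<and> E \<subseteq> Rn n \<and> dim E = m}"

definition orth_proj :: "nat \<Rightarrow> (nat \<Rightarrow> real) set \<Rightarrow> (nat \<Rightarrow> real) \<Rightarrow> nat \<Rightarrow> real"
  where "orth_proj n E x = (THE y. y \<in> E \<and> (\<forall>z\<in>E. ip n (x - y) z = 0))"

text \<open>
  The usual topology of the Grassmannian, from the embedding of \<open>G(n,m)\<close> into the \<open>n \<times> n\<close>
  matrices that sends \<open>E\<close> to the matrix of the orthogonal projection onto \<open>E\<close>. The rows with
  index \<open>i \<ge> n\<close> and the columns with index \<open>j \<ge> n\<close> are zero.
\<close>

definition grassmannian_topology :: "nat \<Rightarrow> nat \<Rightarrow> (nat \<Rightarrow> real) set topology"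
  where "grassmannian_topology n m =
    pullback_topology (grassmannian n m) (\<lambda>E i j. orth_proj n E (\<lambda>l. of_bool (l = i)) j) euclidean"

definition grassmannian_borel :: "nat \<Rightarrow> nat \<Rightarrow> (nat \<Rightarrow> real) set measure"
  where "grassmannian_borel n m =
    sigma (grassmannian n m) {U. openin (grassmannian_topology n m) U}"

text \<open>The spherical Radon transform \<open>R\<^sub>m\<close>; the dimension \<open>m\<close> is that of \<open>E\<close>.\<close>

definition radon :: "nat \<Rightarrow> ((nat \<Rightarrow> real) \<Rightarrow> real) \<Rightarrow> (nat \<Rightarrow> real) set \<Rightarrow> real"
  where "radon n f E = (LINT \<theta>|sphere_measure n E. f \<theta>)"

text \<open>
  \<open>\<nu> = R\<^sub>m\<^sup>* \<mu>\<close> for finite non-negative Borel measures \<open>\<mu>\<close> on \<open>G(n,m)\<close> and \<open>\<nu>\<close> on the sphere.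
  Signed measures are not needed below.
\<close>

definition is_radon_dual ::
    "nat \<Rightarrow> nat \<Rightarrow> (nat \<Rightarrow> real) set measure \<Rightarrow> (nat \<Rightarrow> real) measure \<Rightarrow> bool"
  where "is_radon_dual n m \<mu> \<nu> \<longleftrightarrow>
    finite_measure \<mu> \<and> sets \<mu> = sets (grassmannian_borel n m) \<and>
    finite_measure \<nu> \<and> sets \<nu> = sets (restrict_space borel (unit_sphere n (Rn n))) \<and>
    (\<forall>f. continuous_on (unit_sphere n (Rn n)) f \<longrightarrow>
      (LINT \<theta>|\<nu>. f \<theta>) = (LINT E|\<mu>. radon n f E))"

definition BP :: "nat \<Rightarrow> nat \<Rightarrow> (nat \<Rightarrow> real) set set"
  where "BP n k = {L. star_body n L \<and>
    (\<exists>\<mu>. is_radon_dual n (n - k) \<mu>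
      (density (sphere_measure n (Rn n)) (\<lambda>\<theta>. ennreal (radial L \<theta> ^ k))))}"

end

theory Submission
  imports Defs
begin

text \<open>
  Put \<open>m = n - k\<close>. Since \<open>K \<subseteq> L\<close>, we have \<open>\<integral>\<rho>\<^sub>L\<^sup>k \<rho>\<^sub>K\<^sup>m d\<sigma> \<ge> \<integral>\<rho>\<^sub>K\<^sup>n d\<sigma> = 1\<close>. Writing \<open>\<rho>\<^sub>L\<^sup>k\<close> as the dual
  Radon transform of \<open>\<mu>\<close>, whose total mass is the \<open>k\<close>-th power of the mean radius \<open>M\<close> of \<open>L\<close>, some
  subspace \<open>E\<close> of dimension \<open>m\<close> has the average of \<open>\<rho>\<^sub>K\<^sup>m\<close> over its sphere at least \<open>1 / (2 M\<^sup>k)\<close>: the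
  section of \<open>K\<close> by \<open>E\<close> is large. The volume of the sections parallel to \<open>E\<close> is an even log-concave
  function \<open>f\<close> on the orthogonal complement of \<open>E\<close>, by the Prekopa--Leindler inequality. Its
  Ball body of order \<open>k + 2\<close> is convex, has exactly the second moments of \<open>K\<close>, so is isotropic, and
  its volume is controlled by \<open>f 0\<close>. Comparing the isotropic constant of \<open>K\<close> with that of this
  \<open>k\<close>-dimensional body gives the estimate.
\<close>


section \<open>Coordinates\<close>

text \<open>The order \<open>k + 2\<close> of the Ball body is forced by isotropy. In polar
  coordinates of R^k a second moment carries the weight r^(k-1) r^2 dr, so a body with the same
  integral of that weight along every ray keeps all second moments exactly. The volume, which sees
  only r^(k-1) dr, is then merely bounded: comparing the two radial moments with those of an
  exponential loses (6 e^2)^k, which is harmless because the volume enters the isotropic constant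
  through a k-th root. The ratio of the unit ball volumes in dimensions n and m is absorbed by
  log-convexity of Gamma. Hence the constant 2 sqrt(6 e^2); the 2 comes from accepting a section
  only half as large as the average one.

  The measure on a sphere and the isotropic constant are definite descriptions over a type that
  contains every R^n at once, so each needs an existence and uniqueness proof before anything can be
  computed. Uniqueness of translation-invariant measures supplies linear changes of variables and
  the product formula without determinants; Christensen's argument handles the sphere.\<close>

abbreviation nrm :: "nat \<Rightarrow> (nat \<Rightarrow> real) \<Rightarrow> real"
  where "nrm n x \<equiv> L2_set x {..<n}"

lemma scaleR_fun_apply [simp]: "(r *\<^sub>R f) i = r *\<^sub>R f i"
  by (simp add: scaleR_fun_def)

lemma subspace_Rn: "subspace (Rn n)"
  by (auto simp: subspace_def Rn_def)

lemma Rn_closed [simp, intro]: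
  "0 \<in> Rn n"
  "x \<in> Rn n \<Longrightarrow> y \<in> Rn n \<Longrightarrow> x + y \<in> Rn n"
  "x \<in> Rn n \<Longrightarrow> y \<in> Rn n \<Longrightarrow> x - y \<in> Rn n"
  "x \<in> Rn n \<Longrightarrow> - x \<in> Rn n"
  "x \<in> Rn n \<Longrightarrow> r *\<^sub>R x \<in> Rn n"
  by (auto simp: Rn_def)

lemma Rn_sum [intro]: "(\<And>i. i \<in> I \<Longrightarrow> f i \<in> Rn n) \<Longrightarrow> sum f I \<in> Rn n"
  by (rule subspace_sum[OF subspace_Rn])

lemma fun_sum_apply: "(sum f I) x = (\<Sum>i\<in>I. f i x)" for f :: "'a \<Rightarrow> 'b \<Rightarrow> real"
  by (induction I rule: infinite_finite_induct) auto

lemma nrm_scale: "nrm n (r *\<^sub>R x) = \<bar>r\<bar> * nrm n x"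
  by (simp add: L2_set_def power_mult_distrib sum_distrib_left[symmetric] real_sqrt_mult)

lemma nrm_minus [simp]: "nrm n (- x) = nrm n x"
  by (simp add: L2_set_def)

lemma nrm_commute: "nrm n (x - y) = nrm n (y - x)"
  by (metis minus_diff_eq nrm_minus)

lemma nrm_0 [simp]: "nrm n 0 = 0"
  by (simp add: L2_set_def)

lemma coord_le_nrm: "i < n \<Longrightarrow> \<bar>x i\<bar> \<le> nrm n x"
  using member_le_L2_set[of "{..<n}" i "\<lambda>i. \<bar>x i\<bar>"] by (simp add: L2_set_def)

lemma nrm_eq_0: "x \<in> Rn n \<Longrightarrow> nrm n x = 0 \<longleftrightarrow> x = 0"
  by (auto simp: L2_set_eq_0_iff Rn_def fun_eq_iff) (metis lessThan_iff not_le)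

lemma nrm_pos: "x \<in> Rn n \<Longrightarrow> x \<noteq> 0 \<Longrightarrow> nrm n x > 0"
  using nrm_eq_0[of x n] L2_set_nonneg[of x "{..<n}"] by linarith

lemma nrm_pow2: "(nrm n x)\<^sup>2 = ip n x x"
  by (simp add: L2_set_def ip_def sum_nonneg power2_eq_square)

lemma ip_lin:
  "ip n (x + y) z = ip n x z + ip n y z"
  "ip n z (x + y) = ip n z x + ip n z y"
  "ip n (x - y) z = ip n x z - ip n y z"
  "ip n z (x - y) = ip n z x - ip n z y"
  "ip n (r *\<^sub>R x) z = r * ip n x z"
  "ip n z (r *\<^sub>R x) = r * ip n z x"
  "ip n (- x) z = - ip n x z"
  "ip n z (- x) = - ip n z x"
  by (auto simp: ip_def algebra_simps sum.distrib sum_subtractf sum_distrib_left sum_negf)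

lemma ip_sym: "ip n x y = ip n y x"
  by (simp add: ip_def mult.commute)

lemma ip_0 [simp]: "ip n 0 x = 0" "ip n x 0 = 0"
  by (auto simp: ip_def)

lemma ip_sum:
  "ip n (sum f I) z = (\<Sum>i\<in>I. ip n (f i) z)"
  "ip n z (sum f I) = (\<Sum>i\<in>I. ip n z (f i))"
  by (induction I rule: infinite_finite_induct) (auto simp: ip_lin)

lemma ip_polar: "ip n x y = ((nrm n (x + y))\<^sup>2 - (nrm n (x - y))\<^sup>2) / 4"
  by (simp add: nrm_pow2 ip_lin ip_sym[of n y x])

lemma ip_abs_le: "\<bar>ip n x y\<bar> \<le> nrm n x * nrm n y"
proof -
  have "\<bar>ip n x y\<bar> \<le> (\<Sum>i<n. \<bar>x i\<bar> * \<bar>y i\<bar>)"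
    unfolding ip_def by (rule order.trans[OF sum_abs]) (simp add: abs_mult)
  also have "\<dots> \<le> nrm n x * nrm n y"
    using L2_set_mult_ineq[of x y "{..<n}"] by simp
  finally show ?thesis .
qed

lemma ip_self_pos: "x \<in> Rn n \<Longrightarrow> x \<noteq> 0 \<Longrightarrow> ip n x x > 0"
  using nrm_pos[of x n] by (metis nrm_pow2 zero_less_power)

definition evec :: "nat \<Rightarrow> nat \<Rightarrow> real"
  where "evec i = (\<lambda>j. of_bool (j = i))"

lemma evec_Rn: "i < n \<Longrightarrow> evec i \<in> Rn n"
  by (auto simp: evec_def Rn_def)

lemma ip_evec: "i < n \<Longrightarrow> ip n (evec i) x = x i" "i < n \<Longrightarrow> ip n x (evec i) = x i"
proof -
  assume i: "i < n"
  have "ip n (evec i) x = (\<Sum>j<n. if j = i then x j else 0)"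
    unfolding ip_def evec_def by (rule sum.cong) auto
  then show "ip n (evec i) x = x i" using i by simp
  then show "ip n x (evec i) = x i" by (simp add: ip_sym)
qed

lemma nrm_evec: "i < n \<Longrightarrow> nrm n (evec i) = 1"
proof -
  assume i: "i < n"
  have "(nrm n (evec i))\<^sup>2 = 1"
    by (simp add: nrm_pow2 ip_evec[OF i]) (simp add: evec_def)
  then have "nrm n (evec i) = 1 \<or> nrm n (evec i) = - 1" by (simp add: power2_eq_1_iff)
  then show ?thesis using L2_set_nonneg[of "evec i" "{..<n}"] by linarith
qed

lemma Rn_eqI: "x \<in> Rn n \<Longrightarrow> y \<in> Rn n \<Longrightarrow> (\<And>i. i < n \<Longrightarrow> x i = y i) \<Longrightarrow> x = y"
  by (auto simp: Rn_def fun_eq_iff) (metis not_le)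

text \<open>The linear map given by a matrix with columns \<open>u i\<close>; only the first
  \<open>m\<close> coordinates of the argument are read. It serves both as a linear map of R^n and
  as the parametrisation of the span of a system of vectors.\<close>

definition lmap :: "nat \<Rightarrow> (nat \<Rightarrow> nat \<Rightarrow> real) \<Rightarrow> (nat \<Rightarrow> real) \<Rightarrow> nat \<Rightarrow> real"
  where "lmap m u x = (\<Sum>i<m. x i *\<^sub>R u i)"

lemma lmap_apply: "lmap m u x j = (\<Sum>i<m. x i * u i j)"
  by (simp add: lmap_def fun_sum_apply)

lemma linear_lmap: "linear (lmap m u)"
  by (rule linearI) (simp_all add: lmap_def scaleR_left_distrib sum.distrib scaleR_sum_right)

lemma lmap_lin:
  "lmap m u (x + y) = lmap m u x + lmap m u y"
  "lmap m u (x - y) = lmap m u x - lmap m u y"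
  "lmap m u (- x) = - lmap m u x"
  "lmap m u (r *\<^sub>R x) = r *\<^sub>R lmap m u x"
  "lmap m u 0 = 0"
  using linear_lmap[of m u]
  by (auto simp: linear_add linear_diff linear_neg linear_scale linear_0)

lemma lmap_Rn: "(\<And>i. i < m \<Longrightarrow> u i \<in> Rn n) \<Longrightarrow> lmap m u x \<in> Rn n"
  unfolding lmap_def by (rule Rn_sum) auto

lemma Rn_expand:
  assumes "x \<in> Rn n" shows "x = lmap n evec x"
proof
  fix j
  show "x j = lmap n evec x j"
  proof (cases "j < n")
    case True
    have "lmap n evec x j = (\<Sum>i<n. if i = j then x i else 0)"
      unfolding lmap_apply evec_def by (rule sum.cong) auto
    then show ?thesis using True by simp
  next
    case False
    have "lmap n evec x j = (\<Sum>i<n. 0)"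
      unfolding lmap_apply evec_def by (rule sum.cong) (use False in auto)
    then show ?thesis using False assms by (simp add: Rn_def)
  qed
qed

lemma lmap_evec: "i < m \<Longrightarrow> lmap m u (evec i) = u i"
proof
  fix j assume i: "i < m"
  have "lmap m u (evec i) j = (\<Sum>l<m. if l = i then u l j else 0)"
    unfolding lmap_apply evec_def by (rule sum.cong) auto
  then show "lmap m u (evec i) j = u i j" using i by simp
qed

text \<open>A linear map on the whole function type is arbitrary outside \<open>Rn n\<close> and
  need not be measurable. Replacing it on \<open>Rn n\<close> by a matrix map gives a representative
  that is continuous everywhere.\<close>

lemma linear_eq_lmap:
  assumes "linear T" "x \<in> Rn n"
  shows "T x = lmap n (\<lambda>i. T (evec i)) x"
proof -
  have "T x = T (lmap n evec x)" using Rn_expand[OF assms(2)] by simp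
  also have "\<dots> = lmap n (\<lambda>i. T (evec i)) x"
    unfolding lmap_def using assms(1) by (simp add: linear_sum linear_scale)
  finally show ?thesis .
qed

lemma lmap_lmap:
  "lmap m u (lmap l v x) = lmap l (\<lambda>i. lmap m u (v i)) x"
  unfolding lmap_def[of l] by (simp add: linear_sum[OF linear_lmap] lmap_lin)

text \<open>The index set is countable, so the Borel sets of the product topology are generated by
  the coordinates.\<close>

lemma borel_measurable_fun_iff:
  "f \<in> borel_measurable M \<longleftrightarrow> (\<forall>j. (\<lambda>x. f x j) \<in> borel_measurable M)"
  for f :: "'a \<Rightarrow> nat \<Rightarrow> real"
proof
  assume f: "f \<in> borel_measurable M"
  have "(\<lambda>x. x j) \<in> borel_measurable (borel :: (nat \<Rightarrow> real) measure)" for j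
    by (intro borel_measurable_continuous_onI continuous_on_product_coordinates)
  from measurable_compose[OF f this] show "\<forall>j. (\<lambda>x. f x j) \<in> borel_measurable M" by blast
next
  assume "\<forall>j. (\<lambda>x. f x j) \<in> borel_measurable M"
  then show "f \<in> borel_measurable M"
    by (intro measurable_coordinatewise_then_product) auto
qed

lemma measurable_coord:
  "(\<lambda>x. x j) \<in> borel_measurable (borel :: (nat \<Rightarrow> real) measure)"
  by (intro borel_measurable_continuous_onI continuous_on_product_coordinates)

text \<open>As a global rule, measurability of coordinates would apply to every real-valued term.\<close>

context
  notes measurable_compose[OF _ measurable_coord, measurable (raw)]
begin

lemma measurable_fun_add [measurable (raw)]:
  fixes f g :: "'a \<Rightarrow> nat \<Rightarrow> real"
  assumes [measurable]: "f \<in> borel_measurable M" "g \<in> borel_measurable M"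
  shows "(\<lambda>x. f x + g x) \<in> borel_measurable M"
  by (subst borel_measurable_fun_iff) simp

lemma measurable_fun_diff [measurable (raw)]:
  fixes f g :: "'a \<Rightarrow> nat \<Rightarrow> real"
  assumes [measurable]: "f \<in> borel_measurable M" "g \<in> borel_measurable M"
  shows "(\<lambda>x. f x - g x) \<in> borel_measurable M"
  by (subst borel_measurable_fun_iff) simp

lemma measurable_fun_uminus [measurable (raw)]:
  fixes f :: "'a \<Rightarrow> nat \<Rightarrow> real"
  assumes [measurable]: "f \<in> borel_measurable M"
  shows "(\<lambda>x. - f x) \<in> borel_measurable M"
  by (subst borel_measurable_fun_iff) simp

lemma measurable_fun_scaleR [measurable (raw)]:
  fixes f :: "'a \<Rightarrow> nat \<Rightarrow> real"
  assumes [measurable]: "f \<in> borel_measurable M" "r \<in> borel_measurable M"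
  shows "(\<lambda>x. r x *\<^sub>R f x) \<in> borel_measurable M"
  by (subst borel_measurable_fun_iff) simp

lemma measurable_nrm [measurable (raw)]:
  fixes f :: "'a \<Rightarrow> nat \<Rightarrow> real"
  assumes [measurable]: "f \<in> borel_measurable M"
  shows "(\<lambda>x. nrm n (f x)) \<in> borel_measurable M"
  unfolding L2_set_def by measurable

lemma measurable_ip [measurable (raw)]:
  fixes f :: "'a \<Rightarrow> nat \<Rightarrow> real"
  assumes [measurable]: "f \<in> borel_measurable M" "g \<in> borel_measurable M"
  shows "(\<lambda>x. ip n (f x) (g x)) \<in> borel_measurable M"
  unfolding ip_def by measurable

lemma measurable_lmap [measurable]: "lmap m u \<in> borel_measurable borel"
  by (subst borel_measurable_fun_iff) (simp add: lmap_apply)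

lemma measurable_cube [measurable]: "{x :: nat \<Rightarrow> real. \<forall>i<n. \<bar>x i\<bar> \<le> r} \<in> sets borel"
  by measurable

text \<open>The identification of R^m x R^k with R^(m+k). The tail of \<open>z\<close> is dropped
  but that of \<open>y\<close> is kept, so \<open>glue_shiftn\<close> holds on the entire type,
  without membership in \<open>Rn\<close>.\<close>

definition glue :: "nat \<Rightarrow> (nat \<Rightarrow> real) \<Rightarrow> (nat \<Rightarrow> real) \<Rightarrow> nat \<Rightarrow> real"
  where "glue m z y = (\<lambda>i. if i < m then z i else y (i - m))"

lemma measurable_glue [measurable (raw)]:
  assumes [measurable]: "f \<in> borel_measurable M" "g \<in> borel_measurable M"
  shows "(\<lambda>x. glue m (f x) (g x)) \<in> borel_measurable M"
  by (subst borel_measurable_fun_iff) (simp add: glue_def)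

definition shiftn :: "nat \<Rightarrow> (nat \<Rightarrow> real) \<Rightarrow> nat \<Rightarrow> real"
  where "shiftn m x = (\<lambda>i. x (m + i))"

lemma measurable_shiftn [measurable]: "shiftn m \<in> borel_measurable borel"
  by (subst borel_measurable_fun_iff) (simp add: shiftn_def)

text \<open>A projection onto \<open>Rn n\<close> that also replaces the \<open>undefined\<close>
  entries of the elements of a finite product space by 0.\<close>

definition cutoff :: "nat \<Rightarrow> (nat \<Rightarrow> real) \<Rightarrow> nat \<Rightarrow> real"
  where "cutoff n x = (\<lambda>i. if i < n then x i else 0)"

lemma measurable_cutoff [measurable]: "cutoff n \<in> borel_measurable borel"
  by (subst borel_measurable_fun_iff) (simp add: cutoff_def)

end

section \<open>Continuity for the product topology\<close>

lemma continuous_on_coord: "continuous_on S (\<lambda>x. x j)" for S :: "(nat \<Rightarrow> real) set"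
  by (rule continuous_on_subset[OF continuous_on_product_coordinates]) simp

lemma continuous_on_lmap: "continuous_on S (lmap m u)"
  by (intro continuous_on_coordinatewise_then_product)
    (auto simp: lmap_apply intro!: continuous_intros continuous_on_coord)

lemma continuous_on_nrm: "continuous_on S (\<lambda>x. nrm n (x - y))"
  unfolding L2_set_def by (auto intro!: continuous_intros continuous_on_coord)

lemma closed_Rn: "closed (Rn n)"
proof -
  have "Rn n = (\<Inter>i\<in>{n..}. {x. x i = 0})" by (auto simp: Rn_def)
  moreover have "closed {x :: nat \<Rightarrow> real. x i = 0}" for i
    by (intro closed_Collect_eq continuous_on_coord continuous_intros)
  ultimately show ?thesis by auto
qed

lemma Rn_borel [measurable]: "Rn n \<in> sets borel"
  using closed_Rn by auto

section \<open>Lebesgue measure and linear maps\<close>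

lemma sets_lebesgue_Rn [simp, measurable_cong]: "sets (lebesgue_Rn n) = sets borel"
  by (simp add: lebesgue_Rn_def)

lemma space_lebesgue_Rn [simp]: "space (lebesgue_Rn n) = UNIV"
  by (simp add: lebesgue_Rn_def)

lemma measurable_lebesgue_Rn [simp]: "measurable (lebesgue_Rn n) N = measurable borel N"
  by (rule measurable_cong_sets) auto

lemma product_sigma_finite_lborel: "product_sigma_finite (\<lambda>_::nat. lborel :: real measure)"
  by standard

lemma cutoff_Rn: "cutoff n x \<in> Rn n"
  by (simp add: cutoff_def Rn_def)

lemma cutoff_id: "x \<in> Rn n \<Longrightarrow> cutoff n x = x"
  by (auto simp: cutoff_def Rn_def)

lemma nrm_cutoff: "nrm n (cutoff n x) = nrm n x"
  by (simp add: cutoff_def L2_set_def)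

lemma measurable_cutoff_PiM [measurable]: "cutoff n \<in> Pi\<^sub>M {..<n} (\<lambda>_. lborel) \<rightarrow>\<^sub>M borel"
proof -
  have "(\<lambda>x. cutoff n x j) \<in> borel_measurable (Pi\<^sub>M {..<n} (\<lambda>_. lborel))" for j
    using measurable_component_singleton[of j "{..<n}" "\<lambda>_. lborel :: real measure"]
    by (cases "j < n") (auto simp: cutoff_def)
  then show ?thesis by (subst borel_measurable_fun_iff) auto
qed

lemma lebesgue_Rn_eq: "lebesgue_Rn n = distr (Pi\<^sub>M {..<n} (\<lambda>_. lborel)) borel (cutoff n)"
  unfolding lebesgue_Rn_def by (rule distr_cong) (auto simp: cutoff_def)

lemma emeasure_lebesgue_Rn:
  "A \<in> sets borel \<Longrightarrow> emeasure (lebesgue_Rn n) A =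
    emeasure (Pi\<^sub>M {..<n} (\<lambda>_. lborel)) (cutoff n -` A \<inter> space (Pi\<^sub>M {..<n} (\<lambda>_. lborel)))"
  by (simp add: lebesgue_Rn_eq emeasure_distr)

lemma AE_lebesgue_Rn: "AE x in lebesgue_Rn n. x \<in> Rn n"
  unfolding lebesgue_Rn_eq by (subst AE_distr_iff) (auto simp: cutoff_Rn)

text \<open>The set is a cylinder in the function type rather than a ball, but
  \<open>lebesgue_Rn n\<close> is carried by \<open>Rn n\<close>, so the Euclidean ball volume
  applies. Cylinders are the convenient finite-measure exhausting sets below.\<close>

lemma emeasure_nrm_le:
  assumes "r > 0"
  shows "emeasure (lebesgue_Rn n) {x. nrm n x \<le> r} = ennreal (unit_ball_vol (real n) * r ^ n)"
proof -
  have "emeasure (lebesgue_Rn n) {x. nrm n x \<le> r} =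
     emeasure (Pi\<^sub>M {..<n} (\<lambda>_. lborel)) ({f. sqrt (\<Sum>i\<in>{..<n}. (f i)\<^sup>2) \<le> r} \<inter> space (Pi\<^sub>M {..<n} (\<lambda>_. lborel)))"
    by (subst emeasure_lebesgue_Rn) (auto simp: nrm_cutoff, auto simp: L2_set_def vimage_def nrm_cutoff[unfolded L2_set_def])
  also have "\<dots> = ennreal (unit_ball_vol (real n) * r ^ n)"
    by (subst emeasure_cball_aux) (use assms in auto)
  finally show ?thesis .
qed

lemma unit_ball_borel [measurable]: "unit_ball n \<in> sets borel"
  unfolding unit_ball_def by measurable

lemma emeasure_Int_Rn:
  "A \<in> sets borel \<Longrightarrow> emeasure (lebesgue_Rn n) (A \<inter> Rn n) = emeasure (lebesgue_Rn n) A"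
  by (rule emeasure_eq_AE) (use AE_lebesgue_Rn[of n] in auto)

lemma emeasure_ball:
  assumes "r > 0"
  shows "emeasure (lebesgue_Rn n) {x \<in> Rn n. nrm n x \<le> r} = ennreal (unit_ball_vol (real n) * r ^ n)"
proof -
  have "{x \<in> Rn n. nrm n x \<le> r} = {x. nrm n x \<le> r} \<inter> Rn n" by auto
  then show ?thesis
    using emeasure_Int_Rn[of "{x. nrm n x \<le> r}" n] emeasure_nrm_le[OF assms, of n] by simp
qed

lemma emeasure_unit_ball: "emeasure (lebesgue_Rn n) (unit_ball n) = ennreal (unit_ball_vol (real n))"
  using emeasure_ball[of 1 n] by (simp add: unit_ball_def)

lemma sigma_finite_lebesgue_Rn: "sigma_finite_measure (lebesgue_Rn n)"
proof
  let ?A = "range (\<lambda>N::nat. {x. nrm n x \<le> real (Suc N)})"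
  have "\<exists>N::nat. nrm n x \<le> 1 + real N" for x
  proof -
    obtain N :: nat where "nrm n x \<le> real N" using real_arch_simple by blast
    then show ?thesis by (intro exI[of _ N]) auto
  qed
  then have "\<Union> ?A = space (lebesgue_Rn n)" by auto
  moreover have "emeasure (lebesgue_Rn n) a \<noteq> \<infinity>" if "a \<in> ?A" for a
    using that emeasure_nrm_le by (auto simp del: of_nat_Suc)
  ultimately show "\<exists>A. countable A \<and> A \<subseteq> sets (lebesgue_Rn n) \<and> \<Union> A = space (lebesgue_Rn n) \<and>
      (\<forall>a\<in>A. emeasure (lebesgue_Rn n) a \<noteq> \<infinity>)"
    by (intro exI[of _ ?A]) auto
qed

interpretation lam: sigma_finite_measure "lebesgue_Rn n" for n
  by (rule sigma_finite_lebesgue_Rn)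

text \<open>One-dimensional Lebesgue measure is translation invariant and boxes determine the
  product measure; the result is then pushed forward along \<open>cutoff\<close>.\<close>

lemma lebesgue_Rn_translate:
  assumes "a \<in> Rn n"
  shows "distr (lebesgue_Rn n) borel (\<lambda>x. a + x) = lebesgue_Rn n"
proof -
  interpret product_sigma_finite "\<lambda>_::nat. lborel :: real measure"
    by (rule product_sigma_finite_lborel)
  let ?P = "Pi\<^sub>M {..<n} (\<lambda>_. lborel :: real measure)"
  let ?t = "\<lambda>x. \<lambda>i\<in>{..<n}. a i + x i"
  have t [measurable]: "?t \<in> ?P \<rightarrow>\<^sub>M ?P" by measurable
  have P: "distr ?P ?P ?t = ?P"
  proof (rule PiM_eqI)
    fix A :: "nat \<Rightarrow> real set" assume A: "\<And>i. i \<in> {..<n} \<Longrightarrow> A i \<in> sets lborel"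
    have "emeasure (distr ?P ?P ?t) (Pi\<^sub>E {..<n} A) = emeasure ?P (?t -` Pi\<^sub>E {..<n} A \<inter> space ?P)"
      by (rule emeasure_distr) (use A in \<open>auto intro!: sets_PiM_I_finite\<close>)
    also have "?t -` Pi\<^sub>E {..<n} A \<inter> space ?P = Pi\<^sub>E {..<n} (\<lambda>i. (\<lambda>x. a i + x) -` A i)"
      by (auto simp: space_PiM PiE_def Pi_def)
    also have "emeasure ?P \<dots> = (\<Prod>i<n. emeasure lborel ((\<lambda>x. a i + x) -` A i))"
    proof (rule emeasure_PiM)
      fix i assume "i \<in> {..<n}"
      then show "(\<lambda>x. a i + x) -` A i \<in> sets lborel"
        using measurable_sets[of "(+) (a i)" borel borel "A i"] A by auto
    qed simp
    also have "\<dots> = (\<Prod>i<n. emeasure lborel (A i))"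
    proof (rule prod.cong)
      fix i assume i: "i \<in> {..<n}"
      have "emeasure lborel (A i) = emeasure (distr lborel borel ((+) (a i))) (A i)"
        by (simp add: lborel_distr_plus)
      also have "\<dots> = emeasure lborel ((\<lambda>x. a i + x) -` A i)"
        by (subst emeasure_distr) (use A[OF i] in auto)
      finally show "emeasure lborel ((\<lambda>x. a i + x) -` A i) = emeasure lborel (A i)" by simp
    qed simp
    finally show "emeasure (distr ?P ?P ?t) (Pi\<^sub>E {..<n} A) = (\<Prod>i<n. emeasure lborel (A i))" .
  qed auto
  have "distr (lebesgue_Rn n) borel (\<lambda>x. a + x) = distr ?P borel (\<lambda>x. a + cutoff n x)"
    unfolding lebesgue_Rn_eq by (subst distr_distr) (auto simp: comp_def)
  also have "\<dots> = distr ?P borel (\<lambda>x. cutoff n (?t x))"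
    by (rule distr_cong) (use assms in \<open>auto simp: cutoff_def Rn_def fun_eq_iff\<close>)
  also have "\<dots> = distr (distr ?P ?P ?t) borel (cutoff n)"
    by (subst distr_distr) (auto simp: comp_def)
  also have "\<dots> = lebesgue_Rn n"
    using P by (simp add: lebesgue_Rn_eq)
  finally show ?thesis .
qed

text \<open>Uniqueness of Haar measure: shift one variable by the other in the product integral of the two indicators,
  using the invariance of each measure once.\<close>

lemma translation_invariant_proportional:
  fixes \<nu> :: "(nat \<Rightarrow> real) measure"
  assumes \<nu>: "sets \<nu> = sets borel" "sigma_finite_measure \<nu>" "AE x in \<nu>. x \<in> Rn n"
    and inv: "\<And>a. a \<in> Rn n \<Longrightarrow> distr \<nu> borel (\<lambda>x. a + x) = \<nu>"
    and Q [measurable]: "Q \<in> sets borel" and B [measurable]: "B \<in> sets borel"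
    and sym: "\<And>x. - x \<in> Q \<longleftrightarrow> x \<in> Q"
  shows "emeasure \<nu> Q * emeasure (lebesgue_Rn n) B = emeasure \<nu> B * emeasure (lebesgue_Rn n) Q"
proof -
  interpret \<nu>: sigma_finite_measure \<nu> by fact
  interpret pair_sigma_finite \<nu> "lebesgue_Rn n" ..
  note [measurable_cong] = \<nu>(1)
  have sp: "space \<nu> = UNIV" using sets_eq_imp_space_eq[OF \<nu>(1)] by simp
  let ?q = "indicator Q :: _ \<Rightarrow> ennreal" and ?b = "indicator B :: _ \<Rightarrow> ennreal"
  have tr: "(\<integral>\<^sup>+x. g (a + x) \<partial>M) = (\<integral>\<^sup>+x. g x \<partial>M)"
    if [measurable]: "g \<in> borel_measurable borel" and "distr M borel (\<lambda>x. a + x) = M" "sets M = sets borel"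
    for g a and M :: "(nat \<Rightarrow> real) measure"
  proof -
    have "(\<integral>\<^sup>+x. g x \<partial>M) = (\<integral>\<^sup>+x. g x \<partial>distr M borel (\<lambda>x. a + x))" by (simp add: that)
    also have "\<dots> = (\<integral>\<^sup>+x. g (a + x) \<partial>M)"
      by (rule nn_integral_distr) (auto simp: measurable_cong_sets[OF that(3) refl])
    finally show ?thesis by simp
  qed
  have "emeasure \<nu> Q * emeasure (lebesgue_Rn n) B = (\<integral>\<^sup>+x. ?q x * (\<integral>\<^sup>+y. ?b y \<partial>lebesgue_Rn n) \<partial>\<nu>)"
    by (simp add: nn_integral_multc \<nu>)
  also have "\<dots> = (\<integral>\<^sup>+x. (\<integral>\<^sup>+y. ?q x * ?b (x + y) \<partial>lebesgue_Rn n) \<partial>\<nu>)"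
  proof (rule nn_integral_cong_AE)
    show "AE x in \<nu>. ?q x * (\<integral>\<^sup>+y. ?b y \<partial>lebesgue_Rn n) = (\<integral>\<^sup>+y. ?q x * ?b (x + y) \<partial>lebesgue_Rn n)"
      using \<nu>(3) by eventually_elim (subst nn_integral_cmult, simp, subst tr[where g = ?b], auto intro: lebesgue_Rn_translate)
  qed
  also have "\<dots> = (\<integral>\<^sup>+y. (\<integral>\<^sup>+x. ?q x * ?b (x + y) \<partial>\<nu>) \<partial>lebesgue_Rn n)"
    by (rule Fubini'[symmetric]) measurable
  also have "\<dots> = (\<integral>\<^sup>+y. (\<integral>\<^sup>+x. ?q (x - y) * ?b x \<partial>\<nu>) \<partial>lebesgue_Rn n)"
  proof (rule nn_integral_cong_AE)
    show "AE y in lebesgue_Rn n. (\<integral>\<^sup>+x. ?q x * ?b (x + y) \<partial>\<nu>) = (\<integral>\<^sup>+x. ?q (x - y) * ?b x \<partial>\<nu>)"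
      using AE_lebesgue_Rn
    proof eventually_elim
      case (elim y)
      have "(\<integral>\<^sup>+x. ?q x * ?b (x + y) \<partial>\<nu>) = (\<integral>\<^sup>+x. ?q ((y + x) - y) * ?b (y + x) \<partial>\<nu>)"
        by (simp add: add.commute)
      also have "\<dots> = (\<integral>\<^sup>+x. ?q (x - y) * ?b x \<partial>\<nu>)"
        by (rule tr[where g = "\<lambda>x. ?q (x - y) * ?b x"]) (auto simp: \<nu> inv elim)
      finally show ?case .
    qed
  qed
  also have "\<dots> = (\<integral>\<^sup>+x. (\<integral>\<^sup>+y. ?q (x - y) * ?b x \<partial>lebesgue_Rn n) \<partial>\<nu>)"
    by (rule Fubini') measurable
  also have "\<dots> = (\<integral>\<^sup>+x. ?b x * (\<integral>\<^sup>+y. ?q y \<partial>lebesgue_Rn n) \<partial>\<nu>)"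
  proof (rule nn_integral_cong_AE)
    \<comment> \<open>This is where symmetry of \<open>Q\<close> enters: with \<open>- x + y\<close>
      in place of \<open>x - y\<close>, the inner integral over \<open>y\<close> is a translate of
      the indicator of \<open>Q\<close>.\<close>
    have q: "?q (x - y) = ?q (- x + y)" for x y
      using sym[of "x - y"] by (auto simp: indicator_def)
    show "AE x in \<nu>. (\<integral>\<^sup>+y. ?q (x - y) * ?b x \<partial>lebesgue_Rn n) = ?b x * (\<integral>\<^sup>+y. ?q y \<partial>lebesgue_Rn n)"
      using \<nu>(3) unfolding q
      by eventually_elim (subst nn_integral_multc, simp, subst tr[where g = ?q], auto intro: lebesgue_Rn_translate simp: mult.commute)
  qed
  also have "\<dots> = emeasure \<nu> B * emeasure (lebesgue_Rn n) Q"
    by (simp add: nn_integral_multc \<nu>)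
  finally show ?thesis .
qed

section \<open>Change of variables under invertible linear maps\<close>

lemma lmap_inverse:
  assumes bij: "bij_betw (lmap n u) (Rn n) (Rn n)"
  obtains v where "\<And>i. i < n \<Longrightarrow> v i \<in> Rn n"
    "\<And>x. x \<in> Rn n \<Longrightarrow> lmap n v (lmap n u x) = x"
    "\<And>x. x \<in> Rn n \<Longrightarrow> lmap n u (lmap n v x) = x"
proof
  let ?v = "\<lambda>i. inv_into (Rn n) (lmap n u) (evec i)"
  have v: "?v i \<in> Rn n" "lmap n u (?v i) = evec i" if "i < n" for i
    using bij evec_Rn[OF that] by (auto simp: bij_betw_def intro: inv_into_into) (auto simp: f_inv_into_f)
  have uv: "lmap n u (lmap n ?v x) = x" if "x \<in> Rn n" for x
  proof -
    have "lmap n u (lmap n ?v x) = lmap n (\<lambda>i. lmap n u (?v i)) x" by (rule lmap_lmap)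
    also have "\<dots> = lmap n evec x" unfolding lmap_def[of n] by (intro sum.cong) (auto simp: v(2)[unfolded lmap_def])
    finally show ?thesis using Rn_expand[OF that] by simp
  qed
  show "lmap n ?v (lmap n u x) = x" if x: "x \<in> Rn n" for x
  proof -
    have "lmap n u x \<in> Rn n" using bij x by (auto simp: bij_betw_def)
    then have "lmap n u (lmap n ?v (lmap n u x)) = lmap n u x" by (rule uv)
    moreover have "lmap n ?v (lmap n u x) \<in> Rn n" by (rule lmap_Rn) (rule v)
    ultimately show ?thesis using bij x by (auto simp: bij_betw_def dest: inj_onD)
  qed
  show "?v i \<in> Rn n" if "i < n" for i by (rule v(1)[OF that])
  show "lmap n u (lmap n ?v x) = x" if "x \<in> Rn n" for x by (rule uv[OF that])
qed

lemma nn_integral_translate: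
  assumes "a \<in> Rn n" and [measurable]: "g \<in> borel_measurable borel"
  shows "(\<integral>\<^sup>+x. g (a + x) \<partial>lebesgue_Rn n) = (\<integral>\<^sup>+x. g x \<partial>lebesgue_Rn n)"
proof -
  have "(\<integral>\<^sup>+x. g x \<partial>lebesgue_Rn n) = (\<integral>\<^sup>+x. g x \<partial>distr (lebesgue_Rn n) borel (\<lambda>x. a + x))"
    by (simp add: lebesgue_Rn_translate assms)
  also have "\<dots> = (\<integral>\<^sup>+x. g (a + x) \<partial>lebesgue_Rn n)"
    by (rule nn_integral_distr) auto
  finally show ?thesis by simp
qed

text \<open>The push-forward of Lebesgue measure under an invertible linear map is again translation
  invariant, since each translation vector is the image of one; uniqueness of Haar measure then
  yields the factor.\<close>

lemma emeasure_lmap_proportional: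
  assumes bij: "bij_betw (lmap n u) (Rn n) (Rn n)"
  shows "\<exists>\<kappa>::real. \<kappa> > 0 \<and> (\<forall>B\<in>sets borel. emeasure (lebesgue_Rn n) (lmap n u -` B) =
    ennreal \<kappa> * emeasure (lebesgue_Rn n) B)"
proof -
  let ?L = "lebesgue_Rn n"
  let ?N = "distr ?L borel (lmap n u)"
  obtain v where v: "\<And>i. i < n \<Longrightarrow> v i \<in> Rn n"
    "\<And>x. x \<in> Rn n \<Longrightarrow> lmap n v (lmap n u x) = x"
    "\<And>x. x \<in> Rn n \<Longrightarrow> lmap n u (lmap n v x) = x"
    using lmap_inverse[OF bij] by metis
  have uR: "lmap n u x \<in> Rn n" if "x \<in> Rn n" for x using bij that by (auto simp: bij_betw_def)
  have \<nu>: "emeasure ?N B = emeasure ?L (lmap n u -` B)" if "B \<in> sets borel" for B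
    using that by (subst emeasure_distr) auto
  \<comment> \<open>The images of balls under the map. Their push-forward measure is the volume of a
    ball, which gives sigma-finiteness and later keeps the factor away from 0 and infinity.\<close>
  let ?C = "\<lambda>N::nat. {y. nrm n (lmap n v y) \<le> real (Suc N)}"
  have C: "?C N \<in> sets borel" for N by measurable
  have C\<nu>: "emeasure ?N (?C N) = emeasure ?L {x. nrm n x \<le> real (Suc N)}" for N
    unfolding \<nu>[OF C]
  proof (rule emeasure_eq_AE)
    show "AE x in ?L. (x \<in> lmap n u -` ?C N) = (x \<in> {x. nrm n x \<le> real (Suc N)})"
      using AE_lebesgue_Rn by eventually_elim (auto simp: v)
    show "lmap n u -` ?C N \<in> sets (lebesgue_Rn n)"
      using measurable_sets[of "lmap n u" borel borel "?C N"] C by simp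
  qed auto
  have Cfin: "emeasure ?N (?C N) < \<infinity>" for N
    unfolding C\<nu> by (subst emeasure_nrm_le) auto
  have sf: "sigma_finite_measure ?N"
  proof
    have "\<exists>N::nat. nrm n x \<le> real (Suc N)" for x
    proof -
      obtain N :: nat where "nrm n x \<le> real N" using real_arch_simple by blast
      then show ?thesis by (intro exI[of _ N]) auto
    qed
    then have "\<Union> (range ?C) = space ?N" by auto
    then show "\<exists>A. countable A \<and> A \<subseteq> sets ?N \<and> \<Union> A = space ?N \<and>
      (\<forall>a\<in>A. emeasure ?N a \<noteq> \<infinity>)"
      using Cfin C by (intro exI[of _ "range ?C"]) (auto simp: less_top[symmetric] simp del: of_nat_Suc)
  qed
  have inv: "distr ?N borel (\<lambda>x. a + x) = ?N" if a: "a \<in> Rn n" for a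
  proof -
    have "lmap n v a \<in> Rn n" by (rule lmap_Rn) (rule v)
    have "distr ?N borel (\<lambda>x. a + x) = distr ?L borel (\<lambda>x. a + lmap n u x)"
      by (subst distr_distr) (auto simp: comp_def)
    also have "(\<lambda>x. a + lmap n u x) = (\<lambda>x. lmap n u (lmap n v a + x))"
      by (simp add: lmap_lin v a)
    also have "distr ?L borel \<dots> = distr (distr ?L borel (\<lambda>x. lmap n v a + x)) borel (lmap n u)"
      by (subst distr_distr) (auto simp: comp_def)
    finally show ?thesis unfolding lebesgue_Rn_translate[OF \<open>lmap n v a \<in> Rn n\<close>] .
  qed
  let ?Q = "{x. nrm n x \<le> 1}"
  have AE: "AE x in (?N). x \<in> Rn n"
  proof (subst AE_distr_iff)
    show "AE x in lebesgue_Rn n. lmap n u x \<in> Rn n"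
      by (rule eventually_mono[OF AE_lebesgue_Rn]) (rule uR)
    show "{x \<in> space borel. x \<in> Rn n} \<in> sets borel" by simp
  qed simp
  have ratio: "emeasure ?N ?Q * emeasure ?L B = emeasure ?N B * emeasure ?L ?Q" if "B \<in> sets borel" for B
    by (rule translation_invariant_proportional[OF _ sf AE inv]) (use that in auto)
  define q where "q = unit_ball_vol (real n)"
  have q: "q > 0" "emeasure ?L ?Q = ennreal q"
    using emeasure_nrm_le[of 1 n] by (auto simp: q_def)
  \<comment> \<open>If the push-forward gave \<open>?Q\<close> infinite mass, the ratio identity at
    \<open>?C 0\<close> would force \<open>?C 0\<close> to be Lebesgue null, and the same identity
    would then read 0 = \<open>q\<close> * \<open>q\<close>.\<close>
  have fin: "emeasure ?N ?Q < \<infinity>"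
  proof (rule ccontr)
    assume "\<not> ?thesis"
    then have "emeasure ?N ?Q = \<infinity>" by (simp add: less_top[symmetric])
    then have "\<infinity> * emeasure ?L (?C 0) = emeasure ?N (?C 0) * ennreal q" using ratio[OF C[of 0]] q by simp
    also have "\<dots> < \<infinity>" using Cfin[of 0] by (simp add: ennreal_mult_less_top)
    finally have 0: "emeasure ?L (?C 0) = 0"
      by (auto simp: ennreal_top_mult split: if_splits)
    have "emeasure ?N (?C 0) = ennreal q" using C\<nu>[of 0] q by simp
    then have "emeasure ?N ?Q * 0 = ennreal q * ennreal q" using ratio[OF C[of 0]] q 0 by simp
    then show False using q by (simp add: ennreal_mult[symmetric])
  qed
  have pos: "emeasure ?N ?Q > 0"
  proof (rule ccontr)
    assume "\<not> ?thesis"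
    then have "emeasure ?N ?Q = 0" by simp
    then have "emeasure ?N (?C 0) * ennreal q = 0" using ratio[OF C[of 0]] q by simp
    moreover have "emeasure ?N (?C 0) = ennreal q" using C\<nu>[of 0] q by simp
    ultimately show False using q by simp
  qed
  define p where "p = enn2real (emeasure ?N ?Q)"
  have p: "emeasure ?N ?Q = ennreal p" using fin by (simp add: p_def)
  then have "p > 0" using pos by (simp add: ennreal_less_zero_iff)
  show ?thesis
  proof (intro exI[of _ "p / q"] conjI ballI)
    show "p / q > 0" using \<open>p > 0\<close> q by simp
    fix B :: "(nat \<Rightarrow> real) set" assume B: "B \<in> sets borel"
    have "ennreal (p / q) * emeasure ?L B = ennreal (1 / q) * (ennreal p * emeasure ?L B)"
      using \<open>p > 0\<close> q by (simp add: mult.assoc[symmetric] ennreal_mult[symmetric])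
    also have "\<dots> = ennreal (1 / q) * (ennreal q * emeasure ?N B)"
      using ratio[OF B] q p by (simp add: mult.commute)
    also have "\<dots> = emeasure ?N B"
      using q by (simp add: mult.assoc[symmetric] ennreal_mult[symmetric])
    finally show "emeasure ?L (lmap n u -` B) = ennreal (p / q) * emeasure ?L B"
      using \<nu>[OF B] by simp
  qed
qed

lemma nn_integral_proportional:
  fixes f :: "(nat \<Rightarrow> real) \<Rightarrow> nat \<Rightarrow> real"
  assumes f [measurable]: "f \<in> borel_measurable borel"
    and k: "\<And>B. B \<in> sets borel \<Longrightarrow> emeasure (lebesgue_Rn n) (f -` B) = \<kappa> * emeasure (lebesgue_Rn n) B"
    and [measurable]: "g \<in> borel_measurable borel"
  shows "(\<integral>\<^sup>+x. g (f x) \<partial>lebesgue_Rn n) = \<kappa> * (\<integral>\<^sup>+x. g x \<partial>lebesgue_Rn n)"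
proof -
  have "distr (lebesgue_Rn n) borel f = scale_measure \<kappa> (lebesgue_Rn n)"
    by (rule measure_eqI) (auto simp: emeasure_distr k)
  then have "(\<integral>\<^sup>+x. g x \<partial>distr (lebesgue_Rn n) borel f) = \<kappa> * (\<integral>\<^sup>+x. g x \<partial>lebesgue_Rn n)"
    by (simp add: nn_integral_scale_measure)
  then show ?thesis by (subst (asm) nn_integral_distr) auto
qed

lemma nn_integral_lmap:
  assumes "bij_betw (lmap n u) (Rn n) (Rn n)"
  obtains \<kappa> :: real where "\<kappa> > 0" "\<And>g. g \<in> borel_measurable borel \<Longrightarrow>
    (\<integral>\<^sup>+x. g (lmap n u x) \<partial>lebesgue_Rn n) = ennreal \<kappa> * (\<integral>\<^sup>+x. g x \<partial>lebesgue_Rn n)"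
  using emeasure_lmap_proportional[OF assms] nn_integral_proportional[OF measurable_lmap] by metis

text \<open>The unknown factor is read off from the unit ball, whose preimage is the ball of radius
  \<open>1 / s\<close>.\<close>

lemma nn_integral_similarity:
  assumes bij: "bij_betw (lmap n u) (Rn n) (Rn n)" and s: "s > 0"
    and sim: "\<And>x. x \<in> Rn n \<Longrightarrow> nrm n (lmap n u x) = s * nrm n x"
    and g: "g \<in> borel_measurable borel"
  shows "(\<integral>\<^sup>+x. g (lmap n u x) \<partial>lebesgue_Rn n) = ennreal (1 / s ^ n) * (\<integral>\<^sup>+x. g x \<partial>lebesgue_Rn n)"
proof -
  obtain \<kappa> :: real where k: "\<kappa> > 0" "\<And>g. g \<in> borel_measurable borel \<Longrightarrow>
    (\<integral>\<^sup>+x. g (lmap n u x) \<partial>lebesgue_Rn n) = ennreal \<kappa> * (\<integral>\<^sup>+x. g x \<partial>lebesgue_Rn n)"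
    using nn_integral_lmap[OF bij] by metis
  define q where "q = unit_ball_vol (real n)"
  have q: "q > 0" by (simp add: q_def)
  have "ennreal \<kappa> * ennreal q = (\<integral>\<^sup>+x. indicator {x. nrm n x \<le> 1} (lmap n u x) \<partial>lebesgue_Rn n)"
    using emeasure_nrm_le[of 1 n] by (subst k) (auto simp: q_def)
  also have "\<dots> = (\<integral>\<^sup>+x. indicator {x. nrm n x \<le> 1 / s} x \<partial>lebesgue_Rn n)"
    by (rule nn_integral_cong_AE)
      (rule eventually_mono[OF AE_lebesgue_Rn], use s in \<open>auto simp: indicator_def sim field_simps\<close>)
  also have "\<dots> = ennreal (q * (1 / s) ^ n)"
    using emeasure_nrm_le[of "1 / s" n] s by (simp add: q_def)
  finally have "\<kappa> * q = q * (1 / s) ^ n"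
    using k(1) q s by (simp add: ennreal_mult[symmetric])
  then have "\<kappa> * q = (1 / s ^ n) * q" by (simp add: power_divide)
  then have "\<kappa> = 1 / s ^ n" using q by (simp only: mult_right_cancel)
  then show ?thesis using k(2)[OF g] by simp
qed

lemma nn_integral_scaleR:
  assumes r: "r > 0" and g: "g \<in> borel_measurable borel"
  shows "(\<integral>\<^sup>+x. g (r *\<^sub>R x) \<partial>lebesgue_Rn n) = ennreal (1 / r ^ n) * (\<integral>\<^sup>+x. g x \<partial>lebesgue_Rn n)"
proof -
  let ?u = "\<lambda>i. r *\<^sub>R evec i"
  have eq: "lmap n ?u x = r *\<^sub>R x" if "x \<in> Rn n" for x
    using linear_eq_lmap[OF linear_scaleR that] by simp
  have "(\<integral>\<^sup>+x. g (r *\<^sub>R x) \<partial>lebesgue_Rn n) = (\<integral>\<^sup>+x. g (lmap n ?u x) \<partial>lebesgue_Rn n)"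
    by (rule nn_integral_cong_AE, rule eventually_mono[OF AE_lebesgue_Rn]) (simp add: eq)
  also have "\<dots> = ennreal (1 / r ^ n) * (\<integral>\<^sup>+x. g x \<partial>lebesgue_Rn n)"
  proof (rule nn_integral_similarity[OF _ r _ g])
    have "bij_betw (\<lambda>x. r *\<^sub>R x) (Rn n) (Rn n)"
      by (rule bij_betw_byWitness[where f' = "\<lambda>x. (1 / r) *\<^sub>R x"]) (use r in auto)
    then show "bij_betw (lmap n ?u) (Rn n) (Rn n)"
      by (subst bij_betw_cong[OF eq]) auto
    show "nrm n (lmap n ?u x) = r * nrm n x" if "x \<in> Rn n" for x
      using r by (simp add: eq[OF that] nrm_scale)
  qed
  finally show ?thesis .
qed

lemma nn_integral_isometry:
  assumes "bij_betw (lmap n u) (Rn n) (Rn n)" "\<And>x. x \<in> Rn n \<Longrightarrow> nrm n (lmap n u x) = nrm n x"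
    and "g \<in> borel_measurable borel"
  shows "(\<integral>\<^sup>+x. g (lmap n u x) \<partial>lebesgue_Rn n) = (\<integral>\<^sup>+x. g x \<partial>lebesgue_Rn n)"
  using nn_integral_similarity[OF assms(1), of 1 g] assms(2,3) by simp

section \<open>Products\<close>

lemma glue_Rn: "y \<in> Rn k \<Longrightarrow> glue m z y \<in> Rn (m + k)"
  by (auto simp: glue_def Rn_def)

lemma glue_lin:
  "glue m (z + z') (y + y') = glue m z y + glue m z' y'"
  "glue m (r *\<^sub>R z) (r *\<^sub>R y) = r *\<^sub>R glue m z y"
  "glue m (- z) (- y) = - glue m z y"
  by (auto simp: glue_def)

lemma sum_glue: "(\<Sum>i<m + k. f i) = (\<Sum>i<m. f i) + (\<Sum>i<k. f (m + i))" for f :: "nat \<Rightarrow> 'a::comm_monoid_add"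
proof -
  have "(\<Sum>i<m + k. f i) = sum f {..<m} + sum f {m..<m + k}"
    by (subst sum.union_disjoint[symmetric]) (auto intro: sum.cong)
  also have "sum f {m..<m + k} = (\<Sum>i<k. f (m + i))"
    using sum.shift_bounds_nat_ivl[of f 0 m k] by (simp add: add.commute lessThan_atLeast0)
  finally show ?thesis .
qed

lemma ip_glue: "ip (m + k) (glue m z y) (glue m z' y') = ip m z z' + ip k y y'"
  unfolding ip_def sum_glue by (simp add: glue_def)

lemma glue_shiftn: "glue m (cutoff m x) (shiftn m x) = x"
  by (auto simp: glue_def cutoff_def shiftn_def)

lemma shiftn_Rn: "x \<in> Rn (m + k) \<Longrightarrow> shiftn m x \<in> Rn k"
  by (auto simp: Rn_def shiftn_def)

text \<open>A symmetric test set that splits under \<open>glue\<close>; it normalises the uniqueness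
  theorem in \<open>nn_integral_glue\<close>.\<close>

lemma emeasure_cube: "emeasure (lebesgue_Rn n) {x. \<forall>i<n. \<bar>x i\<bar> \<le> 1} = 2 ^ n"
proof -
  interpret product_sigma_finite "\<lambda>_::nat. lborel :: real measure"
    by (rule product_sigma_finite_lborel)
  have *: "{x :: nat \<Rightarrow> real. \<forall>i<n. \<bar>x i\<bar> \<le> 1} \<in> sets borel" by measurable
  let ?P = "Pi\<^sub>M {..<n} (\<lambda>_. lborel :: real measure)"
  have eq: "cutoff n -` {x. \<forall>i<n. \<bar>x i\<bar> \<le> 1} \<inter> space ?P = Pi\<^sub>E {..<n} (\<lambda>_. {-1..1})"
  proof -
    have "\<bar>a\<bar> \<le> 1 \<longleftrightarrow> a \<in> {-1..1}" for a :: real by auto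
    then show ?thesis unfolding cutoff_def space_PiM PiE_def Pi_def vimage_def by simp
  qed
  have "emeasure (lebesgue_Rn n) {x. \<forall>i<n. \<bar>x i\<bar> \<le> 1} = emeasure ?P (Pi\<^sub>E {..<n} (\<lambda>_. {-1..1::real}))"
    unfolding emeasure_lebesgue_Rn[OF *] eq ..
  also have "\<dots> = (\<Prod>i<n. emeasure lborel {-1..1::real})" by (rule emeasure_PiM) auto
  also have "\<dots> = 2 ^ n" by simp
  finally show ?thesis .
qed

text \<open>The product measure pushed forward along \<open>glue\<close> is translation invariant
  and gives the cube its Lebesgue mass, so it is Lebesgue measure by uniqueness.\<close>

lemma nn_integral_glue:
  assumes [measurable]: "g \<in> borel_measurable borel"
  shows "(\<integral>\<^sup>+x. g x \<partial>lebesgue_Rn (m + k)) =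
    (\<integral>\<^sup>+y. (\<integral>\<^sup>+z. g (glue m z y) \<partial>lebesgue_Rn m) \<partial>lebesgue_Rn k)"
proof -
  interpret pair_sigma_finite "lebesgue_Rn m" "lebesgue_Rn k" ..
  let ?M = "lebesgue_Rn m \<Otimes>\<^sub>M lebesgue_Rn k"
  let ?G = "\<lambda>(z, y). glue m z y"
  let ?n = "m + k"
  define \<nu> where "\<nu> = distr ?M borel ?G"
  have G: "?G \<in> borel_measurable ?M" by measurable
  have I: "(\<integral>\<^sup>+x. g x \<partial>\<nu>) = (\<integral>\<^sup>+y. (\<integral>\<^sup>+z. g (glue m z y) \<partial>lebesgue_Rn m) \<partial>lebesgue_Rn k)"
    if [measurable]: "g \<in> borel_measurable borel" for g
    unfolding \<nu>_def by (subst nn_integral_distr[OF G]) (simp, subst nn_integral_snd[symmetric], auto)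
  have s\<nu>: "sets \<nu> = sets borel" by (simp add: \<nu>_def)
  have sp: "space \<nu> = UNIV" by (simp add: \<nu>_def)
  have cube: "emeasure \<nu> {x. \<forall>i<?n. \<bar>x i\<bar> \<le> 1} = 2 ^ ?n"
  proof -
    have [measurable]: "{x :: nat \<Rightarrow> real. \<forall>i<n. \<bar>x i\<bar> \<le> 1} \<in> sets borel" for n by measurable
    have *: "indicator {x. \<forall>i<?n. \<bar>x i\<bar> \<le> 1} (glue m z y) =
      (indicator {x. \<forall>i<m. \<bar>x i\<bar> \<le> 1} z * indicator {x. \<forall>i<k. \<bar>x i\<bar> \<le> 1} y :: ennreal)" for z y
    proof -
      have "(\<forall>i<?n. \<bar>glue m z y i\<bar> \<le> 1) \<longleftrightarrow> (\<forall>i<m. \<bar>z i\<bar> \<le> 1) \<and> (\<forall>i<k. \<bar>y i\<bar> \<le> 1)"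
      proof (intro iffI conjI allI impI)
        fix i assume *: "\<forall>i<?n. \<bar>glue m z y i\<bar> \<le> 1"
        { assume "i < m" then show "\<bar>z i\<bar> \<le> 1" using *[rule_format, of i] by (simp add: glue_def) }
        { assume "i < k" then show "\<bar>y i\<bar> \<le> 1" using *[rule_format, of "m + i"] by (simp add: glue_def) }
      next
        fix i assume "(\<forall>i<m. \<bar>z i\<bar> \<le> 1) \<and> (\<forall>i<k. \<bar>y i\<bar> \<le> 1)" "i < ?n"
        then show "\<bar>glue m z y i\<bar> \<le> 1" by (auto simp: glue_def)
      qed
      then show ?thesis by (auto simp: indicator_def)
    qed
    have "emeasure \<nu> {x. \<forall>i<?n. \<bar>x i\<bar> \<le> 1} = (\<integral>\<^sup>+x. indicator {x. \<forall>i<?n. \<bar>x i\<bar> \<le> 1} x \<partial>\<nu>)"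
      by (subst nn_integral_indicator) (auto simp: s\<nu>)
    also have "\<dots> = 2 ^ m * 2 ^ k"
      by (subst I) (simp_all add: * nn_integral_multc nn_integral_cmult emeasure_cube)
    finally show ?thesis by (simp add: power_add)
  qed
  have sf: "sigma_finite_measure \<nu>"
  proof
    let ?C = "\<lambda>N::nat. {x. nrm m x \<le> real (Suc N) \<and> nrm k (shiftn m x) \<le> real (Suc N)}"
    have C: "?C N \<in> sets borel" for N by measurable
    have "emeasure \<nu> (?C N) < \<infinity>" for N
    proof -
      have *: "indicator (?C N) (glue m z y) = 
        (indicator {x. nrm m x \<le> real (Suc N)} z * indicator {x. nrm k x \<le> real (Suc N)} y :: ennreal)" for z y
        by (simp add: indicator_def glue_def shiftn_def L2_set_def)
      have "emeasure \<nu> (?C N) = (\<integral>\<^sup>+x. indicator (?C N) x \<partial>\<nu>)"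
        using C by (subst nn_integral_indicator) (auto simp: s\<nu>)
      also have "\<dots> = emeasure (lebesgue_Rn m) {x. nrm m x \<le> real (Suc N)} * emeasure (lebesgue_Rn k) {x. nrm k x \<le> real (Suc N)}"
        using C by (subst I) (simp_all add: * nn_integral_multc nn_integral_cmult del: of_nat_Suc)
      also have "\<dots> < \<infinity>" by (subst (1 2) emeasure_nrm_le) (auto simp: ennreal_mult_less_top)
      finally show ?thesis .
    qed
    moreover have "\<exists>N::nat. nrm m x \<le> real (Suc N) \<and> nrm k (shiftn m x) \<le> real (Suc N)" for x
    proof -
      obtain N :: nat where "max (nrm m x) (nrm k (shiftn m x)) \<le> real N" using real_arch_simple by blast
      then show ?thesis by (intro exI[of _ N]) auto
    qed
    then have "\<Union> (range ?C) = space \<nu>" by (auto simp: sp simp del: of_nat_Suc)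
    ultimately show "\<exists>A. countable A \<and> A \<subseteq> sets \<nu> \<and> \<Union> A = space \<nu> \<and> (\<forall>a\<in>A. emeasure \<nu> a \<noteq> \<infinity>)"
      using C by (intro exI[of _ "range ?C"]) (auto simp: less_top[symmetric] s\<nu> simp del: of_nat_Suc)
  qed
  have AE: "AE x in \<nu>. x \<in> Rn ?n"
  proof -
    have "AE p in ?M. ?G p \<in> Rn ?n"
    proof (rule AE_pair_measure)
      show "{p \<in> space ?M. ?G p \<in> Rn ?n} \<in> sets ?M" by measurable
      show "AE z in lebesgue_Rn m. AE y in lebesgue_Rn k. ?G (z, y) \<in> Rn ?n"
        by (rule AE_I2, rule eventually_mono[OF AE_lebesgue_Rn]) (simp add: glue_Rn)
    qed
    then show ?thesis
      unfolding \<nu>_def by (subst AE_distr_iff) auto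
  qed
  have inv: "distr \<nu> borel (\<lambda>x. a + x) = \<nu>" if a: "a \<in> Rn ?n" for a
  proof (rule measure_eqI)
    let ?y = "shiftn m a"
    have ga: "a = glue m (cutoff m a) ?y" by (simp add: glue_shiftn)
    have y: "?y \<in> Rn k" using a by (rule shiftn_Rn)
    fix A assume "A \<in> sets (distr \<nu> borel (\<lambda>x. a + x))"
    then have [measurable]: "A \<in> sets borel" by simp
    have [measurable]: "(\<lambda>x. a + x) \<in> \<nu> \<rightarrow>\<^sub>M borel" by (simp add: measurable_cong_sets[OF s\<nu> refl])
    have "emeasure (distr \<nu> borel (\<lambda>x. a + x)) A = (\<integral>\<^sup>+x. indicator A x \<partial>distr \<nu> borel (\<lambda>x. a + x))" 
      by (subst nn_integral_indicator) auto
    also have "\<dots> = (\<integral>\<^sup>+x. indicator A (a + x) \<partial>\<nu>)" by (rule nn_integral_distr) auto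
    also have "\<dots> = (\<integral>\<^sup>+y. (\<integral>\<^sup>+z. indicator A (a + glue m z y) \<partial>lebesgue_Rn m) \<partial>lebesgue_Rn k)"
      by (rule I) simp
    also have "\<dots> = (\<integral>\<^sup>+y. (\<integral>\<^sup>+z. indicator A (glue m (cutoff m a + z) (?y + y)) \<partial>lebesgue_Rn m) \<partial>lebesgue_Rn k)"
      by (subst (1) ga) (simp only: glue_lin)
    also have "\<dots> = (\<integral>\<^sup>+y. (\<integral>\<^sup>+z. indicator A (glue m z (?y + y)) \<partial>lebesgue_Rn m) \<partial>lebesgue_Rn k)"
      by (rule nn_integral_cong, rule nn_integral_translate[OF cutoff_Rn]) measurable
    also have "\<dots> = (\<integral>\<^sup>+y. (\<integral>\<^sup>+z. indicator A (glue m z y) \<partial>lebesgue_Rn m) \<partial>lebesgue_Rn k)"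
      by (rule nn_integral_translate[OF y, of "\<lambda>y. \<integral>\<^sup>+z. indicator A (glue m z y) \<partial>lebesgue_Rn m"]) measurable
    also have "\<dots> = (\<integral>\<^sup>+x. indicator A x \<partial>\<nu>)" by (rule I[symmetric]) simp
    also have "\<dots> = emeasure \<nu> A" by (subst nn_integral_indicator) (auto simp: s\<nu>)
    finally show "emeasure (distr \<nu> borel (\<lambda>x. a + x)) A = emeasure \<nu> A" .
  qed (simp add: s\<nu>)
  have "\<nu> = lebesgue_Rn ?n"
  proof (rule measure_eqI)
    fix A assume "A \<in> sets \<nu>"
    then have A: "A \<in> sets borel" by (simp add: s\<nu>)
    let ?Q = "{x :: nat \<Rightarrow> real. \<forall>i<?n. \<bar>x i\<bar> \<le> 1}"
    have Q: "?Q \<in> sets borel" by measurable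
    have "emeasure \<nu> ?Q * emeasure (lebesgue_Rn ?n) A = emeasure \<nu> A * emeasure (lebesgue_Rn ?n) ?Q"
      by (rule translation_invariant_proportional[OF s\<nu> sf AE inv Q A]) auto
    then have "2 ^ ?n * emeasure (lebesgue_Rn ?n) A = 2 ^ ?n * emeasure \<nu> A"
      by (simp only: cube emeasure_cube mult.commute)
    moreover have "(2::ennreal) ^ ?n \<noteq> 0" "(2::ennreal) ^ ?n \<noteq> top"
      by (auto simp: power_eq_top_ennreal)
    ultimately show "emeasure \<nu> A = emeasure (lebesgue_Rn ?n) A"
      by (metis ennreal_mult_cancel_left)
  qed (simp add: s\<nu>)
  with I[of g] show ?thesis by simp
qed

section \<open>Polar coordinates\<close>

text \<open>The value at points of norm zero only serves to make \<open>dirn n\<close> map into the sphere everywhere.\<close>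

definition dirn :: "nat \<Rightarrow> (nat \<Rightarrow> real) \<Rightarrow> nat \<Rightarrow> real"
  where "dirn n x = (if nrm n x = 0 then evec 0 else (1 / nrm n x) *\<^sub>R cutoff n x)"

lemma measurable_dirn [measurable]: "dirn n \<in> borel_measurable borel"
  unfolding dirn_def by measurable

lemma dirn_sphere:
  assumes "n \<ge> 1"
  shows "dirn n x \<in> Rn n" "nrm n (dirn n x) = 1"
  using assms by (auto simp: dirn_def evec_Rn nrm_evec cutoff_Rn nrm_scale nrm_cutoff)

lemma dirn_eq: "x \<in> Rn n \<Longrightarrow> x \<noteq> 0 \<Longrightarrow> dirn n x = (1 / nrm n x) *\<^sub>R x"
  using nrm_eq_0[of x n] by (simp add: dirn_def cutoff_id)

lemma AE_nrm_pos:
  assumes "n \<ge> 1" shows "AE x in lebesgue_Rn n. nrm n x > 0"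
proof -
  have *: "emeasure (lebesgue_Rn n) {x. nrm n x \<le> 0} \<le> ennreal (unit_ball_vol (real n) * (1 / real (Suc k)) ^ n)" for k
  proof -
    have "emeasure (lebesgue_Rn n) {x. nrm n x \<le> 0} \<le> emeasure (lebesgue_Rn n) {x. nrm n x \<le> 1 / real (Suc k)}"
      by (rule emeasure_mono) (auto intro: order.trans)
    then show ?thesis using emeasure_nrm_le[of "1 / real (Suc k)" n] by simp
  qed
  have "(\<lambda>k. unit_ball_vol (real n) * (1 / real (Suc k)) ^ n) \<longlonglongrightarrow> unit_ball_vol (real n) * 0 ^ n"
    by (intro tendsto_intros) (rule LIMSEQ_inverse_real_of_nat[unfolded inverse_eq_divide])
  then have "(\<lambda>k. ennreal (unit_ball_vol (real n) * (1 / real (Suc k)) ^ n)) \<longlonglongrightarrow> ennreal 0"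
    using assms by (intro tendsto_ennrealI) (simp add: power_0_left)
  from LIMSEQ_le_const[OF this] * have "emeasure (lebesgue_Rn n) {x. nrm n x \<le> 0} \<le> ennreal 0"
    by blast
  then have "{x. nrm n x \<le> 0} \<in> null_sets (lebesgue_Rn n)"
    by (intro null_setsI) auto
  from AE_not_in[OF this] show ?thesis by eventually_elim (auto simp: not_le)
qed

lemma nn_integral_inverse_power:
  assumes "a > 0" "n \<ge> 1"
  shows "(\<integral>\<^sup>+t. ennreal (1 / t ^ Suc n) * indicator {a..} t \<partial>lborel) = ennreal (1 / (real n * a ^ n))"
proof -
  have "(\<integral>\<^sup>+t. ennreal (1 / t ^ Suc n) * indicator {a..} t \<partial>lborel) = ennreal (0 - (- 1 / (real n * a ^ n)))"
  proof (rule nn_integral_FTC_atLeast)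
    show "(\<lambda>t::real. 1 / t ^ Suc n) \<in> borel_measurable borel" by measurable
    fix x assume x: "a \<le> x"
    show "0 \<le> 1 / x ^ Suc n" using x assms by simp
    obtain k where k: "n = Suc k" using assms(2) by (cases n) auto
    have "((\<lambda>x. - 1 / (real n * x ^ n)) has_real_derivative 
      (1 / (real n * x ^ n)\<^sup>2 * (real n * (real n * x ^ (n - 1))))) (at x)"
      using x assms by (auto intro!: derivative_eq_intros simp: power2_eq_square)
    moreover have "1 / (real n * x ^ n)\<^sup>2 * (real n * (real n * x ^ (n - 1))) = 1 / x ^ Suc n"
    proof -
      have "1 / (N * (x * z))\<^sup>2 * (N * (N * z)) = 1 / (x * (x * z))" if "N > 0" "z > 0" for N z :: real
        using that x assms by (simp add: power2_eq_square field_simps)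
      from this[of "real n" "x ^ k"] show ?thesis using x assms by (simp add: k del: of_nat_Suc)
    qed
    ultimately show "((\<lambda>x. - 1 / (real n * x ^ n)) has_real_derivative 1 / x ^ Suc n) (at x)" by simp
  next
    have "((\<lambda>x. - 1 / real n * inverse (x ^ n)) \<longlongrightarrow> - 1 / real n * 0) at_top"
      by (intro tendsto_intros tendsto_inverse_0_at_top filterlim_pow_at_top filterlim_ident) (use assms in auto)
    then show "((\<lambda>x. - 1 / (real n * x ^ n)) \<longlongrightarrow> 0) at_top" by (simp add: field_simps)
  qed
  then show ?thesis by simp
qed

text \<open>Instead of a surface measure, the direction of a uniform point \<open>y\<close> of the
  unit ball is used, so scaling and Fubini suffice. With r = |y| t the inner integral becomes one
  over t; for fixed t the substitution x = t y produces the power \<open>1 / t ^ Suc n\<close>,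
  whose integral over t \<ge> |x| is 1 / (n |x|^n).\<close>

lemma nn_integral_polar:
  assumes n: "n \<ge> 1" and [measurable]: "g \<in> borel_measurable borel"
  shows "(\<integral>\<^sup>+x. g x \<partial>lebesgue_Rn n) = of_nat n *
    (\<integral>\<^sup>+y. (\<integral>\<^sup>+r. g (r *\<^sub>R dirn n y) * ennreal (r ^ (n - 1)) * indicator {0<..} r \<partial>lborel)
      * indicator (unit_ball n) y \<partial>lebesgue_Rn n)"
proof -
  interpret pair_sigma_finite "lebesgue_Rn n" lborel ..
  let ?L = "lebesgue_Rn n"
  \<comment> \<open>The factor \<open>nrm n x ^ n\<close> is what the final t-integral cancels, and
    the cut-off \<open>nrm n x \<le> t\<close> is the condition that \<open>y\<close> lies in the
    unit ball when x = t y.\<close>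
  define w where "w t x = g x * ennreal (nrm n x ^ n) * indicator {x. nrm n x \<le> t} x" for t x
  have w [measurable]: "w t \<in> borel_measurable borel" for t
    unfolding w_def by measurable
  have inner: "(\<integral>\<^sup>+r. g (r *\<^sub>R dirn n y) * ennreal (r ^ (n - 1)) * indicator {0<..} r \<partial>lborel)
      * indicator (unit_ball n) y =
    (\<integral>\<^sup>+t. ennreal (1 / t) * w t (t *\<^sub>R y) * indicator {0<..} t \<partial>lborel)"
    if y: "y \<in> Rn n" "nrm n y > 0" for y
  proof -
    have "y \<noteq> 0" using y by auto
    have *: "g ((nrm n y * t) *\<^sub>R dirn n y) = g (t *\<^sub>R y)" for t
      using dirn_eq[OF y(1) \<open>y \<noteq> 0\<close>] y by simp
    have "(\<integral>\<^sup>+r. g (r *\<^sub>R dirn n y) * ennreal (r ^ (n - 1)) * indicator {0<..} r \<partial>lborel) =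
      ennreal (nrm n y) * (\<integral>\<^sup>+t. g (t *\<^sub>R y) * ennreal ((nrm n y * t) ^ (n - 1)) * indicator {0<..} (nrm n y * t) \<partial>lborel)"
      using y by (subst nn_integral_real_affine[where c = "nrm n y" and t = 0]) (auto simp: *)
    also have "\<dots> = (\<integral>\<^sup>+t. ennreal (nrm n y) * (g (t *\<^sub>R y) * ennreal ((nrm n y * t) ^ (n - 1)) * indicator {0<..} (nrm n y * t)) \<partial>lborel)"
      by (rule nn_integral_cmult[symmetric]) measurable
    finally have "(\<integral>\<^sup>+r. g (r *\<^sub>R dirn n y) * ennreal (r ^ (n - 1)) * indicator {0<..} r \<partial>lborel) * indicator (unit_ball n) y
      = (\<integral>\<^sup>+t. ennreal (nrm n y) * (g (t *\<^sub>R y) * ennreal ((nrm n y * t) ^ (n - 1)) * indicator {0<..} (nrm n y * t)) * indicator (unit_ball n) y \<partial>lborel)"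
      by (simp add: nn_integral_multc)
    also have "\<dots> = (\<integral>\<^sup>+t. ennreal (1 / t) * w t (t *\<^sub>R y) * indicator {0<..} t \<partial>lborel)"
    proof (rule nn_integral_cong)
      fix t :: real
      show "ennreal (nrm n y) * (g (t *\<^sub>R y) * ennreal ((nrm n y * t) ^ (n - 1)) * indicator {0<..} (nrm n y * t)) * indicator (unit_ball n) y
        = ennreal (1 / t) * w t (t *\<^sub>R y) * indicator {0<..} t"
      proof (cases "t > 0")
        case True
        obtain k where k: "n = Suc k" using n by (cases n) auto
        have "indicator {x. nrm n x \<le> t} (t *\<^sub>R y) = (indicator (unit_ball n) y :: ennreal)"
          using True y by (auto simp: indicator_def unit_ball_def nrm_scale)
        moreover have "nrm n y * (nrm n y * t) ^ (n - 1) = (1 / t) * nrm n (t *\<^sub>R y) ^ n"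
          using True by (simp add: k nrm_scale power_mult_distrib)
        then have "ennreal (nrm n y) * ennreal ((nrm n y * t) ^ (n - 1)) = ennreal (1 / t) * ennreal (nrm n (t *\<^sub>R y) ^ n)"
          using True by (simp add: ennreal_mult[symmetric])
        ultimately show ?thesis
          unfolding w_def using True y by (simp add: mult_ac)
      qed (use y in \<open>auto simp: indicator_def zero_less_mult_iff\<close>)
    qed
    finally show ?thesis .
  qed
  have "(\<integral>\<^sup>+y. (\<integral>\<^sup>+r. g (r *\<^sub>R dirn n y) * ennreal (r ^ (n - 1)) * indicator {0<..} r \<partial>lborel)
      * indicator (unit_ball n) y \<partial>?L) =
    (\<integral>\<^sup>+y. (\<integral>\<^sup>+t. ennreal (1 / t) * w t (t *\<^sub>R y) * indicator {0<..} t \<partial>lborel) \<partial>?L)"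
    by (rule nn_integral_cong_AE) (use AE_lebesgue_Rn[of n] AE_nrm_pos[OF n] in eventually_elim, rule inner)
  also have "\<dots> = (\<integral>\<^sup>+t. (\<integral>\<^sup>+y. ennreal (1 / t) * w t (t *\<^sub>R y) * indicator {0<..} t \<partial>?L) \<partial>lborel)"
    by (rule Fubini'[symmetric]) (unfold w_def, measurable)
  also have "\<dots> = (\<integral>\<^sup>+t. (\<integral>\<^sup>+x. ennreal (1 / t ^ Suc n) * w t x * indicator {0<..} t \<partial>?L) \<partial>lborel)"
  proof (rule nn_integral_cong)
    fix t :: real
    show "(\<integral>\<^sup>+y. ennreal (1 / t) * w t (t *\<^sub>R y) * indicator {0<..} t \<partial>?L) = (\<integral>\<^sup>+x. ennreal (1 / t ^ Suc n) * w t x * indicator {0<..} t \<partial>?L)"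
    proof (cases "t > 0")
      case True
      then show ?thesis
        by (simp add: nn_integral_cmult nn_integral_scaleR[OF True w] mult.assoc[symmetric] ennreal_mult[symmetric])
    qed simp
  qed
  also have "\<dots> = (\<integral>\<^sup>+x. (\<integral>\<^sup>+t. ennreal (1 / t ^ Suc n) * w t x * indicator {0<..} t \<partial>lborel) \<partial>?L)"
    by (rule Fubini') (unfold w_def, measurable)
  also have "\<dots> = (\<integral>\<^sup>+x. ennreal (1 / real n) * g x \<partial>?L)"
  proof (rule nn_integral_cong_AE, use AE_nrm_pos[OF n] in eventually_elim)
    fix x assume x: "nrm n x > 0"
    have "(\<integral>\<^sup>+t. ennreal (1 / t ^ Suc n) * w t x * indicator {0<..} t \<partial>lborel) =
      (\<integral>\<^sup>+t. g x * ennreal (nrm n x ^ n) * (ennreal (1 / t ^ Suc n) * indicator {nrm n x..} t) \<partial>lborel)"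
      by (rule nn_integral_cong) (use x in \<open>auto simp: w_def indicator_def mult_ac\<close>)
    also have "\<dots> = g x * ennreal (nrm n x ^ n) * ennreal (1 / (real n * nrm n x ^ n))"
      by (subst nn_integral_cmult) (use nn_integral_inverse_power[OF x n] in auto)
    also have "\<dots> = g x * ennreal (nrm n x ^ n * (1 / (real n * nrm n x ^ n)))"
      using x by (simp add: mult.assoc ennreal_mult[symmetric])
    also have "nrm n x ^ n * (1 / (real n * nrm n x ^ n)) = 1 / real n" using x by simp
    finally show "(\<integral>\<^sup>+t. ennreal (1 / t ^ Suc n) * w t x * indicator {0<..} t \<partial>lborel) = ennreal (1 / real n) * g x"
      by (simp add: mult.commute)
  qed
  also have "\<dots> = ennreal (1 / real n) * (\<integral>\<^sup>+x. g x \<partial>?L)"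
    by (rule nn_integral_cmult) simp
  finally have "of_nat n * (\<integral>\<^sup>+y. (\<integral>\<^sup>+r. g (r *\<^sub>R dirn n y) * ennreal (r ^ (n - 1)) * indicator {0<..} r \<partial>lborel)
      * indicator (unit_ball n) y \<partial>?L) = (of_nat n * ennreal (1 / real n)) * (\<integral>\<^sup>+x. g x \<partial>?L)"
    by (simp add: mult.assoc)
  also have "of_nat n * ennreal (1 / real n) = 1"
    using n by (simp add: ennreal_of_nat_eq_real_of_nat ennreal_mult[symmetric])
  finally show ?thesis by (simp only: mult_1)
qed

section \<open>The invariant measure on a sphere\<close>

text \<open>This connects the product topology with the Euclidean one: a basic neighbourhood
  restricts each coordinate separately, the coordinates from \<open>n\<close> on are 0 at both
  points, and finitely many radii remain to be minimised.\<close>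

lemma open_contains_cube:
  assumes "open U" "x \<in> U" "x \<in> Rn n"
  obtains e where "e > 0" "\<And>z. z \<in> Rn n \<Longrightarrow> (\<And>i. i < n \<Longrightarrow> \<bar>z i - x i\<bar> < e) \<Longrightarrow> z \<in> U"
proof -
  have "openin (product_topology (\<lambda>i. euclidean) UNIV) U"
    using \<open>open U\<close> by (simp add: euclidean_product_topology)
  from product_topology_open_contains_basis[OF this \<open>x \<in> U\<close>]
  obtain X where X: "x \<in> Pi\<^sub>E UNIV X" "\<And>i. open (X i)" "Pi\<^sub>E UNIV X \<subseteq> U" by auto
  have "\<exists>e>0. \<forall>t. \<bar>t - x i\<bar> < e \<longrightarrow> t \<in> X i" for i
  proof -
    have "x i \<in> X i" using X(1) by auto
    then show ?thesis using X(2)[of i] unfolding open_dist dist_real_def by blast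
  qed
  then obtain e where e: "\<And>i. e i > 0" "\<And>i t. \<bar>t - x i\<bar> < e i \<Longrightarrow> t \<in> X i" by metis
  let ?e = "Min (insert 1 (e ` {..<n}))"
  show thesis
  proof
    show "?e > 0" using e by (subst Min_gr_iff) auto
    fix z assume z: "z \<in> Rn n" "\<And>i. i < n \<Longrightarrow> \<bar>z i - x i\<bar> < ?e"
    have "z i \<in> X i" for i
    proof (cases "i < n")
      case True
      have "?e \<le> e i" using True by (intro Min_le) auto
      with z(2)[OF True] have "\<bar>z i - x i\<bar> < e i" by (rule less_le_trans)
      then show ?thesis by (rule e(2))
    next
      case False
      then have "z i = x i" using z(1) assms(3) by (simp add: Rn_def)
      then show ?thesis using X(1) by auto
    qed
    then show "z \<in> U" using X(3) by auto
  qed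
qed

text \<open>An open cylinder over a Euclidean ball. It is not cut down to \<open>Rn n\<close>, so
  that it is open, hence Borel, in the whole type.\<close>

definition nball :: "nat \<Rightarrow> (nat \<Rightarrow> real) \<Rightarrow> real \<Rightarrow> (nat \<Rightarrow> real) set"
  where "nball n x d = {y. nrm n (y - x) < d}"

lemma open_nball: "open (nball n x d)"
  unfolding nball_def by (intro open_Collect_less continuous_on_nrm continuous_intros)

lemma open_contains_nball:
  assumes "open U" "x \<in> U" "x \<in> Rn n"
  obtains e where "e > 0" "nball n x e \<inter> Rn n \<subseteq> U"
proof -
  obtain e where e: "e > 0" "\<And>z. z \<in> Rn n \<Longrightarrow> (\<And>i. i < n \<Longrightarrow> \<bar>z i - x i\<bar> < e) \<Longrightarrow> z \<in> U"
    using open_contains_cube[OF assms] by metis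
  have "nball n x e \<inter> Rn n \<subseteq> U"
  proof
    fix z assume z: "z \<in> nball n x e \<inter> Rn n"
    show "z \<in> U"
    proof (rule e(2))
      fix i assume "i < n"
      then show "\<bar>z i - x i\<bar> < e" using coord_le_nrm[of i n "z - x"] z by (simp add: nball_def)
    qed (use z in simp)
  qed
  then show thesis using e(1) that by blast
qed

text \<open>If one ball of radius \<open>d\<close> centred in \<open>S\<close> were null, all would
  be; by the Lindelof property countably many of them cover \<open>S\<close>, which carries the full
  mass.\<close>

lemma emeasure_nball_pos:
  assumes "prob_space \<mu>" and s: "sets \<mu> = sets borel" and S: "AE x in \<mu>. x \<in> S" "S \<subseteq> Rn n"
    and cap: "\<And>x y d. x \<in> S \<Longrightarrow> y \<in> S \<Longrightarrow> emeasure \<mu> (nball n x d) = emeasure \<mu> (nball n y d)"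
    and x: "x \<in> S" and d: "d > 0"
  shows "emeasure \<mu> (nball n x d) > 0"
proof (rule ccontr)
  interpret prob_space \<mu> by fact
  assume "\<not> ?thesis"
  then have 0: "emeasure \<mu> (nball n y d) = 0" if "y \<in> S" for y using cap[OF x that, of d] by simp
  obtain F where F: "F \<subseteq> (\<lambda>x. nball n x d) ` S" "countable F" "\<Union>F = \<Union>((\<lambda>x. nball n x d) ` S)"
    using Lindelof[of "(\<lambda>x. nball n x d) ` S"] open_nball by (metis (no_types, lifting) imageE)
  have "f \<in> null_sets \<mu>" if "f \<in> F" for f
    using that F(1) 0 open_nball by (auto simp: s intro!: null_setsI)
  then have "(\<Union>f\<in>F. f) \<in> null_sets \<mu>" using F(2) by (intro null_sets_UN') auto
  from AE_not_in[OF this] have "AE x in \<mu>. x \<notin> \<Union>F" by simp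
  with S(1) have "AE x in \<mu>. False"
  proof eventually_elim
    case (elim y)
    have "y \<in> nball n y d" using d by (simp add: nball_def)
    then show ?case using elim F(3) by auto
  qed
  then show False by simp
qed

text \<open>Christensen's argument: integrating the indicator of \<open>x \<in> C\<close> and \<open>|x - y| < d\<close> against both measures in
  either order bounds the mass of a closed set \<open>C\<close> by that of its \<open>d\<close>-neighbourhood.\<close>

lemma uniformly_distributed_unique:
  assumes P: "prob_space \<mu>" "prob_space \<nu>" and s: "sets \<mu> = sets borel" "sets \<nu> = sets borel"
    and S: "AE x in \<mu>. x \<in> S" "AE x in \<nu>. x \<in> S" "S \<subseteq> Rn n"
    and cap: "\<And>x y d. x \<in> S \<Longrightarrow> y \<in> S \<Longrightarrow> emeasure \<mu> (nball n x d) = emeasure \<mu> (nball n y d)"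
      "\<And>x y d. x \<in> S \<Longrightarrow> y \<in> S \<Longrightarrow> emeasure \<nu> (nball n x d) = emeasure \<nu> (nball n y d)"
  shows "\<mu> = \<nu>"
proof -
  have le: "emeasure \<mu> C \<le> emeasure \<nu> C"
    if P: "prob_space \<mu>" "prob_space \<nu>" and s: "sets \<mu> = sets borel" "sets \<nu> = sets borel"
    and S: "AE x in \<mu>. x \<in> S" "AE x in \<nu>. x \<in> S"
    and cap: "\<And>x y d. x \<in> S \<Longrightarrow> y \<in> S \<Longrightarrow> emeasure \<mu> (nball n x d) = emeasure \<mu> (nball n y d)"
      "\<And>x y d. x \<in> S \<Longrightarrow> y \<in> S \<Longrightarrow> emeasure \<nu> (nball n x d) = emeasure \<nu> (nball n y d)"
    and C: "closed C" for \<mu> \<nu> :: "(nat \<Rightarrow> real) measure" and C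
  proof -
    interpret \<mu>: prob_space \<mu> by fact
    interpret \<nu>: prob_space \<nu> by fact
    interpret pair_sigma_finite \<mu> \<nu> ..
    note [measurable_cong] = s
    have CB [measurable]: "C \<in> sets borel" using C by simp
    have "\<exists>x. x \<in> S"
    proof (rule ccontr)
      assume "\<nexists>x. x \<in> S"
      then have "AE x in \<mu>. False" using S(1) by simp
      then show False by simp
    qed
    then obtain x0 where x0: "x0 \<in> S" by blast
    define C' where "C' d = (\<Union>c\<in>C \<inter> S. nball n c d)" for d
    have C'B [measurable]: "C' d \<in> sets borel" for d
      unfolding C'_def by (intro borel_open open_UN ballI open_nball)
    have nb: "y \<in> nball n x d \<longleftrightarrow> x \<in> nball n y d" for x y d
      using nrm_commute[of x y n] by (simp add: nball_def)
    have ind: "indicator (nball n x d) y = (indicator {p. nrm n (snd p - fst p) < d} (x, y) :: ennreal)" for x y d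
      by (simp add: indicator_def nball_def)
    have [measurable]: "nball n x d \<in> sets borel" for x d using open_nball by simp
    have nu: "AE x in \<mu>. (\<integral>\<^sup>+y. indicator (nball n x d) y \<partial>\<nu>) = emeasure \<nu> (nball n x0 d)" for d
      using S(1) by eventually_elim (simp add: cap(2)[OF _ x0] s)
    have mu: "AE y in \<nu>. (\<integral>\<^sup>+x. indicator (nball n x d) y \<partial>\<mu>) = emeasure \<mu> (nball n x0 d)" for d
      using S(2)
    proof eventually_elim
      case (elim y)
      have "(\<integral>\<^sup>+x. indicator (nball n x d) y \<partial>\<mu>) = (\<integral>\<^sup>+x. indicator (nball n y d) x \<partial>\<mu>)"
        by (rule nn_integral_cong) (use nb in \<open>auto simp: indicator_def\<close>)
      then show ?case using cap(1)[OF elim x0, of d] by (simp add: s)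
    qed
    \<comment> \<open>First application of the double integral, without a set \<open>C\<close>: both
      orders of integration of the indicator of |x - y| < d give a ball mass, so the two measures
      agree on balls centred in \<open>S\<close>.\<close>
    have eqc: "emeasure \<mu> (nball n x0 d) = emeasure \<nu> (nball n x0 d)" for d
    proof -
      have "emeasure \<nu> (nball n x0 d) = (\<integral>\<^sup>+x. (\<integral>\<^sup>+y. indicator (nball n x d) y \<partial>\<nu>) \<partial>\<mu>)"
        using nn_integral_cong_AE[OF nu] by (simp add: \<mu>.emeasure_space_1)
      also have "\<dots> = (\<integral>\<^sup>+y. (\<integral>\<^sup>+x. indicator (nball n x d) y \<partial>\<mu>) \<partial>\<nu>)"
        unfolding ind by (rule Fubini'[symmetric]) measurable
      also have "\<dots> = emeasure \<mu> (nball n x0 d)"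
        using nn_integral_cong_AE[OF mu] by (simp add: \<nu>.emeasure_space_1)
      finally show ?thesis by simp
    qed
    have nbhd: "emeasure \<mu> C \<le> emeasure \<nu> (C' d)" if d: "d > 0" for d
    proof -
      let ?c = "emeasure \<nu> (nball n x0 d)"
      have c: "?c \<noteq> 0" "?c \<noteq> \<infinity>"
        using emeasure_nball_pos[OF P(2) s(2) S(2) \<open>S \<subseteq> Rn n\<close> cap(2) x0 d] by auto
      have "?c * emeasure \<mu> C = (\<integral>\<^sup>+x. ?c * indicator C x \<partial>\<mu>)"
        by (simp add: nn_integral_cmult s)
      also have "\<dots> = (\<integral>\<^sup>+x. (\<integral>\<^sup>+y. indicator C x * indicator (nball n x d) y \<partial>\<nu>) \<partial>\<mu>)"
        by (rule nn_integral_cong_AE) (use nu[of d] in \<open>eventually_elim, simp add: nn_integral_cmult s mult.commute\<close>)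
      also have "\<dots> = (\<integral>\<^sup>+y. (\<integral>\<^sup>+x. indicator C x * indicator (nball n x d) y \<partial>\<mu>) \<partial>\<nu>)"
        unfolding ind by (rule Fubini'[symmetric]) measurable
      also have "\<dots> \<le> (\<integral>\<^sup>+y. (\<integral>\<^sup>+x. indicator (C' d) y * indicator (nball n x d) y \<partial>\<mu>) \<partial>\<nu>)"
      proof (rule nn_integral_mono, rule nn_integral_mono_AE)
        fix y
        show "AE x in \<mu>. indicator C x * indicator (nball n x d) y \<le> (indicator (C' d) y * indicator (nball n x d) y :: ennreal)"
          using S(1) by eventually_elim (auto simp: C'_def indicator_def)
      qed
      also have "\<dots> = (\<integral>\<^sup>+y. indicator (C' d) y * ?c \<partial>\<nu>)"
      proof (rule nn_integral_cong_AE, use mu[of d] in eventually_elim)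
        case (elim y)
        have "(\<integral>\<^sup>+x. indicator (C' d) y * indicator (nball n x d) y \<partial>\<mu>) =
           indicator (C' d) y * (\<integral>\<^sup>+x. indicator (nball n x d) y \<partial>\<mu>)"
          unfolding ind by (rule nn_integral_cmult) measurable
        then show ?case by (simp add: elim eqc)
      qed
      also have "\<dots> = ?c * emeasure \<nu> (C' d)"
        by (simp add: nn_integral_multc s mult.commute)
      finally show ?thesis using c by (simp add: ennreal_mult_le_mult_iff)
    qed
    \<comment> \<open>Now the radius tends to 0. Because \<open>C\<close> is closed, a point of
      \<open>S\<close> lying in all the neighbourhoods belongs to \<open>C\<close>.\<close>
    have "emeasure \<mu> C \<le> (INF k. emeasure \<nu> (C' (1 / real (Suc k))))"
      by (rule INF_greatest) (rule nbhd, simp)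
    also have "\<dots> = emeasure \<nu> (\<Inter>k. C' (1 / real (Suc k)))"
    proof (rule INF_emeasure_decseq)
      show "decseq (\<lambda>k. C' (1 / real (Suc k)))"
        unfolding decseq_def C'_def
      proof (intro allI impI UN_mono order_refl)
        fix a b :: nat and c assume "a \<le> b"
        then have "1 / real (Suc b) \<le> 1 / real (Suc a)" by (intro divide_left_mono) auto
        then show "nball n c (1 / real (Suc b)) \<subseteq> nball n c (1 / real (Suc a))"
          unfolding nball_def by auto
      qed
    qed (auto simp: s)
    also have "\<dots> \<le> emeasure \<nu> C"
    proof (rule emeasure_mono_AE)
      show "AE x in \<nu>. x \<in> (\<Inter>k. C' (1 / real (Suc k))) \<longrightarrow> x \<in> C"
      proof (rule eventually_mono[OF S(2)], intro impI, rule ccontr)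
        fix x assume x: "x \<in> S" "x \<in> (\<Inter>k. C' (1 / real (Suc k)))" "x \<notin> C"
        then have "x \<in> Rn n" using \<open>S \<subseteq> Rn n\<close> by auto
        then obtain e where e: "e > 0" "nball n x e \<inter> Rn n \<subseteq> - C"
          using open_contains_nball[of "- C" x n] C x by (auto simp: open_Compl)
        obtain k where "1 / real (Suc k) < e"
          using reals_Archimedean[OF e(1)] by (auto simp: inverse_eq_divide)
        moreover obtain c where c: "c \<in> C" "c \<in> S" "x \<in> nball n c (1 / real (Suc k))"
          using x(2) by (auto simp: C'_def)
        ultimately have "c \<in> nball n x e"
          using nb[of x c] unfolding nball_def by auto
        then show False using e(2) c \<open>S \<subseteq> Rn n\<close> by auto
      qed
    qed (simp add: s)
    finally show ?thesis .
  qed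
  have eqC: "emeasure \<mu> C = emeasure \<nu> C" if "closed C" for C
    by (rule antisym) (rule le[OF P s S(1,2) cap that] le[OF P(2,1) s(2,1) S(2,1) cap(2,1) that]; assumption)+
  have sp: "space \<mu> = UNIV" "space \<nu> = UNIV"
    using sets_eq_imp_space_eq[OF s(1)] sets_eq_imp_space_eq[OF s(2)] by auto
  show ?thesis
  proof (rule measure_eqI_generator_eq[where E = "Collect open" and \<Omega> = UNIV and A = "\<lambda>_. UNIV"])
    show "Int_stable (Collect open :: (nat \<Rightarrow> real) set set)" by (auto simp: Int_stable_def)
    show "sets \<mu> = sigma_sets UNIV (Collect open)" "sets \<nu> = sigma_sets UNIV (Collect open)"
      using s by (auto simp: borel_def)
    show "emeasure \<mu> UNIV \<noteq> \<infinity>" using P(1) by (metis prob_space.emeasure_space_1 sp(1) ennreal_one_neq_top infinity_ennreal_def)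
    fix U :: "(nat \<Rightarrow> real) set" assume "U \<in> Collect open"
    then have U: "open U" by simp
    have "emeasure \<mu> U = 1 - emeasure \<mu> (- U)"
      using prob_space.emeasure_space_1[OF P(1)] U emeasure_compl[of "- U" \<mu>] P(1)
      by (simp add: sp s finite_measure.emeasure_finite prob_space.finite_measure Compl_eq_Diff_UNIV[symmetric])
    moreover have "emeasure \<nu> U = 1 - emeasure \<nu> (- U)"
      using prob_space.emeasure_space_1[OF P(2)] U emeasure_compl[of "- U" \<nu>] P(2)
      by (simp add: sp s finite_measure.emeasure_finite prob_space.finite_measure Compl_eq_Diff_UNIV[symmetric])
    ultimately show "emeasure \<mu> U = emeasure \<nu> U" using eqC[of "- U"] U by (simp add: closed_Compl)
  qed auto
qed

section \<open>Orthonormal systems\<close>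

lemma unit_ball_vol_nonzero [simp]: "unit_ball_vol (real n) \<noteq> 0"
  by (metis less_irrefl of_nat_0_le_iff unit_ball_vol_pos)

definition orthonormal :: "nat \<Rightarrow> nat \<Rightarrow> (nat \<Rightarrow> nat \<Rightarrow> real) \<Rightarrow> bool"
  where "orthonormal n m u \<longleftrightarrow>
    (\<forall>i<m. u i \<in> Rn n) \<and> (\<forall>i<m. \<forall>j<m. ip n (u i) (u j) = of_bool (i = j))"

text \<open>The transpose of the matrix map \<open>lmap m u\<close> (see \<open>ip_lmap\<close>).
  For orthonormal \<open>u\<close> it is also a left inverse, and \<open>lmap m u\<close> after it
  is the orthogonal projection onto the span.\<close>

definition coords :: "nat \<Rightarrow> nat \<Rightarrow> (nat \<Rightarrow> nat \<Rightarrow> real) \<Rightarrow> (nat \<Rightarrow> real) \<Rightarrow> nat \<Rightarrow> real"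
  where "coords n m u y = cutoff m (\<lambda>i. ip n y (u i))"

lemma coords_Rn: "coords n m u y \<in> Rn m"
  by (simp add: coords_def cutoff_Rn)

lemma measurable_coords [measurable]: "coords n m u \<in> borel_measurable borel"
proof (subst borel_measurable_fun_iff, intro allI)
  fix j show "(\<lambda>x. coords n m u x j) \<in> borel_measurable borel"
    by (cases "j < m") (auto simp: coords_def cutoff_def)
qed

lemma orthonormal_evec: "orthonormal n n evec"
  by (auto simp: orthonormal_def evec_Rn ip_evec) (auto simp: evec_def)

lemma lmap_evec_id: "x \<in> Rn n \<Longrightarrow> lmap n evec x = x"
  using Rn_expand by metis

lemma lmap_evec_image: "lmap n evec ` Rn n = Rn n"
  by (auto simp: lmap_evec_id image_iff)

context
  fixes n m u assumes on: "orthonormal n m u"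
begin

lemma orthonormal_lmap_Rn: "lmap m u x \<in> Rn n"
  using on by (intro lmap_Rn) (auto simp: orthonormal_def)

lemma orthonormal_ip_left:
  assumes "j < m" shows "ip n (lmap m u x) (u j) = x j"
proof -
  have "ip n (lmap m u x) (u j) = (\<Sum>i<m. x i * ip n (u i) (u j))"
    by (simp add: lmap_def ip_sum ip_lin)
  also have "\<dots> = (\<Sum>i<m. if i = j then x i else 0)"
    by (rule sum.cong) (use on assms in \<open>auto simp: orthonormal_def\<close>)
  finally show ?thesis using assms by simp
qed

lemma orthonormal_ip: "ip n (lmap m u x) (lmap m u y) = ip m x y"
proof -
  have "ip n (lmap m u x) (lmap m u y) = (\<Sum>i<m. y i * ip n (lmap m u x) (u i))"
    by (subst (2) lmap_def) (simp add: ip_sum ip_lin)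
  also have "\<dots> = (\<Sum>i<m. x i * y i)"
    by (rule sum.cong) (auto simp: orthonormal_ip_left)
  finally show ?thesis by (simp add: ip_def)
qed

lemma orthonormal_nrm: "nrm n (lmap m u x) = nrm m x"
  using orthonormal_ip[of x x] by (metis nrm_pow2 L2_set_nonneg power2_eq_imp_eq)

lemma coords_lmap: "x \<in> Rn m \<Longrightarrow> coords n m u (lmap m u x) = x"
  by (rule Rn_eqI[of _ m]) (auto simp: coords_Rn, simp add: coords_def cutoff_def orthonormal_ip_left)

lemma lmap_coords: "y \<in> lmap m u ` Rn m \<Longrightarrow> lmap m u (coords n m u y) = y"
  using coords_lmap by auto

lemma orthonormal_image_subspace: "subspace (lmap m u ` Rn m)"
  by (rule linear_subspace_image[OF linear_lmap subspace_Rn])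

text \<open>The image is the fixed point set of the orthogonal projection, a measurable map.\<close>

lemma orthonormal_image_borel: "lmap m u ` Rn m \<in> sets borel"
proof -
  have "lmap m u ` Rn m = {y. lmap m u (coords n m u y) - y \<in> {0}}"
    using lmap_coords coords_Rn[of n m u] by (auto simp: image_iff) metis+
  also have "\<dots> \<in> sets borel" by measurable
  finally show ?thesis .
qed

end

section \<open>Existence and uniqueness of the invariant measure\<close>

lemma unit_sphere_borel: "E \<in> sets borel \<Longrightarrow> unit_sphere n E \<in> sets borel"
proof -
  assume "E \<in> sets borel"
  then have "E \<inter> {x. nrm n x = 1} \<in> sets borel" by measurable
  then show ?thesis by (simp add: unit_sphere_def Int_def)
qed

text \<open>An explicit candidate for the invariant measure: the direction of a uniformly
  distributed point of the unit ball of R^m, carried to the subspace by an isometric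
  parametrisation.\<close>

definition sph :: "nat \<Rightarrow> nat \<Rightarrow> (nat \<Rightarrow> nat \<Rightarrow> real) \<Rightarrow> (nat \<Rightarrow> real) measure"
  where "sph n m u = distr (uniform_measure (lebesgue_Rn m) (unit_ball m))
    (restrict_space borel (unit_sphere n (lmap m u ` Rn m))) (\<lambda>x. lmap m u (dirn m x))"

text \<open>The predicate under the definite description in \<open>sphere_measure\<close>, named so
  that it can be folded there.\<close>

definition invariant_on_sphere :: "nat \<Rightarrow> (nat \<Rightarrow> real) set \<Rightarrow> (nat \<Rightarrow> real) measure \<Rightarrow> bool"
  where "invariant_on_sphere n E \<mu> \<longleftrightarrow>
    prob_space \<mu> \<and> sets \<mu> = sets (restrict_space borel (unit_sphere n E)) \<and>
    (\<forall>T. linear T \<and> T ` E = E \<and> (\<forall>x\<in>E. L2_set (T x) {..<n} = L2_set x {..<n})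
      \<longrightarrow> distr \<mu> \<mu> T = \<mu>)"

text \<open>The reflection in the hyperplane orthogonal to \<open>x - y\<close> exchanges two
  vectors of equal length, and it preserves \<open>E\<close> because \<open>x - y\<close> lies in
  \<open>E\<close>. So isometries of \<open>E\<close> act transitively on its sphere, also when
  \<open>E\<close> is a line.\<close>

lemma reflection:
  assumes E: "subspace E" "E \<subseteq> Rn n" and x: "x \<in> unit_sphere n E" and y: "y \<in> unit_sphere n E" "x \<noteq> y"
  obtains T where "linear T" "T ` E = E" "\<And>z. nrm n (T z) = nrm n z" "T x = y" "T \<in> borel_measurable borel"
proof
  let ?T = "\<lambda>z. z - (2 * ip n z (x - y) / ip n (x - y) (x - y)) *\<^sub>R (x - y)"
  define T where "T = ?T"
  define v where "v = x - y"
  have v: "v \<in> E" "v \<noteq> 0" using E x y by (auto simp: v_def unit_sphere_def subspace_diff)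
  have vv: "ip n v v > 0" using v E by (intro ip_self_pos) auto
  have T: "T z = z - (2 * ip n z v / ip n v v) *\<^sub>R v" for z by (simp add: T_def v_def)
  show "linear ?T"
    unfolding T_def[symmetric] by (rule linearI) (simp_all add: T ip_lin algebra_simps add_divide_distrib scaleR_right_diff_distrib)
  have TT: "T (T z) = z" for z
  proof -
    have "ip n (T z) v = - ip n z v" using vv by (simp add: T ip_lin)
    then have "T (T z) = T z + (2 * ip n z v / ip n v v) *\<^sub>R v" by (subst T) simp
    then show ?thesis by (simp add: T)
  qed
  have TE: "T z \<in> E" if "z \<in> E" for z
    unfolding T using that v(1) E(1) by (intro subspace_diff subspace_scale)
  show "?T ` E = E"
    unfolding T_def[symmetric] using TE TT by (auto simp: image_iff) metis
  have n: "nrm n (T z) = nrm n z" for z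
  proof -
    have "ip n (T z) (T z) = ip n z z" using vv
      by (simp add: T ip_lin ip_sym[of n v z] field_simps)
    then show ?thesis by (metis nrm_pow2 L2_set_nonneg power2_eq_imp_eq)
  qed
  then show "nrm n (?T z) = nrm n z" for z unfolding T_def .
  have n1: "ip n x x = 1" "ip n y y = 1"
    using x y(1) by (auto simp: unit_sphere_def nrm_pow2[symmetric])
  have "ip n v v = 2 * ip n x v"
    by (simp add: v_def ip_lin n1 ip_sym[of n y x])
  then have "2 * ip n x v / ip n v v = 1" using vv by simp
  then have "T x = y" by (simp add: T v_def)
  then show "?T x = y" unfolding T_def .
  show "?T \<in> borel_measurable borel" by measurable
qed

text \<open>The reflection exchanging the two centres carries one cap onto the other.\<close>

lemma invariant_on_sphere_nball:
  assumes E: "subspace E" "E \<subseteq> Rn n" "E \<in> sets borel" and inv: "invariant_on_sphere n E \<mu>"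
    and x: "x \<in> unit_sphere n E" and y: "y \<in> unit_sphere n E"
  shows "emeasure \<mu> (nball n x d \<inter> unit_sphere n E) = emeasure \<mu> (nball n y d \<inter> unit_sphere n E)"
proof (cases "x = y")
  case False
  obtain T where R: "linear T" "T ` E = E" "\<And>z. nrm n (T z) = nrm n z" "T x = y" "T \<in> borel_measurable borel"
    using reflection[OF E(1,2) x y False] by blast
  have s: "sets \<mu> = sets (restrict_space borel (unit_sphere n E))"
    using inv by (simp add: invariant_on_sphere_def)
  have inv': "distr \<mu> \<mu> T = \<mu>"
    using inv R(1-3) unfolding invariant_on_sphere_def by blast
  have sp: "space \<mu> = unit_sphere n E" using sets_eq_imp_space_eq[OF s] by (simp add: space_restrict_space)
  have S: "unit_sphere n E \<in> sets borel" using E(3) by (rule unit_sphere_borel)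
  have TS: "T z \<in> unit_sphere n E" if "z \<in> unit_sphere n E" for z
    using that R(2,3) by (auto simp: unit_sphere_def)
  have Tm: "T \<in> \<mu> \<rightarrow>\<^sub>M \<mu>"
    unfolding measurable_cong_sets[OF s s]
    by (rule measurable_restrict_space3) (use TS R(5) in auto)
  have nb: "nball n y d \<inter> unit_sphere n E \<in> sets \<mu>"
    unfolding s by (subst sets_restrict_space_iff) (use S open_nball in auto)
  have "emeasure \<mu> (nball n y d \<inter> unit_sphere n E) = emeasure \<mu> (T -` (nball n y d \<inter> unit_sphere n E) \<inter> unit_sphere n E)"
    using emeasure_distr[OF Tm nb] by (simp add: inv' sp)
  also have "T -` (nball n y d \<inter> unit_sphere n E) \<inter> unit_sphere n E = nball n x d \<inter> unit_sphere n E"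
  proof -
    have "nrm n (T z - y) = nrm n (z - x)" for z
      using R(3)[of "z - x"] R(1,4) by (simp add: linear_diff)
    then show ?thesis using TS by (auto simp: nball_def)
  qed
  finally show ?thesis by simp
qed simp

text \<open>Invariance makes caps of equal radius equally heavy, so
  \<open>uniformly_distributed_unique\<close> applies once both measures are transported from the
  sphere to the Borel sets of the whole type.\<close>

lemma invariant_on_sphere_unique:
  assumes E: "subspace E" "E \<subseteq> Rn n" "E \<in> sets borel"
    and \<mu>: "invariant_on_sphere n E \<mu>" and \<nu>: "invariant_on_sphere n E \<nu>"
  shows "\<mu> = \<nu>"
proof -
  let ?S = "unit_sphere n E"
  have S: "?S \<in> sets borel" using E(3) by (rule unit_sphere_borel)
  have push: "prob_space (distr \<mu> borel (\<lambda>x. x))" "AE x in distr \<mu> borel (\<lambda>x. x). x \<in> ?S"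
    "\<And>A. A \<in> sets borel \<Longrightarrow> emeasure (distr \<mu> borel (\<lambda>x. x)) A = emeasure \<mu> (A \<inter> ?S)"
    "sets \<mu> = sets (restrict_space borel ?S)"
    if \<mu>: "invariant_on_sphere n E \<mu>" for \<mu>
  proof -
    show s: "sets \<mu> = sets (restrict_space borel ?S)" using \<mu> by (simp add: invariant_on_sphere_def)
    have sp: "space \<mu> = ?S" using sets_eq_imp_space_eq[OF s] by (simp add: space_restrict_space)
    have id: "(\<lambda>x. x) \<in> \<mu> \<rightarrow>\<^sub>M borel"
      unfolding measurable_cong_sets[OF s refl] by (rule measurable_restrict_space1) simp
    show "prob_space (distr \<mu> borel (\<lambda>x. x))"
      using \<mu> id by (intro prob_space.prob_space_distr) (auto simp: invariant_on_sphere_def)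
    show "AE x in distr \<mu> borel (\<lambda>x. x). x \<in> ?S"
      using S by (subst AE_distr_iff[OF id]) (auto simp: sp)
    show "emeasure (distr \<mu> borel (\<lambda>x. x)) A = emeasure \<mu> (A \<inter> ?S)" if "A \<in> sets borel" for A
      using that by (subst emeasure_distr[OF id]) (auto simp: sp)
  qed
  have "distr \<mu> borel (\<lambda>x. x) = distr \<nu> borel (\<lambda>x. x)"
  proof (rule uniformly_distributed_unique[of _ _ ?S n])
    have nb: "nball n x d \<in> sets borel" for x d using open_nball by simp
    fix x y d assume xy: "x \<in> ?S" "y \<in> ?S"
    show "emeasure (distr \<mu> borel (\<lambda>x. x)) (nball n x d) = emeasure (distr \<mu> borel (\<lambda>x. x)) (nball n y d)"
      unfolding push(3)[OF \<mu> nb] by (rule invariant_on_sphere_nball[OF E \<mu> xy])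
    show "emeasure (distr \<nu> borel (\<lambda>x. x)) (nball n x d) = emeasure (distr \<nu> borel (\<lambda>x. x)) (nball n y d)"
      unfolding push(3)[OF \<nu> nb] by (rule invariant_on_sphere_nball[OF E \<nu> xy])
  qed (use push[OF \<mu>] push[OF \<nu>] E(2) in \<open>auto simp: unit_sphere_def\<close>)
  note eq = this
  show ?thesis
  proof (rule measure_eqI)
    show "sets \<mu> = sets \<nu>" using push(4)[OF \<mu>] push(4)[OF \<nu>] by simp
    fix A assume "A \<in> sets \<mu>"
    then have A: "A \<in> sets borel" "A \<subseteq> ?S"
      unfolding push(4)[OF \<mu>] using S by (auto simp: sets_restrict_space_iff)
    then have "A \<inter> ?S = A" by auto
    then show "emeasure \<mu> A = emeasure \<nu> A"
      using push(3)[OF \<mu> A(1)] push(3)[OF \<nu> A(1)] eq by simp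
  qed
qed

context
  fixes n m u assumes on: "orthonormal n m u" and m: "m \<ge> 1"
begin

lemma prob_uniform_ball: "prob_space (uniform_measure (lebesgue_Rn m) (unit_ball m))"
  by (intro prob_space_uniform_measure) (simp_all add: emeasure_unit_ball)

lemma measurable_sph:
  "(\<lambda>x. lmap m u (dirn m x)) \<in> borel \<rightarrow>\<^sub>M restrict_space borel (unit_sphere n (lmap m u ` Rn m))"
  by (rule measurable_restrict_space2)
    (use dirn_sphere[OF m] in \<open>auto simp: unit_sphere_def orthonormal_nrm[OF on]\<close>)

lemma measurable_sph':
  "(\<lambda>x. lmap m u (dirn m x)) \<in> uniform_measure (lebesgue_Rn m) (unit_ball m) \<rightarrow>\<^sub>M
    restrict_space borel (unit_sphere n (lmap m u ` Rn m))"
  using measurable_sph by (simp add: measurable_cong_sets[OF sets_uniform_measure refl])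

lemma nn_integral_sph:
  assumes f: "f \<in> borel_measurable (restrict_space borel (unit_sphere n (lmap m u ` Rn m)))"
  shows "(\<integral>\<^sup>+x. f x \<partial>sph n m u) =
    (\<integral>\<^sup>+x. f (lmap m u (dirn m x)) * indicator (unit_ball m) x \<partial>lebesgue_Rn m) / ennreal (unit_ball_vol (real m))"
proof -
  have [measurable]: "(\<lambda>x. f (lmap m u (dirn m x))) \<in> borel_measurable borel"
    using measurable_compose[OF measurable_sph f] .
  show ?thesis
    unfolding sph_def
    by (subst nn_integral_distr[OF measurable_sph'])
      (use f in \<open>auto simp: nn_integral_uniform_measure emeasure_unit_ball\<close>)
qed

text \<open>An isometry of the subspace corresponds under the parametrisation to a linear isometry
  \<open>W\<close> of R^m. It preserves Lebesgue measure and the unit ball, and it commutes with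
  taking directions.\<close>

lemma invariant_sph: "invariant_on_sphere n (lmap m u ` Rn m) (sph n m u)"
  unfolding invariant_on_sphere_def
proof (intro conjI allI impI; (elim conjE)?)
  let ?E = "lmap m u ` Rn m"
  let ?R = "restrict_space borel (unit_sphere n ?E)"
  let ?U = "uniform_measure (lebesgue_Rn m) (unit_ball m)"
  show "prob_space (sph n m u)"
    unfolding sph_def by (rule prob_space.prob_space_distr[OF prob_uniform_ball measurable_sph'])
  show s: "sets (sph n m u) = sets ?R" by (simp add: sph_def)
  fix T assume T: "linear T" "T ` ?E = ?E" "\<forall>x\<in>?E. nrm n (T x) = nrm n x"
  define w where "w i = coords n m u (T (u i))" for i
  define W where "W = lmap m w"
  have uE: "u i \<in> ?E" if "i < m" for i
    using lmap_evec[OF that, of u] evec_Rn[OF that] by (metis image_eqI)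
  have TJ: "T (lmap m u x) = lmap m u (W x)" for x
  proof -
    have "T (lmap m u x) = (\<Sum>i<m. x i *\<^sub>R T (u i))"
      using T(1) by (simp add: lmap_def linear_sum linear_scale)
    also have "\<dots> = (\<Sum>i<m. x i *\<^sub>R lmap m u (w i))"
    proof (rule sum.cong)
      fix i assume "i \<in> {..<m}"
      then have "T (u i) \<in> ?E" using uE[of i] T(2) by blast
      then show "x i *\<^sub>R T (u i) = x i *\<^sub>R lmap m u (w i)" by (simp only: w_def lmap_coords[OF on])
    qed simp
    also have "\<dots> = lmap m u (W x)" unfolding W_def lmap_lmap by (simp add: lmap_def[of m "\<lambda>i. lmap m u (w i)"])
    finally show ?thesis .
  qed
  have W_Rn: "W x \<in> Rn m" for x
    unfolding W_def w_def by (rule lmap_Rn) (rule coords_Rn)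
  have W_nrm: "nrm m (W x) = nrm m x" if "x \<in> Rn m" for x
  proof -
    have "nrm m (W x) = nrm n (T (lmap m u x))" by (simp add: TJ orthonormal_nrm[OF on])
    also have "\<dots> = nrm n (lmap m u x)" using T(3) that by auto
    finally show ?thesis by (simp add: orthonormal_nrm[OF on])
  qed
  have W_bij: "bij_betw W (Rn m) (Rn m)"
    unfolding bij_betw_def
  proof
    show "inj_on W (Rn m)"
    proof (rule inj_onI)
      fix x y assume xy: "x \<in> Rn m" "y \<in> Rn m" "W x = W y"
      then have "W (x - y) = 0" by (simp add: W_def lmap_lin)
      then have "nrm m (x - y) = 0" using W_nrm[of "x - y"] xy by simp
      then show "x = y" using nrm_eq_0[of "x - y" m] xy by simp
    qed
    show "W ` Rn m = Rn m"
    proof (intro equalityI subsetI)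
      fix y assume y: "y \<in> Rn m"
      then have "lmap m u y \<in> T ` ?E" using T(2) by auto
      then obtain x where x: "x \<in> Rn m" "lmap m u y = T (lmap m u x)" by auto
      then have "lmap m u y = lmap m u (W x)" using TJ by simp
      then have "y = W x" using coords_lmap[OF on] y W_Rn by metis
      then show "y \<in> W ` Rn m" using x by blast
    qed (use W_Rn in auto)
  qed
  have Wdir: "W (dirn m x) = dirn m (W x)" if "x \<in> Rn m" "nrm m x > 0" for x
  proof -
    have "x \<noteq> 0" "W x \<noteq> 0" using that W_nrm[of x] by auto
    then show ?thesis using that W_Rn[of x] W_nrm[of x]
      by (simp add: dirn_eq W_def lmap_lin)
  qed
  have TS: "T y \<in> unit_sphere n ?E" if "y \<in> unit_sphere n ?E" for y
    using that T(2,3) by (auto simp: unit_sphere_def)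
  \<comment> \<open>\<open>T\<close> is an arbitrary linear map of an infinite-dimensional type, so
    measurability is not automatic; on the sphere it agrees with a composition of matrix
    maps.\<close>
  have Tm: "T \<in> ?R \<rightarrow>\<^sub>M ?R"
  proof -
    have "(\<lambda>y. lmap m u (W (coords n m u y))) \<in> ?R \<rightarrow>\<^sub>M ?R"
    proof (rule measurable_restrict_space3)
      show "(\<lambda>y. lmap m u (W (coords n m u y))) \<in> borel_measurable borel" unfolding W_def by measurable
      show "(\<lambda>y. lmap m u (W (coords n m u y))) \<in> unit_sphere n ?E \<rightarrow> unit_sphere n ?E"
      proof
        fix y assume y: "y \<in> unit_sphere n ?E"
        then have "lmap m u (coords n m u y) = y" by (intro lmap_coords[OF on]) (simp add: unit_sphere_def)
        then have "T y = lmap m u (W (coords n m u y))" using TJ by metis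
        then show "lmap m u (W (coords n m u y)) \<in> unit_sphere n ?E" using TS[OF y] by simp
      qed
    qed
    moreover have "T y = lmap m u (W (coords n m u y))" if "y \<in> space ?R" for y
    proof -
      have "lmap m u (coords n m u y) = y"
        using that by (intro lmap_coords[OF on]) (simp add: unit_sphere_def space_restrict_space)
      then show ?thesis using TJ by metis
    qed
    ultimately show ?thesis by (subst measurable_cong) auto
  qed
  show "distr (sph n m u) (sph n m u) T = sph n m u"
  proof (rule measure_eqI)
    fix A assume "A \<in> sets (distr (sph n m u) (sph n m u) T)"
    then have A: "A \<in> sets ?R" by (simp add: s)
    let ?f = "\<lambda>x. indicator A (lmap m u (dirn m x)) * indicator (unit_ball m) x :: ennreal"
    have iA: "(indicator A :: _ \<Rightarrow> ennreal) \<in> borel_measurable ?R" using A by simp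
    have f: "?f \<in> borel_measurable borel"
      using measurable_compose[OF measurable_sph iA] by measurable
    have Tm': "T \<in> sph n m u \<rightarrow>\<^sub>M sph n m u" using Tm by (simp add: measurable_cong_sets[OF s s])
    have "emeasure (distr (sph n m u) (sph n m u) T) A = (\<integral>\<^sup>+x. indicator A x \<partial>distr (sph n m u) (sph n m u) T)"
      using A by (subst nn_integral_indicator) (auto simp: s)
    also have "\<dots> = (\<integral>\<^sup>+x. indicator A (T x) \<partial>sph n m u)"
      by (rule nn_integral_distr[OF Tm']) (rule borel_measurable_indicator, use A in \<open>simp add: s\<close>)
    also have "\<dots> = (\<integral>\<^sup>+x. indicator A (T (lmap m u (dirn m x))) * indicator (unit_ball m) x \<partial>lebesgue_Rn m)
      / ennreal (unit_ball_vol (real m))"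
      by (rule nn_integral_sph) (rule measurable_compose[OF Tm iA])
    also have "(\<integral>\<^sup>+x. indicator A (T (lmap m u (dirn m x))) * indicator (unit_ball m) x \<partial>lebesgue_Rn m) =
      (\<integral>\<^sup>+x. ?f (W x) \<partial>lebesgue_Rn m)"
    proof (rule nn_integral_cong_AE)
      show "AE x in lebesgue_Rn m. indicator A (T (lmap m u (dirn m x))) * indicator (unit_ball m) x = ?f (W x)"
        using AE_lebesgue_Rn[of m] AE_nrm_pos[OF m]
        by eventually_elim (auto simp: TJ Wdir unit_ball_def W_Rn W_nrm indicator_def)
    qed
    also have "\<dots> = (\<integral>\<^sup>+x. ?f x \<partial>lebesgue_Rn m)"
      unfolding W_def by (rule nn_integral_isometry[OF _ _ f]) (use W_bij W_nrm in \<open>auto simp: W_def\<close>)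
    also have "\<dots> / ennreal (unit_ball_vol (real m)) = (\<integral>\<^sup>+x. indicator A x \<partial>sph n m u)"
      by (rule nn_integral_sph[symmetric]) (rule iA)
    also have "\<dots> = emeasure (sph n m u) A" using A by (subst nn_integral_indicator) (auto simp: s)
    finally show "emeasure (distr (sph n m u) (sph n m u) T) A = emeasure (sph n m u) A" .
  qed simp
qed

text \<open>Existence and uniqueness together evaluate the definite description. From here on the
  sphere measure is computed through integrals over the unit ball of R^m.\<close>

lemma sphere_measure_eq: "sphere_measure n (lmap m u ` Rn m) = sph n m u"
  unfolding sphere_measure_def
proof (rule the_equality, fold invariant_on_sphere_def)
  show "invariant_on_sphere n (lmap m u ` Rn m) (sph n m u)" by (rule invariant_sph)
  fix \<mu> assume "invariant_on_sphere n (lmap m u ` Rn m) \<mu>"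
  then show "\<mu> = sph n m u"
    using orthonormal_lmap_Rn[OF on]
    by (intro invariant_on_sphere_unique[OF orthonormal_image_subspace[OF on] _ orthonormal_image_borel[OF on] _ invariant_sph]) auto
qed

end

section \<open>The isotropic constant\<close>

text \<open>The second moment as an extended non-negative integral, so that Fubini and changes of
  variables need no integrability; \<open>LINT_mom\<close> converts back.\<close>

definition mom :: "nat \<Rightarrow> (nat \<Rightarrow> real) set \<Rightarrow> (nat \<Rightarrow> real) \<Rightarrow> ennreal"
  where "mom n S \<theta> = (\<integral>\<^sup>+x. indicator S x * ennreal ((ip n x \<theta>)\<^sup>2) \<partial>lebesgue_Rn n)"

lemma LINT_mom:
  assumes [measurable]: "S \<in> sets borel"
  shows "(LINT x:S|lebesgue_Rn n. (ip n x \<theta>)\<^sup>2) = enn2real (mom n S \<theta>)"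
  unfolding set_lebesgue_integral_def mom_def
  by (subst integral_eq_nn_integral) (auto simp: indicator_def intro!: arg_cong[where f = enn2real] nn_integral_cong)

lemma compact_nrm_bounded:
  assumes "compact S"
  obtains R where "R > 0" "\<And>x. x \<in> S \<Longrightarrow> nrm n x \<le> R"
proof -
  have "compact (nrm n ` S)"
    using continuous_on_nrm[where S = S and n = n and y = 0] by (intro compact_continuous_image assms) simp
  then obtain R where R: "\<And>x. x \<in> S \<Longrightarrow> nrm n x \<le> R"
    using compact_imp_bounded[of "nrm n ` S"] by (force simp: bounded_iff)
  show thesis by (rule that[of "max R 1"]) (use R in \<open>auto simp: le_max_iff_disj\<close>)
qed

lemma compact_emeasure_finite:
  assumes "compact S" shows "emeasure (lebesgue_Rn n) S < \<infinity>"
proof -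
  obtain R where R: "R > 0" "\<And>x. x \<in> S \<Longrightarrow> nrm n x \<le> R" using compact_nrm_bounded[OF assms] by metis
  have "emeasure (lebesgue_Rn n) S \<le> emeasure (lebesgue_Rn n) {x. nrm n x \<le> R}"
    by (rule emeasure_mono) (use R in auto)
  also have "\<dots> < \<infinity>" using emeasure_nrm_le[OF R(1)] by simp
  finally show ?thesis .
qed

lemma mom_finite:
  assumes S: "compact S" shows "mom n S \<theta> < \<infinity>"
proof -
  obtain R where R: "R > 0" "\<And>x. x \<in> S \<Longrightarrow> nrm n x \<le> R" using compact_nrm_bounded[OF assms] by metis
  have [measurable]: "S \<in> sets borel" using S by (simp add: borel_compact)
  have "mom n S \<theta> \<le> (\<integral>\<^sup>+x. ennreal ((R * nrm n \<theta>)\<^sup>2) * indicator S x \<partial>lebesgue_Rn n)"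
    unfolding mom_def
  proof (rule nn_integral_mono)
    fix x
    have "(ip n x \<theta>)\<^sup>2 \<le> (R * nrm n \<theta>)\<^sup>2" if "x \<in> S"
    proof -
      have "\<bar>ip n x \<theta>\<bar> \<le> nrm n x * nrm n \<theta>" by (rule ip_abs_le)
      also have "\<dots> \<le> R * nrm n \<theta>" by (rule mult_right_mono) (use R(2)[OF that] in auto)
      finally show ?thesis using R(1) by (simp add: abs_le_square_iff[symmetric] abs_mult)
    qed
    then show "indicator S x * ennreal ((ip n x \<theta>)\<^sup>2) \<le> ennreal ((R * nrm n \<theta>)\<^sup>2) * indicator S x"
      by (auto simp: indicator_def intro!: ennreal_leI)
  qed
  also have "\<dots> = ennreal ((R * nrm n \<theta>)\<^sup>2) * emeasure (lebesgue_Rn n) S"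
    by (rule nn_integral_cmult_indicator) simp
  also have "\<dots> < \<infinity>" using compact_emeasure_finite[OF S, of n] by (simp add: ennreal_mult_less_top)
  finally show ?thesis .
qed

lemma mom_scale_right:
  assumes [measurable]: "S \<in> sets borel"
  shows "mom n S (r *\<^sub>R \<theta>) = ennreal (r\<^sup>2) * mom n S \<theta>"
  unfolding mom_def
  by (subst nn_integral_cmult[symmetric])
    (auto simp: ip_lin power_mult_distrib ennreal_mult mult_ac)

text \<open>Homogeneity extends the constant on the unit sphere to a multiple of the squared norm on
  \<open>Rn n\<close>, the form in which moments can be compared under linear maps.\<close>

lemma mom_isotropic:
  assumes S: "compact S" and c: "\<And>\<theta>. \<theta> \<in> unit_sphere n (Rn n) \<Longrightarrow> (LINT x:S|lebesgue_Rn n. (ip n x \<theta>)\<^sup>2) = I"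
    and \<theta>: "\<theta> \<in> Rn n" and I: "I \<ge> 0"
  shows "mom n S \<theta> = ennreal (I * (nrm n \<theta>)\<^sup>2)"
proof (cases "\<theta> = 0")
  case True
  then show ?thesis by (simp add: mom_def)
next
  case False
  have SB: "S \<in> sets borel" using S by (simp add: borel_compact)
  have p: "nrm n \<theta> > 0" using nrm_pos[OF \<theta> False] .
  let ?t = "(1 / nrm n \<theta>) *\<^sub>R \<theta>"
  have t: "?t \<in> unit_sphere n (Rn n)" using \<theta> p by (simp add: unit_sphere_def nrm_scale)
  have "mom n S ?t = ennreal (enn2real (mom n S ?t))" using mom_finite[OF S] by simp
  also have "\<dots> = ennreal I" using c[OF t] by (simp add: LINT_mom[OF SB])
  finally have "ennreal ((nrm n \<theta>)\<^sup>2) * mom n S ?t = ennreal (I * (nrm n \<theta>)\<^sup>2)"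
    using I by (simp add: ennreal_mult mult.commute)
  then show ?thesis
    using mom_scale_right[OF SB, of n "nrm n \<theta>" ?t] p by simp
qed

section \<open>Uniqueness of the isotropic constant\<close>

lemma coords_lin:
  "coords n m u (x + y) = coords n m u x + coords n m u y"
  "coords n m u (x - y) = coords n m u x - coords n m u y"
  "coords n m u (r *\<^sub>R x) = r *\<^sub>R coords n m u x"
  by (auto simp: coords_def cutoff_def ip_lin)

lemma ip_lmap: "ip n (lmap m a x) \<theta> = ip m x (coords n m a \<theta>)"
proof -
  have "ip n (lmap m a x) \<theta> = (\<Sum>i<m. x i * ip n (a i) \<theta>)"
    by (simp add: lmap_def ip_sum ip_lin)
  also have "\<dots> = ip m x (coords n m a \<theta>)"
    unfolding ip_def[of m] coords_def cutoff_def by (rule sum.cong) (auto simp: ip_sym)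
  finally show ?thesis .
qed

lemma ip_Rn_eqI:
  assumes "x \<in> Rn n" "y \<in> Rn n" "\<And>\<theta>. \<theta> \<in> Rn n \<Longrightarrow> ip n x \<theta> = ip n y \<theta>"
  shows "x = y"
  by (rule Rn_eqI[OF assms(1,2)]) (use assms(3)[OF evec_Rn] in \<open>auto simp: ip_evec\<close>)

text \<open>If a linear map takes one isotropic body of volume 1 to another, the second moments show that its transpose is
  a similarity, hence so is the map itself, and its ratio is 1 by comparing volumes.\<close>

lemma similar_of_transpose_similar:
  assumes bij: "bij_betw (lmap n a) (Rn n) (Rn n)" and s: "s > 0"
    and t: "\<And>\<theta>. \<theta> \<in> Rn n \<Longrightarrow> nrm n (coords n n a \<theta>) = s * nrm n \<theta>" and x: "x \<in> Rn n"
  shows "nrm n (lmap n a x) = s * nrm n x"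
proof -
  let ?At = "coords n n a"
  have aR: "lmap n a y \<in> Rn n" if "y \<in> Rn n" for y using bij that by (auto simp: bij_betw_def)
  \<comment> \<open>Polarisation turns the norm identity for the transpose into one for inner
    products, that is, the map times its transpose is \<open>s\<^sup>2\<close> times the identity.
    Bijectivity then lets \<open>x\<close> be written as a transpose image.\<close>
  have ipt: "ip n (?At \<theta>) (?At \<phi>) = s\<^sup>2 * ip n \<theta> \<phi>" if "\<theta> \<in> Rn n" "\<phi> \<in> Rn n" for \<theta> \<phi>
    unfolding ip_polar[of n "?At \<theta>"] ip_polar[of n \<theta>] coords_lin[symmetric]
    using that by (simp add: t power_mult_distrib algebra_simps diff_divide_distrib)
  have AAt: "lmap n a (?At \<phi>) = s\<^sup>2 *\<^sub>R \<phi>" if "\<phi> \<in> Rn n" for \<phi>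
    by (rule ip_Rn_eqI[of _ n]) (use that in \<open>auto simp: aR coords_Rn ip_lmap ipt ip_lin\<close>)
  define \<phi> where "\<phi> = (1 / s\<^sup>2) *\<^sub>R lmap n a x"
  have \<phi>: "\<phi> \<in> Rn n" using aR[OF x] by (simp add: \<phi>_def)
  have "lmap n a (?At \<phi>) = lmap n a x" using s by (simp add: AAt[OF \<phi>]) (simp add: \<phi>_def)
  then have "?At \<phi> = x"
    using bij x coords_Rn[of n n a \<phi>] by (auto simp: bij_betw_def dest: inj_onD)
  then have "nrm n x = s * nrm n \<phi>" using t[OF \<phi>] by simp
  also have "\<dots> = s * (1 / s\<^sup>2 * nrm n (lmap n a x))" by (simp add: \<phi>_def nrm_scale)
  finally show ?thesis using s by (simp add: power2_eq_square)
qed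

lemma isotropic_const_unique:
  assumes n: "n \<ge> 1" and S1: "compact S1" "S1 \<subseteq> Rn n" and S2: "compact S2" "S2 = lmap n a ` S1"
    and bij: "bij_betw (lmap n a) (Rn n) (Rn n)"
    and v: "vol n S1 = 1" "vol n S2 = 1"
    and c1: "c1 \<ge> 0" "\<And>\<theta>. \<theta> \<in> unit_sphere n (Rn n) \<Longrightarrow> (LINT x:S1|lebesgue_Rn n. (ip n x \<theta>)\<^sup>2) = c1\<^sup>2"
    and c2: "c2 \<ge> 0" "\<And>\<theta>. \<theta> \<in> unit_sphere n (Rn n) \<Longrightarrow> (LINT x:S2|lebesgue_Rn n. (ip n x \<theta>)\<^sup>2) = c2\<^sup>2"
  shows "c1 = c2"
proof -
  have B [measurable]: "S1 \<in> sets borel" "S2 \<in> sets borel" using S1 S2 by (auto simp: borel_compact)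
  have e: "emeasure (lebesgue_Rn n) S1 = 1" "emeasure (lebesgue_Rn n) S2 = 1"
    using v compact_emeasure_finite[OF S1(1), of n] compact_emeasure_finite[OF S2(1), of n]
    by (auto simp: vol_def emeasure_eq_ennreal_measure)
  have mem: "lmap n a x \<in> S2 \<longleftrightarrow> x \<in> S1" if "x \<in> Rn n" for x
    using that S1(2) bij unfolding S2(2) bij_betw_def by (auto dest: inj_onD)
  obtain \<kappa> :: real where k: "\<kappa> > 0" "\<And>g. g \<in> borel_measurable borel \<Longrightarrow>
    (\<integral>\<^sup>+x. g (lmap n a x) \<partial>lebesgue_Rn n) = ennreal \<kappa> * (\<integral>\<^sup>+x. g x \<partial>lebesgue_Rn n)"
    using nn_integral_lmap[OF bij] by metis
  have ind: "(\<integral>\<^sup>+x. indicator S2 (lmap n a x) \<partial>lebesgue_Rn n) = 1"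
  proof -
    have "(\<integral>\<^sup>+x. indicator S2 (lmap n a x) \<partial>lebesgue_Rn n) = (\<integral>\<^sup>+x. indicator S1 x \<partial>lebesgue_Rn n)"
      by (rule nn_integral_cong_AE, rule eventually_mono[OF AE_lebesgue_Rn]) (simp add: mem indicator_def)
    then show ?thesis by (simp add: e)
  qed
  have "1 = ennreal \<kappa> * 1" using k(2)[of "indicator S2"] ind e by simp
  then have k1: "\<kappa> = 1" using k(1) by simp
  let ?At = "coords n n a"
  \<comment> \<open>Moments of \<open>S2\<close> in direction \<open>\<theta>\<close> are moments of
    \<open>S1\<close> in the transposed direction; isotropy on both sides reduces this to an
    identity of norms.\<close>
  have eq: "c1 * nrm n (?At \<theta>) = c2 * nrm n \<theta>" if \<theta>: "\<theta> \<in> Rn n" for \<theta>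
  proof -
    have "mom n S2 \<theta> = (\<integral>\<^sup>+x. indicator S2 (lmap n a x) * ennreal ((ip n (lmap n a x) \<theta>)\<^sup>2) \<partial>lebesgue_Rn n)"
      unfolding mom_def by (subst k(2)) (auto simp: k1)
    also have "\<dots> = mom n S1 (?At \<theta>)"
      unfolding mom_def
      by (rule nn_integral_cong_AE, rule eventually_mono[OF AE_lebesgue_Rn]) (simp add: mem indicator_def ip_lmap)
    finally have "mom n S2 \<theta> = mom n S1 (?At \<theta>)" .
    then have "c2\<^sup>2 * (nrm n \<theta>)\<^sup>2 = c1\<^sup>2 * (nrm n (?At \<theta>))\<^sup>2"
      using mom_isotropic[OF S1(1) c1(2) coords_Rn, of n a \<theta>] mom_isotropic[OF S2(1) c2(2) \<theta>] by simp
    then have "(c1 * nrm n (?At \<theta>))\<^sup>2 = (c2 * nrm n \<theta>)\<^sup>2" by (simp add: power_mult_distrib)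
    then show ?thesis using c1(1) c2(1) by (subst (asm) power2_eq_iff_nonneg) auto
  qed
  have e0: "evec 0 \<in> Rn n" "nrm n (evec 0) = 1" using n by (auto simp: evec_Rn nrm_evec)
  show ?thesis
  proof (cases "c1 = 0")
    case True
    then show ?thesis using eq[OF e0(1)] e0(2) by simp
  next
    case False
    define s where "s = c2 / c1"
    have At: "nrm n (?At \<theta>) = s * nrm n \<theta>" if "\<theta> \<in> Rn n" for \<theta>
      using eq[OF that] False by (simp add: s_def field_simps)
    \<comment> \<open>If the ratio vanished, the transpose would kill \<open>evec 0\<close>, and the
      range of the map would be orthogonal to \<open>evec 0\<close>, contradicting
      surjectivity.\<close>
    have "s \<noteq> 0"
    proof
      assume "s = 0"
      then have "?At (evec 0) = 0" using At[OF e0(1)] nrm_eq_0[OF coords_Rn] by simp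
      then have "ip n (lmap n a x) (evec 0) = 0" for x by (simp add: ip_lmap)
      moreover have "evec 0 \<in> lmap n a ` Rn n" using bij e0(1) by (simp add: bij_betw_def)
      then obtain x where "lmap n a x = evec 0" by auto
      ultimately have "ip n (evec 0) (evec 0) = 0" by metis
      then show False using e0(2) by (simp add: nrm_pow2[symmetric])
    qed
    then have s: "s > 0" using c1(1) c2(1) by (simp add: s_def)
    have "(\<integral>\<^sup>+x. indicator S2 (lmap n a x) \<partial>lebesgue_Rn n) = ennreal (1 / s ^ n) * (\<integral>\<^sup>+x. indicator S2 x \<partial>lebesgue_Rn n)"
      by (rule nn_integral_similarity[OF bij s similar_of_transpose_similar[OF bij s At]]) auto
    then have "1 = ennreal (1 / s ^ n)" using ind e by simp
    then have "s ^ n = 1" using s by (simp add: field_simps flip: ennreal_1)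
    then have "s = 1" using power_eq_imp_eq_base[of s n 1] s n by simp
    then show ?thesis using False by (simp add: s_def)
  qed
qed

text \<open>A body that is already isotropic is normalised by a dilation alone: the volume
  contributes \<open>s ^ n\<close> and the square two more factors \<open>s\<close>. Every other
  normalising map differs from the dilation by a linear bijection, and
  \<open>isotropic_const_unique\<close> excludes a second value.\<close>

lemma isotropic_const_eq:
  assumes n: "n \<ge> 1" and K: "compact K" "K \<subseteq> Rn n" and v: "emeasure (lebesgue_Rn n) K = ennreal v" "v > 0"
    and I: "I \<ge> 0" "\<And>\<theta>. \<theta> \<in> unit_sphere n (Rn n) \<Longrightarrow> (LINT x:K|lebesgue_Rn n. (ip n x \<theta>)\<^sup>2) = I"
    and s: "s > 0" "s ^ n * v = 1"
  shows "isotropic_const n K = sqrt (s ^ (n + 2) * I)"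
proof -
  have B [measurable]: "K \<in> sets borel" using K by (auto simp: borel_compact)
  let ?T = "\<lambda>x :: nat \<Rightarrow> real. s *\<^sub>R x"
  have mem: "x \<in> ?T ` K \<longleftrightarrow> (1 / s) *\<^sub>R x \<in> K" for x
    using s(1) by (force simp: image_iff)
  have TK: "compact (?T ` K)"
  proof (rule compact_continuous_image[OF _ K(1)])
    show "continuous_on K ?T"
      by (intro continuous_on_coordinatewise_then_product) (auto intro!: continuous_intros continuous_on_coord)
  qed
  have TKB [measurable]: "?T ` K \<in> sets borel" using TK by (simp add: borel_compact)
  have TR: "?T ` K \<subseteq> Rn n" using K(2) by auto
  have sc: "(\<integral>\<^sup>+x. g ((1 / s) *\<^sub>R x) \<partial>lebesgue_Rn n) = ennreal (s ^ n) * (\<integral>\<^sup>+x. g x \<partial>lebesgue_Rn n)"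
    if "g \<in> borel_measurable borel" for g
    using nn_integral_scaleR[of "1 / s" g n] s(1) that by (simp add: power_divide)
  have "emeasure (lebesgue_Rn n) (?T ` K) = (\<integral>\<^sup>+x. indicator K ((1 / s) *\<^sub>R x) \<partial>lebesgue_Rn n)"
  proof -
    have "(\<lambda>x. indicator K ((1 / s) *\<^sub>R x) :: ennreal) = indicator (?T ` K)"
      unfolding indicator_def using mem by (intro ext) (simp only:)
    then show ?thesis by simp
  qed
  also have "\<dots> = ennreal (s ^ n) * ennreal v" by (subst sc) (auto simp: v)
  also have "\<dots> = 1" using s v(2) by (simp add: ennreal_mult[symmetric])
  finally have vol: "vol n (?T ` K) = 1" by (simp add: vol_def measure_def)
  have mT: "mom n (?T ` K) \<theta> = ennreal (s ^ (n + 2) * I)" if \<theta>: "\<theta> \<in> unit_sphere n (Rn n)" for \<theta>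
  proof -
    have "mom n (?T ` K) \<theta> = (\<integral>\<^sup>+x. indicator K ((1 / s) *\<^sub>R x) * ennreal ((ip n ((1 / s) *\<^sub>R x) (s *\<^sub>R \<theta>))\<^sup>2) \<partial>lebesgue_Rn n)"
      unfolding mom_def using s(1) by (intro nn_integral_cong) (simp add: mem indicator_def ip_lin)
    also have "\<dots> = ennreal (s ^ n) * mom n K (s *\<^sub>R \<theta>)"
      unfolding mom_def by (subst sc[of "\<lambda>x. indicator K x * ennreal ((ip n x (s *\<^sub>R \<theta>))\<^sup>2)"]) auto
    also have "mom n K (s *\<^sub>R \<theta>) = ennreal (I * (nrm n (s *\<^sub>R \<theta>))\<^sup>2)"
      by (rule mom_isotropic[OF K(1) I(2) _ I(1)]) (use \<theta> in \<open>auto simp: unit_sphere_def\<close>)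
    also have "nrm n (s *\<^sub>R \<theta>) = s" using \<theta> s by (simp add: nrm_scale unit_sphere_def)
    also have "ennreal (s ^ n) * ennreal (I * s\<^sup>2) = ennreal (s ^ (n + 2) * I)"
      using s(1) I(1) by (simp add: ennreal_mult[symmetric] power_add power2_eq_square mult_ac)
    finally show ?thesis .
  qed
  define c where "c = sqrt (s ^ (n + 2) * I)"
  have c: "c \<ge> 0" "c\<^sup>2 = s ^ (n + 2) * I" using s(1) I(1) by (auto simp: c_def)
  have LT: "(LINT x:?T ` K|lebesgue_Rn n. (ip n x \<theta>)\<^sup>2) = c\<^sup>2" if "\<theta> \<in> unit_sphere n (Rn n)" for \<theta>
    using mT[OF that] s(1) I(1) by (simp add: LINT_mom c(2))
  have lT: "linear ?T" by (rule linear_scaleR)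
  have bT: "bij_betw ?T (Rn n) (Rn n)"
    by (rule bij_betw_byWitness[where f' = "\<lambda>x. (1 / s) *\<^sub>R x"]) (use s in auto)
  show ?thesis
    unfolding isotropic_const_def c_def[symmetric]
  proof (rule the_equality)
    show "c \<ge> 0 \<and> (\<exists>T. linear T \<and> bij_betw T (Rn n) (Rn n) \<and> vol n (T ` K) = 1 \<and> isotropic n (T ` K) \<and>
      (\<forall>\<theta>\<in>unit_sphere n (Rn n). (LINT x:T ` K|lebesgue_Rn n. (ip n x \<theta>)\<^sup>2) = c\<^sup>2))"
      by (intro conjI exI[of _ ?T] c lT bT vol) (auto simp: isotropic_def LT)
    fix c' assume "c' \<ge> 0 \<and> (\<exists>T. linear T \<and> bij_betw T (Rn n) (Rn n) \<and> vol n (T ` K) = 1 \<and> isotropic n (T ` K) \<and>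
      (\<forall>\<theta>\<in>unit_sphere n (Rn n). (LINT x:T ` K|lebesgue_Rn n. (ip n x \<theta>)\<^sup>2) = c'\<^sup>2))"
    then obtain T where c': "c' \<ge> 0" and T: "linear T" "bij_betw T (Rn n) (Rn n)" "vol n (T ` K) = 1"
      "\<And>\<theta>. \<theta> \<in> unit_sphere n (Rn n) \<Longrightarrow> (LINT x:T ` K|lebesgue_Rn n. (ip n x \<theta>)\<^sup>2) = c'\<^sup>2" by auto
    \<comment> \<open>The matrix of \<open>T\<close> preceded by the inverse dilation; it carries
      the normalised dilate of \<open>K\<close> onto the image of \<open>K\<close> under
      \<open>T\<close>.\<close>
    define a where "a i = (1 / s) *\<^sub>R T (evec i)" for i
    have a: "lmap n a x = T ((1 / s) *\<^sub>R x)" if "x \<in> Rn n" for x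
    proof -
      have "linear (\<lambda>x. T ((1 / s) *\<^sub>R x))"
        using linear_compose[OF linear_scaleR T(1), of "1 / s"] by (simp add: comp_def)
      from linear_eq_lmap[OF this that] show ?thesis
        using linear_scale[OF T(1)] by (simp add: a_def[abs_def])
    qed
    have "bij_betw (\<lambda>x. (1 / s) *\<^sub>R x) (Rn n) (Rn n)"
      by (rule bij_betw_byWitness[where f' = "\<lambda>x. s *\<^sub>R x"]) (use s in auto)
    from bij_betw_trans[OF this T(2)] have ba: "bij_betw (lmap n a) (Rn n) (Rn n)"
      by (subst bij_betw_cong[OF a]) (auto simp: comp_def)
    have TKa: "T ` K = lmap n a ` ?T ` K"
      using K(2) s(1) by (force simp: a image_image intro!: image_cong)
    have "compact (lmap n a ` ?T ` K)"
      by (rule compact_continuous_image[OF continuous_on_lmap TK])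
    then have "compact (T ` K)" by (simp only: TKa)
    then have "c = c'"
      by (rule isotropic_const_unique[OF n TK TR _ TKa ba vol T(3) c(1) LT c' T(4)])
    then show "c' = c" ..
  qed
qed

section \<open>The Prekopa--Leindler inequality\<close>

lemma emeasure_affine_preimage:
  assumes [measurable]: "A \<in> sets borel" and c: "c > (0::real)"
  shows "emeasure lborel {z. (z - t) / c \<in> A} = ennreal c * emeasure lborel A"
proof -
  have "emeasure lborel {z. (z - t) / c \<in> A} = (\<integral>\<^sup>+z. indicator A ((z - t) / c) \<partial>lborel)"
  proof -
    have "emeasure lborel {z. (z - t) / c \<in> A} = (\<integral>\<^sup>+z. indicator {z. (z - t) / c \<in> A} z \<partial>lborel)" by simp
    also have "\<dots> = (\<integral>\<^sup>+z. indicator A ((z - t) / c) \<partial>lborel)"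
      by (rule nn_integral_cong) (simp add: indicator_def)
    finally show ?thesis .
  qed
  also have "\<dots> = ennreal \<bar>c\<bar> * (\<integral>\<^sup>+x. indicator A (((t + c * x) - t) / c) \<partial>lborel)"
    by (rule nn_integral_real_affine) (use c in auto)
  also have "\<dots> = ennreal c * emeasure lborel A" using c by simp
  finally show ?thesis .
qed

text \<open>Take \<open>a\<close> near the supremum of \<open>A\<close> and \<open>b\<close> near
  the infimum of \<open>B\<close>. The sets (1 - l) A + l b and (1 - l) a + l B both lie in
  \<open>C\<close>, one essentially to the left of the other: their overlap has length at most
  \<open>e\<close>. The \<open>e\<close> is unavoidable since the extrema need not be
  attained.\<close>

lemma brunn_minkowski_1_bounded:
  assumes [measurable]: "A \<in> sets borel" "B \<in> sets borel" "C \<in> sets borel"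
    and ne: "A \<noteq> {}" "B \<noteq> {}" and bdd: "bdd_above A" "bdd_below B" and l: "0 < l" "l < (1::real)"
    and C: "\<And>a b. a \<in> A \<Longrightarrow> b \<in> B \<Longrightarrow> (1 - l) * a + l * b \<in> C"
  shows "ennreal (1 - l) * emeasure lborel A + ennreal l * emeasure lborel B \<le> emeasure lborel C"
proof (rule ennreal_le_epsilon)
  fix e :: real assume e: "e > 0"
  obtain a where a: "a \<in> A" "Sup A - e < a"
    using less_cSup_iff[OF ne(1) bdd(1), of "Sup A - e"] e by auto
  obtain b where b: "b \<in> B" "b < Inf B + e"
    using cInf_less_iff[OF ne(2) bdd(2), of "Inf B + e"] e by auto
  let ?A = "{z. (z - l * b) / (1 - l) \<in> A}" and ?B = "{z. (z - (1 - l) * a) / l \<in> B}"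
  have AC: "?A \<subseteq> C"
  proof
    fix z assume "z \<in> ?A"
    then have "(1 - l) * ((z - l * b) / (1 - l)) + l * b \<in> C" using C b by blast
    then show "z \<in> C" using l by simp
  qed
  have BC: "?B \<subseteq> C"
  proof
    fix z assume "z \<in> ?B"
    then have "(1 - l) * a + l * ((z - (1 - l) * a) / l) \<in> C" using C a by blast
    then show "z \<in> C" using l by simp
  qed
  have AB: "?A \<inter> ?B \<subseteq> {(1 - l) * a + l * Inf B .. (1 - l) * Sup A + l * b}"
  proof
    fix z assume z: "z \<in> ?A \<inter> ?B"
    then have "(z - l * b) / (1 - l) \<le> Sup A" "Inf B \<le> (z - (1 - l) * a) / l"
      using cSup_upper bdd cInf_lower by auto
    then show "z \<in> {(1 - l) * a + l * Inf B .. (1 - l) * Sup A + l * b}"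
      using l by (auto simp: field_simps)
  qed
  have len: "(1 - l) * Sup A + l * b - ((1 - l) * a + l * Inf B) \<le> e"
  proof -
    have "(1 - l) * (Sup A - a) \<le> (1 - l) * e" "l * (b - Inf B) \<le> l * e"
      using a b l by (intro mult_left_mono; simp)+
    then show ?thesis by (simp add: algebra_simps)
  qed
  have "ennreal (1 - l) * emeasure lborel A + ennreal l * emeasure lborel B = emeasure lborel ?A + emeasure lborel ?B"
    using l by (simp add: emeasure_affine_preimage)
  also have "\<dots> = emeasure lborel (?A \<union> ?B) + emeasure lborel (?A \<inter> ?B)"
    by (rule emeasure_Un_Int) measurable
  also have "\<dots> \<le> emeasure lborel C + emeasure lborel {(1 - l) * a + l * Inf B .. (1 - l) * Sup A + l * b}"
    by (intro add_mono emeasure_mono) (use AC BC AB in auto)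
  also have "\<dots> \<le> emeasure lborel C + ennreal e"
    by (intro add_mono order_refl, subst emeasure_lborel_Icc_eq) (use len e in \<open>auto intro!: ennreal_leI\<close>)
  finally show "ennreal (1 - l) * emeasure lborel A + ennreal l * emeasure lborel B \<le> emeasure lborel C + ennreal e" .
qed

text \<open>Boundedness is removed by intersecting with growing intervals and passing to the limit
  of measures.\<close>

lemma brunn_minkowski_1:
  assumes A [measurable]: "A \<in> sets borel" and B [measurable]: "B \<in> sets borel" and [measurable]: "C \<in> sets borel"
    and ne: "A \<noteq> {}" "B \<noteq> {}" and l: "0 < l" "l < (1::real)"
    and C: "\<And>a b. a \<in> A \<Longrightarrow> b \<in> B \<Longrightarrow> (1 - l) * a + l * b \<in> C"
  shows "ennreal (1 - l) * emeasure lborel A + ennreal l * emeasure lborel B \<le> emeasure lborel C"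
proof -
  obtain a b where ab: "a \<in> A" "b \<in> B" using ne by auto
  let ?I = "\<lambda>N::nat. {- real N .. real N}"
  have lim: "(\<lambda>N. emeasure lborel (X \<inter> ?I N)) \<longlonglongrightarrow> emeasure lborel X" if X: "X \<in> sets borel" for X
  proof -
    have "(\<Union>N. X \<inter> ?I N) = X"
    proof -
      have "\<exists>N::nat. x \<in> ?I N" for x
        using real_arch_simple[of "\<bar>x\<bar>"] by (auto simp: abs_le_iff minus_le_iff)
      then show ?thesis by auto
    qed
    moreover have "incseq (\<lambda>N. X \<inter> ?I N)" by (fastforce simp: incseq_def)
    moreover have "range (\<lambda>N. X \<inter> ?I N) \<subseteq> sets lborel" using X by auto
    ultimately show ?thesis using Lim_emeasure_incseq[of "\<lambda>N. X \<inter> ?I N" lborel] by simp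
  qed
  have "(\<lambda>N. ennreal (1 - l) * emeasure lborel (A \<inter> ?I N) + ennreal l * emeasure lborel (B \<inter> ?I N))
    \<longlonglongrightarrow> ennreal (1 - l) * emeasure lborel A + ennreal l * emeasure lborel B"
    by (intro tendsto_intros ennreal_tendsto_cmult lim A B) auto
  then show ?thesis
  proof (rule LIMSEQ_le_const2)
    obtain N0 :: nat where N0: "max \<bar>a\<bar> \<bar>b\<bar> \<le> real N0" using real_arch_simple by blast
    show "\<exists>N0. \<forall>N\<ge>N0. ennreal (1 - l) * emeasure lborel (A \<inter> ?I N) + ennreal l * emeasure lborel (B \<inter> ?I N) \<le> emeasure lborel C"
    proof (intro exI[of _ N0] allI impI brunn_minkowski_1_bounded l)
      fix N assume "N0 \<le> N"
      then have "real N0 \<le> real N" by simp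
      then show "A \<inter> ?I N \<noteq> {}" "B \<inter> ?I N \<noteq> {}" using N0 ab by (auto simp: abs_le_iff)
      show "bdd_above (A \<inter> ?I N)" "bdd_below (B \<inter> ?I N)"
        by (auto intro: bdd_above_Int2 bdd_below_Int2)
      fix x y assume "x \<in> A \<inter> ?I N" "y \<in> B \<inter> ?I N"
      then show "(1 - l) * x + l * y \<in> C" using C by auto
    qed auto
  qed
qed

section \<open>Superlevel sets and functional inequalities on the line\<close>

lemma emeasure_lborel_Ioi: "emeasure lborel {0::real<..} = top"
proof -
  have "of_nat N \<le> emeasure lborel {0::real<..}" for N
  proof -
    have "emeasure lborel {0<..<real N} \<le> emeasure lborel {0::real<..}" by (rule emeasure_mono) auto
    then show ?thesis by (simp add: ennreal_of_nat_eq_real_of_nat)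
  qed
  then have "(SUP N. of_nat N) \<le> emeasure lborel {0::real<..}" by (intro SUP_least)
  then show ?thesis by (simp add: ennreal_SUP_of_nat_eq_top top_unique)
qed

lemma nn_integral_layer_cake:
  assumes "sigma_finite_measure M" and [measurable]: "u \<in> borel_measurable M"
  shows "(\<integral>\<^sup>+x. u x \<partial>M) = (\<integral>\<^sup>+t. emeasure M {x \<in> space M. ennreal t < u x} * indicator {0<..} t \<partial>lborel)"
proof -
  interpret sigma_finite_measure M by fact
  interpret pair_sigma_finite M "lborel :: real measure" ..
  let ?k = "\<lambda>t x. if ennreal t < u x \<and> 0 < t then 1 else 0 :: ennreal"
  have "u x = (\<integral>\<^sup>+t. ?k t x \<partial>lborel)" for x
  proof (cases "u x")
    case (real r)
    then have "?k t x = indicator {0<..<r} t" for t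
      by (auto simp: indicator_def ennreal_less_iff)
    then show ?thesis using real by simp
  next
    case top
    then have "?k t x = indicator {0<..} t" for t by (auto simp: indicator_def)
    then show ?thesis using top by (simp add: emeasure_lborel_Ioi)
  qed
  then have "(\<integral>\<^sup>+x. u x \<partial>M) = (\<integral>\<^sup>+x. (\<integral>\<^sup>+t. ?k t x \<partial>lborel) \<partial>M)" by simp
  also have "\<dots> = (\<integral>\<^sup>+t. (\<integral>\<^sup>+x. ?k t x \<partial>M) \<partial>lborel)"
    by (rule Fubini'[symmetric]) measurable
  also have "\<dots> = (\<integral>\<^sup>+t. emeasure M {x \<in> space M. ennreal t < u x} * indicator {0<..} t \<partial>lborel)"
  proof (rule nn_integral_cong)
    fix t
    have "(\<integral>\<^sup>+x. ?k t x \<partial>M) = (\<integral>\<^sup>+x. indicator {x \<in> space M. ennreal t < u x} x * indicator {0<..} t \<partial>M)"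
      by (rule nn_integral_cong) (auto simp: indicator_def)
    also have "\<dots> = emeasure M {x \<in> space M. ennreal t < u x} * indicator {0<..} t"
      by (rule nn_integral_multc[THEN trans]) auto
    finally show "(\<integral>\<^sup>+x. ?k t x \<partial>M) = emeasure M {x \<in> space M. ennreal t < u x} * indicator {0<..} t" .
  qed
  finally show ?thesis .
qed

text \<open>One-dimensional Brunn-Minkowski at each level, integrated by the layer cake formula.
  Equality of the suprema guarantees that the level sets of \<open>u\<close> and \<open>v\<close>
  are empty at the same levels, which is exactly the non-emptiness that Brunn-Minkowski asks for.
  The arithmetic mean in the conclusion is used twice: for Prekopa-Leindler and for the convexity of
  Ball's body.\<close>

lemma quasi_concave_marginal:
  fixes u v h :: "real \<Rightarrow> ennreal"
  assumes [measurable]: "u \<in> borel_measurable borel" "v \<in> borel_measurable borel" "h \<in> borel_measurable borel"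
    and l: "0 < l" "l < (1::real)" and sup: "(SUP x. u x) = (SUP y. v y)"
    and h: "\<And>x y. min (u x) (v y) \<le> h ((1 - l) * x + l * y)"
  shows "ennreal (1 - l) * (\<integral>\<^sup>+x. u x \<partial>lborel) + ennreal l * (\<integral>\<^sup>+x. v x \<partial>lborel) \<le> (\<integral>\<^sup>+x. h x \<partial>lborel)"
proof -
  let ?m = "\<lambda>f t. emeasure lborel {x. ennreal t < f x} * indicator {0::real<..} t"
  have lc: "(\<integral>\<^sup>+x. f x \<partial>lborel) = (\<integral>\<^sup>+t. ?m f t \<partial>lborel)" if "f \<in> borel_measurable borel" for f :: "real \<Rightarrow> ennreal"
    using nn_integral_layer_cake[of lborel f] that lborel.sigma_finite_measure_axioms by simp
  have mm [measurable]: "?m f \<in> borel_measurable borel" if [measurable]: "f \<in> borel_measurable borel" for f :: "real \<Rightarrow> ennreal"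
  proof -
    have "(\<lambda>t. emeasure lborel (Pair t -` {p. ennreal (fst p) < f (snd p)})) \<in> borel_measurable (borel :: real measure)"
    proof (rule lborel.measurable_emeasure_Pair[where N = "borel :: real measure", simplified])
      have "{p \<in> space (borel \<Otimes>\<^sub>M borel :: (real \<times> real) measure). ennreal (fst p) < f (snd p)}
        \<in> sets (borel \<Otimes>\<^sub>M borel)" by measurable
      then show "{p. ennreal (fst p) < f (snd p)} \<in> sets (borel \<Otimes>\<^sub>M borel)"
        by (simp add: space_pair_measure)
    qed
    then show ?thesis by (simp add: vimage_def)
  qed
  have "ennreal (1 - l) * (\<integral>\<^sup>+x. u x \<partial>lborel) + ennreal l * (\<integral>\<^sup>+x. v x \<partial>lborel)
    = (\<integral>\<^sup>+t. ennreal (1 - l) * ?m u t + ennreal l * ?m v t \<partial>lborel)"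
    using mm[OF assms(1)] mm[OF assms(2)]
    by (subst nn_integral_add) (simp_all add: nn_integral_cmult lc[OF assms(1)] lc[OF assms(2)])
  also have "\<dots> \<le> (\<integral>\<^sup>+t. ?m h t \<partial>lborel)"
  proof (rule nn_integral_mono)
    fix t :: real
    have "ennreal (1 - l) * emeasure lborel {x. ennreal t < u x} + ennreal l * emeasure lborel {x. ennreal t < v x}
      \<le> emeasure lborel {x. ennreal t < h x}"
    proof (cases "ennreal t < (SUP x. u x)")
      case True
      have "\<exists>x. ennreal t < u x" using True by (simp add: less_SUP_iff)
      moreover have "\<exists>x. ennreal t < v x" using True unfolding sup by (simp add: less_SUP_iff)
      ultimately show ?thesis
        by (intro brunn_minkowski_1 l) (auto intro: less_le_trans[OF _ h])
    next
      case False
      then have "\<not> ennreal t < u x" "\<not> ennreal t < v x" for x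
        using sup by (metis SUP_upper UNIV_I less_le_trans)+
      then show ?thesis by simp
    qed
    then show "ennreal (1 - l) * ?m u t + ennreal l * ?m v t \<le> ?m h t"
      by (auto simp: indicator_def)
  qed
  also have "\<dots> = (\<integral>\<^sup>+x. h x \<partial>lborel)" by (rule lc[symmetric]) simp
  finally show ?thesis .
qed

text \<open>There is no real power on \<^typ>\<open>ennreal\<close>; \<open>PLrel l a b c\<close> expresses \<open>a\<^sup>1\<^sup>-\<^sup>l b\<^sup>l \<le> c\<close>.\<close>

definition PLrel :: "real \<Rightarrow> ennreal \<Rightarrow> ennreal \<Rightarrow> ennreal \<Rightarrow> bool"
  where "PLrel l a b c \<longleftrightarrow> (\<forall>s>0. \<forall>t>0. ennreal s \<le> a \<longrightarrow> ennreal t \<le> b \<longrightarrow>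
    ennreal (s powr (1 - l) * t powr l) \<le> c)"

lemma PLrel_mono: "PLrel l a b c \<Longrightarrow> a' \<le> a \<Longrightarrow> b' \<le> b \<Longrightarrow> c \<le> c' \<Longrightarrow> PLrel l a' b' c'"
  unfolding PLrel_def by (meson order.trans)

lemma powr_scale:
  assumes "c > 0" "s > 0" "t > (0::real)"
  shows "(c * s) powr (1 - l) * (c * t) powr l = c * (s powr (1 - l) * t powr l)"
proof -
  have "(c * s) powr (1 - l) * (c * t) powr l = (c powr (1 - l) * c powr l) * (s powr (1 - l) * t powr l)"
    using assms by (simp add: powr_mult mult_ac)
  also have "c powr (1 - l) * c powr l = c" using assms by (simp add: powr_add[symmetric])
  finally show ?thesis .
qed

text \<open>Boundedness and positive integrals put the suprema of \<open>u\<close> and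
  \<open>v\<close> strictly between 0 and infinity. Dividing by them reduces to
  \<open>quasi_concave_marginal\<close>; Young's inequality then weakens its arithmetic mean to the
  geometric one.\<close>

lemma prekopa_leindler_1_bounded:
  fixes u v h :: "real \<Rightarrow> ennreal"
  assumes [measurable]: "u \<in> borel_measurable borel" "v \<in> borel_measurable borel" "h \<in> borel_measurable borel"
    and l: "0 < l" "l < (1::real)" and bdd: "\<And>x. u x \<le> ennreal N" "\<And>x. v x \<le> ennreal N"
    and h: "\<And>x y. PLrel l (u x) (v y) (h ((1 - l) * x + l * y))"
  shows "PLrel l (\<integral>\<^sup>+x. u x \<partial>lborel) (\<integral>\<^sup>+x. v x \<partial>lborel) (\<integral>\<^sup>+x. h x \<partial>lborel)"
  unfolding PLrel_def
proof (intro allI impI)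
  fix s t :: real assume s: "s > 0" "ennreal s \<le> (\<integral>\<^sup>+x. u x \<partial>lborel)" and t: "t > 0" "ennreal t \<le> (\<integral>\<^sup>+x. v x \<partial>lborel)"
  have sup: "\<exists>a>0. (SUP x. w x) = ennreal a" if w: "\<And>x. w x \<le> ennreal N" and "0 < r" "ennreal r \<le> (\<integral>\<^sup>+x. w x \<partial>lborel)"
    for w :: "real \<Rightarrow> ennreal" and r
  proof -
    have "(SUP x. w x) \<le> ennreal N" by (rule SUP_least) (rule w)
    then have "(SUP x. w x) \<noteq> top" by (metis ennreal_neq_top neq_top_trans)
    then obtain a where a: "a \<ge> 0" "(SUP x. w x) = ennreal a" by (cases "SUP x. w x") auto
    have "a \<noteq> 0"
    proof
      assume "a = 0"
      then have "w x \<le> 0" for x using a by (metis SUP_upper UNIV_I ennreal_0)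
      then have "(\<integral>\<^sup>+x. w x \<partial>lborel) = 0" by simp
      then show False using that by simp
    qed
    then show ?thesis using a by (intro exI[of _ a]) auto
  qed
  obtain a where a: "a > 0" "(SUP x. u x) = ennreal a" using sup[OF bdd(1) s] by auto
  obtain b where b: "b > 0" "(SUP x. v x) = ennreal b" using sup[OF bdd(2) t] by auto
  \<comment> \<open>The matching normalisation of \<open>h\<close>: by homogeneity of the geometric
    mean, a common lower bound of the rescaled \<open>u\<close> and \<open>v\<close> is one for the
    rescaled \<open>h\<close>.\<close>
  define c where "c = a powr (1 - l) * b powr l"
  have c: "c > 0" using a b by (simp add: c_def)
  let ?u = "\<lambda>x. ennreal (1 / a) * u x" and ?v = "\<lambda>x. ennreal (1 / b) * v x" and ?h = "\<lambda>x. ennreal (1 / c) * h x"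
  have inv: "ennreal (1 / a) * ennreal a = 1" "ennreal (1 / b) * ennreal b = 1" "ennreal c * ennreal (1 / c) = 1"
    using a b c by (auto simp: ennreal_mult[symmetric])
  have key: "ennreal (1 - l) * (\<integral>\<^sup>+x. ?u x \<partial>lborel) + ennreal l * (\<integral>\<^sup>+x. ?v x \<partial>lborel) \<le> (\<integral>\<^sup>+x. ?h x \<partial>lborel)"
  proof (rule quasi_concave_marginal[OF _ _ _ l])
    show "(SUP x. ?u x) = (SUP x. ?v x)"
      using a b inv by (simp add: SUP_mult_left_ennreal[symmetric])
    fix x y
    show "min (?u x) (?v y) \<le> ?h ((1 - l) * x + l * y)"
    proof (cases "min (?u x) (?v y)")
      case top
      then have "u x = top" using a by (auto simp: min_def ennreal_mult_eq_top_iff split: if_splits)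
      then show ?thesis using bdd(1)[of x] by (simp add: top_unique)
    next
      case (real m)
      show ?thesis
      proof (cases "m = 0")
        case False
        then have m: "m > 0" using real by simp
        have "ennreal m \<le> ?u x" "ennreal m \<le> ?v y" using real(2) by (metis min.cobounded1 min.cobounded2)+
        then have "ennreal a * ennreal m \<le> ennreal a * ?u x" "ennreal b * ennreal m \<le> ennreal b * ?v y"
          by (auto intro: mult_left_mono)
        then have "ennreal (m * a) \<le> u x" "ennreal (m * b) \<le> v y"
          using inv(1,2) a b m by (simp_all add: ennreal_mult mult_ac) (simp_all add: mult.assoc[symmetric] mult.commute)
        then have "ennreal ((m * a) powr (1 - l) * (m * b) powr l) \<le> h ((1 - l) * x + l * y)"
          using h[of x y] m a b unfolding PLrel_def by auto
        then have "ennreal (m * c) \<le> h ((1 - l) * x + l * y)"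
          using powr_scale[OF m a(1) b(1), of l] by (simp add: c_def)
        then have "ennreal (1 / c) * ennreal (m * c) \<le> ?h ((1 - l) * x + l * y)"
          by (rule mult_left_mono) simp
        moreover have "ennreal (1 / c) * ennreal (m * c) = ennreal m"
          using c m by (simp add: ennreal_mult[symmetric])
        ultimately show ?thesis using real by simp
      qed (use real in simp)
    qed
  qed auto
  have "s powr (1 - l) * t powr l = c * ((s / a) powr (1 - l) * (t / b) powr l)"
    using a b s t by (simp add: c_def powr_divide)
  also have "\<dots> \<le> c * ((1 - l) * (s / a) + l * (t / b))"
    using Youngs_inequality_0[of "1 - l" l "s / a" "t / b"] a b s t l c by (intro mult_left_mono) auto
  finally have "ennreal (s powr (1 - l) * t powr l) \<le> ennreal (c * ((1 - l) * (s / a) + l * (t / b)))"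
    by (rule ennreal_leI)
  also have "\<dots> = ennreal c * (ennreal (1 - l) * (ennreal (1 / a) * ennreal s) + ennreal l * (ennreal (1 / b) * ennreal t))"
    using a b c s t l by (simp add: ennreal_mult[symmetric] ennreal_plus[symmetric] del: ennreal_plus)
  also have "\<dots> \<le> ennreal c * (ennreal (1 - l) * (\<integral>\<^sup>+x. ?u x \<partial>lborel) + ennreal l * (\<integral>\<^sup>+x. ?v x \<partial>lborel))"
    using s(2) t(2) by (intro mult_left_mono add_mono) (auto simp: nn_integral_cmult intro!: mult_left_mono)
  also have "\<dots> \<le> ennreal c * (\<integral>\<^sup>+x. ?h x \<partial>lborel)" by (intro mult_left_mono key) simp
  also have "\<dots> = (\<integral>\<^sup>+x. h x \<partial>lborel)"
    using inv(3) by (simp add: nn_integral_cmult mult.assoc[symmetric])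
  finally show "ennreal (s powr (1 - l) * t powr l) \<le> (\<integral>\<^sup>+x. h x \<partial>lborel)" .
qed

text \<open>Provides the strict inequality that a truncation argument needs, by shrinking with a
  factor below 1.\<close>

lemma ennreal_le_of_scaled:
  assumes "X \<ge> 0" "\<And>r. 0 < r \<Longrightarrow> r < 1 \<Longrightarrow> ennreal (r * X) \<le> y"
  shows "ennreal X \<le> y"
proof (rule ccontr)
  assume "\<not> ?thesis"
  then have "y < ennreal X" by simp
  then obtain w where w: "y = ennreal w" "w \<ge> 0" "w < X" by (cases y) (auto simp: ennreal_less_iff)
  define r where "r = (w + X) / (2 * X)"
  have "0 < r" "r < 1" using w by (auto simp: r_def field_simps)
  then have "r * X \<le> w" using assms(2)[of r] w by simp
  moreover have "r * X = (w + X) / 2" using w by (simp add: r_def)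
  ultimately show False using w by simp
qed

text \<open>Truncating \<open>u\<close> and \<open>v\<close> preserves the hypothesis, and by
  monotone convergence the truncated integrals eventually reach \<open>r * s\<close> and
  \<open>r * t\<close> for \<open>r < 1\<close>. Then \<open>r\<close> tends to 1.\<close>

lemma prekopa_leindler_1:
  fixes u v h :: "real \<Rightarrow> ennreal"
  assumes u [measurable]: "u \<in> borel_measurable borel" and v [measurable]: "v \<in> borel_measurable borel"
    and [measurable]: "h \<in> borel_measurable borel"
    and l: "0 < l" "l < (1::real)"
    and h: "\<And>x y. PLrel l (u x) (v y) (h ((1 - l) * x + l * y))"
  shows "PLrel l (\<integral>\<^sup>+x. u x \<partial>lborel) (\<integral>\<^sup>+x. v x \<partial>lborel) (\<integral>\<^sup>+x. h x \<partial>lborel)"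
  unfolding PLrel_def
proof (intro allI impI)
  fix s t :: real assume s: "s > 0" "ennreal s \<le> (\<integral>\<^sup>+x. u x \<partial>lborel)" and t: "t > 0" "ennreal t \<le> (\<integral>\<^sup>+x. v x \<partial>lborel)"
  have trunc: "\<exists>N. ennreal r \<le> (\<integral>\<^sup>+x. min (w x) (ennreal (real N)) \<partial>lborel)"
    if [measurable]: "w \<in> borel_measurable borel" and "ennreal r < (\<integral>\<^sup>+x. w x \<partial>lborel)" for w :: "real \<Rightarrow> ennreal" and r
  proof -
    have "(SUP N::nat. min (w x) (ennreal (real N))) = w x" for x
    proof -
      have "(SUP N::nat. min (w x) (ennreal (real N))) = inf (w x) (SUP N::nat. ennreal (real N))"
        unfolding inf_SUP by (simp add: inf_min)
      also have "(SUP N::nat. ennreal (real N)) = top"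
        using ennreal_SUP_of_nat_eq_top by (simp add: ennreal_of_nat_eq_real_of_nat)
      finally show ?thesis by (simp add: inf_min)
    qed
    then have "(\<integral>\<^sup>+x. w x \<partial>lborel) = (\<integral>\<^sup>+x. (SUP N::nat. min (w x) (ennreal (real N))) \<partial>lborel)" by simp
    also have "\<dots> = (SUP N::nat. \<integral>\<^sup>+x. min (w x) (ennreal (real N)) \<partial>lborel)"
      by (rule nn_integral_monotone_convergence_SUP)
        (auto simp: incseq_def le_fun_def intro!: min.coboundedI2 ennreal_leI)
    finally have "ennreal r < (SUP N::nat. \<integral>\<^sup>+x. min (w x) (ennreal (real N)) \<partial>lborel)" using that by simp
    then show ?thesis by (auto simp: less_SUP_iff intro: less_imp_le)
  qed
  show "ennreal (s powr (1 - l) * t powr l) \<le> (\<integral>\<^sup>+x. h x \<partial>lborel)"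
  proof (rule ennreal_le_of_scaled)
    fix r :: real assume r: "0 < r" "r < 1"
    have "ennreal (r * s) < ennreal s" "ennreal (r * t) < ennreal t"
      using r s t by (auto simp: ennreal_less_iff)
    then obtain N M where NM: "ennreal (r * s) \<le> (\<integral>\<^sup>+x. min (u x) (ennreal (real N)) \<partial>lborel)"
       "ennreal (r * t) \<le> (\<integral>\<^sup>+x. min (v x) (ennreal (real M)) \<partial>lborel)"
      using trunc[OF u] trunc[OF v] s(2) t(2) by (meson less_le_trans)
    have "PLrel l (\<integral>\<^sup>+x. min (u x) (ennreal (real N)) \<partial>lborel) (\<integral>\<^sup>+x. min (v x) (ennreal (real M)) \<partial>lborel) (\<integral>\<^sup>+x. h x \<partial>lborel)"
    proof (rule prekopa_leindler_1_bounded[OF _ _ _ l, where N = "max (real N) (real M)"])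
      show "min (u x) (ennreal (real N)) \<le> ennreal (max (real N) (real M))" "min (v x) (ennreal (real M)) \<le> ennreal (max (real N) (real M))" for x
        by (auto intro!: min.coboundedI2 ennreal_leI)
      show "PLrel l (min (u x) (ennreal (real N))) (min (v y) (ennreal (real M))) (h ((1 - l) * x + l * y))" for x y
        by (rule PLrel_mono[OF h]) auto
    qed auto
    then have "ennreal ((r * s) powr (1 - l) * (r * t) powr l) \<le> (\<integral>\<^sup>+x. h x \<partial>lborel)"
      using NM r s t unfolding PLrel_def by auto
    then show "ennreal (r * (s powr (1 - l) * t powr l)) \<le> (\<integral>\<^sup>+x. h x \<partial>lborel)"
      using powr_scale[of r s t l] r s t by simp
  qed simp
qed

section \<open>Induction on the dimension\<close>

lemma nn_integral_R0:
  assumes [measurable]: "g \<in> borel_measurable borel"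
  shows "(\<integral>\<^sup>+x. g x \<partial>lebesgue_Rn 0) = g 0"
proof -
  interpret product_sigma_finite "\<lambda>_::nat. lborel :: real measure" by (rule product_sigma_finite_lborel)
  have "(\<integral>\<^sup>+x. g x \<partial>lebesgue_Rn 0) = (\<integral>\<^sup>+x. g (cutoff 0 x) \<partial>Pi\<^sub>M {} (\<lambda>_. lborel))"
    unfolding lebesgue_Rn_eq using measurable_cutoff_PiM[of 0] by (subst nn_integral_distr) auto
  also have "\<dots> = g (cutoff 0 (\<lambda>k. undefined))" by (rule nn_integral_empty) simp
  finally show ?thesis by (simp add: cutoff_def zero_fun_def)
qed

lemma nn_integral_R1:
  assumes [measurable]: "g \<in> borel_measurable borel"
  shows "(\<integral>\<^sup>+x. g x \<partial>lebesgue_Rn 1) = (\<integral>\<^sup>+t. g (t *\<^sub>R evec 0) \<partial>lborel)"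
proof -
  interpret product_sigma_finite "\<lambda>_::nat. lborel :: real measure" by (rule product_sigma_finite_lborel)
  have [measurable]: "(\<lambda>t. g (t *\<^sub>R evec 0)) \<in> borel_measurable borel" by measurable
  have "{..<1} = {0::nat}" by auto
  then have "(\<integral>\<^sup>+x. g x \<partial>lebesgue_Rn 1) = (\<integral>\<^sup>+x. g (cutoff 1 x) \<partial>Pi\<^sub>M {0::nat} (\<lambda>_. lborel))"
    unfolding lebesgue_Rn_eq using measurable_cutoff_PiM[of 1] by (subst nn_integral_distr) auto
  also have "\<dots> = (\<integral>\<^sup>+x. g (x 0 *\<^sub>R evec 0) \<partial>Pi\<^sub>M {0::nat} (\<lambda>_. lborel))"
  proof -
    have "cutoff 1 x = x 0 *\<^sub>R evec 0" for x by (auto simp: fun_eq_iff cutoff_def evec_def)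
    then show ?thesis by (simp only:)
  qed
  also have "\<dots> = (\<integral>\<^sup>+t. g (t *\<^sub>R evec 0) \<partial>lborel)"
    by (rule product_nn_integral_singleton) auto
  finally show ?thesis .
qed

text \<open>Fixing the last coordinate, the induction hypothesis says that the integrals over the
  remaining ones satisfy the one-dimensional hypothesis; hence the functions must be arbitrary in
  the induction.\<close>

lemma prekopa_leindler:
  fixes u v h :: "(nat \<Rightarrow> real) \<Rightarrow> ennreal"
  assumes "u \<in> borel_measurable borel" "v \<in> borel_measurable borel" "h \<in> borel_measurable borel"
    and l: "0 < l" "l < (1::real)"
    and "\<And>x y. x \<in> Rn n \<Longrightarrow> y \<in> Rn n \<Longrightarrow> PLrel l (u x) (v y) (h ((1 - l) *\<^sub>R x + l *\<^sub>R y))"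
  shows "PLrel l (\<integral>\<^sup>+x. u x \<partial>lebesgue_Rn n) (\<integral>\<^sup>+x. v x \<partial>lebesgue_Rn n) (\<integral>\<^sup>+x. h x \<partial>lebesgue_Rn n)"
  using assms(1-3,6)
proof (induction n arbitrary: u v h)
  case 0
  then have "PLrel l (u 0) (v 0) (h ((1 - l) *\<^sub>R 0 + l *\<^sub>R 0))" by blast
  then show ?case using 0 by (simp add: nn_integral_R0)
next
  case (Suc n)
  note [measurable] = Suc.prems(1-3)
  let ?I = "\<lambda>g t. \<integral>\<^sup>+z. g (glue n z (t *\<^sub>R evec 0)) \<partial>lebesgue_Rn n"
  have I: "(\<integral>\<^sup>+x. g x \<partial>lebesgue_Rn (Suc n)) = (\<integral>\<^sup>+t. ?I g t \<partial>lborel)"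
    if [measurable]: "g \<in> borel_measurable borel" for g
    using nn_integral_glue[OF that, of n 1]
      nn_integral_R1[of "\<lambda>y. \<integral>\<^sup>+z. g (glue n z y) \<partial>lebesgue_Rn n"] by simp
  have Im: "?I g \<in> borel_measurable borel" if [measurable]: "g \<in> borel_measurable borel" for g
    by measurable
  have R: "glue n z (t *\<^sub>R evec 0) \<in> Rn (Suc n)" for z t
    using glue_Rn[of "t *\<^sub>R evec 0" 1 n z] by (simp add: evec_Rn)
  show ?case
    unfolding I[OF Suc.prems(1)] I[OF Suc.prems(2)] I[OF Suc.prems(3)]
  proof (rule prekopa_leindler_1[OF Im Im Im l])
    fix t t' :: real
    show "PLrel l (?I u t) (?I v t') (?I h ((1 - l) * t + l * t'))"
    proof (rule Suc.IH)
      fix x y assume "x \<in> Rn n" "y \<in> Rn n"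
      have eq: "(1 - l) *\<^sub>R glue n x (t *\<^sub>R evec 0) + l *\<^sub>R glue n y (t' *\<^sub>R evec 0) =
        glue n ((1 - l) *\<^sub>R x + l *\<^sub>R y) (((1 - l) * t + l * t') *\<^sub>R evec 0)"
        by (simp add: glue_lin[symmetric] scaleR_left_distrib)
      show "PLrel l (u (glue n x (t *\<^sub>R evec 0))) (v (glue n y (t' *\<^sub>R evec 0)))
        (h (glue n ((1 - l) *\<^sub>R x + l *\<^sub>R y) (((1 - l) * t + l * t') *\<^sub>R evec 0)))"
        using Suc.prems(4)[OF R R, of x t y t'] unfolding eq .
    qed measurable
  qed (use Suc.prems in auto)
qed

section \<open>Moments of log-concave functions on the half-line\<close>

text \<open>Both sides are compared, by Fubini, with the double integral of
  \<open>G (1 / s) / s\<^sup>2\<close> against the indicator of \<open>1 < s t < 2\<close> and \<open>dt / t\<close>.\<close>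

lemma nn_integral_inverse_substitution:
  assumes [measurable]: "G \<in> borel_measurable borel"
  shows "(\<integral>\<^sup>+s. G (1 / s) * ennreal (1 / s\<^sup>2) * indicator {0<..} s \<partial>lborel) =
    (\<integral>\<^sup>+r. G r * indicator {0::real<..} r \<partial>lborel)"
proof -
  \<comment> \<open>This is ln 2, but only 0 < \<open>c\<close> < infinity matters: it is cancelled
    at the end.\<close>
  define c where "c = (\<integral>\<^sup>+u. ennreal (1 / u) * indicator {1<..<2::real} u \<partial>lborel)"
  have inner: "(\<integral>\<^sup>+t. ennreal (1 / t) * indicator {1<..<2} (s * t) * indicator {0<..} t \<partial>lborel) = c"
    if "s > 0" for s :: real
  proof -
    have "c = ennreal s * (\<integral>\<^sup>+t. ennreal (1 / (s * t)) * indicator {1<..<2} (s * t) \<partial>lborel)"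
      unfolding c_def using that by (subst nn_integral_real_affine[where c = s and t = 0]) auto
    also have "\<dots> = (\<integral>\<^sup>+t. ennreal s * (ennreal (1 / (s * t)) * indicator {1<..<2} (s * t)) \<partial>lborel)"
      by (rule nn_integral_cmult[symmetric]) measurable
    also have "\<dots> = (\<integral>\<^sup>+t. ennreal (1 / t) * indicator {1<..<2} (s * t) * indicator {0<..} t \<partial>lborel)"
    proof (rule nn_integral_cong)
      fix t :: real
      show "ennreal s * (ennreal (1 / (s * t)) * indicator {1<..<2} (s * t)) =
        ennreal (1 / t) * indicator {1<..<2} (s * t) * indicator {0<..} t"
      proof (cases "t > 0")
        case True
        then show ?thesis using that by (simp add: mult.assoc[symmetric] ennreal_mult[symmetric])
      next
        case False
        then have "s * t \<le> 0" using that by (simp add: mult_nonneg_nonpos)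
        then show ?thesis using False by (simp add: indicator_def)
      qed
    qed
    finally show ?thesis by simp
  qed
  have c: "c \<noteq> 0" "c \<noteq> \<infinity>"
  proof -
    have "ennreal (1 / 2) = (\<integral>\<^sup>+u. ennreal (1 / 2) * indicator {1<..<2::real} u \<partial>lborel)"
      by (subst nn_integral_cmult_indicator) auto
    also have "\<dots> \<le> c"
      unfolding c_def
    proof (rule nn_integral_mono)
      fix u :: real
      have "ennreal (1 / 2) \<le> ennreal (1 / u)" if "u \<in> {1<..<2}"
        using that by (intro ennreal_leI) (auto simp: field_simps)
      then show "ennreal (1 / 2) * indicator {1<..<2} u \<le> ennreal (1 / u) * indicator {1<..<2} u"
        by (auto simp: indicator_def)
    qed
    finally show "c \<noteq> 0" by (auto simp: le_zero_eq ennreal_eq_0_iff)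
    have "c \<le> (\<integral>\<^sup>+u. indicator {1<..<2::real} u \<partial>lborel)"
      unfolding c_def
    proof (rule nn_integral_mono)
      fix u :: real
      have "ennreal (1 / u) \<le> ennreal 1" if "u \<in> {1<..<2}"
        using that by (intro ennreal_leI) (auto simp: field_simps)
      then show "ennreal (1 / u) * indicator {1<..<2} u \<le> indicator {1<..<2} u"
        by (auto simp: indicator_def)
    qed
    also have "\<dots> = 1" by simp
    finally show "c \<noteq> \<infinity>" by (auto simp: top_unique)
  qed
  let ?W = "\<lambda>s t. indicator {1<..<2} (s * t) * indicator {0<..} t * indicator {0<..} s :: ennreal"
  have "(\<integral>\<^sup>+s. G (1 / s) * ennreal (1 / s\<^sup>2) * indicator {0<..} s \<partial>lborel) * c
    = (\<integral>\<^sup>+s. G (1 / s) * ennreal (1 / s\<^sup>2) * indicator {0<..} s * c \<partial>lborel)"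
    by (rule nn_integral_multc[symmetric]) measurable
  also have "\<dots> = (\<integral>\<^sup>+s. (\<integral>\<^sup>+t. G (1 / s) * ennreal (1 / s\<^sup>2) * (ennreal (1 / t) * ?W s t) \<partial>lborel) \<partial>lborel)"
  proof (rule nn_integral_cong)
    fix s :: real
    show "G (1 / s) * ennreal (1 / s\<^sup>2) * indicator {0<..} s * c =
      (\<integral>\<^sup>+t. G (1 / s) * ennreal (1 / s\<^sup>2) * (ennreal (1 / t) * ?W s t) \<partial>lborel)"
    proof (cases "s > 0")
      case True
      then show ?thesis
        by (subst nn_integral_cmult) (auto simp: inner[OF True, symmetric] mult.assoc)
    qed simp
  qed
  also have "\<dots> = (\<integral>\<^sup>+t. (\<integral>\<^sup>+s. G (1 / s) * ennreal (1 / s\<^sup>2) * (ennreal (1 / t) * ?W s t) \<partial>lborel) \<partial>lborel)"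
    by (rule lborel_pair.Fubini'[symmetric]) measurable
  also have "\<dots> = (\<integral>\<^sup>+t. (\<integral>\<^sup>+u. G (t / u) * ennreal (1 / u\<^sup>2) * indicator {1<..<2} u * indicator {0<..} t \<partial>lborel) \<partial>lborel)"
  proof (rule nn_integral_cong)
    fix t :: real
    show "(\<integral>\<^sup>+s. G (1 / s) * ennreal (1 / s\<^sup>2) * (ennreal (1 / t) * ?W s t) \<partial>lborel) =
      (\<integral>\<^sup>+u. G (t / u) * ennreal (1 / u\<^sup>2) * indicator {1<..<2} u * indicator {0<..} t \<partial>lborel)"
    proof (cases "t > 0")
      case True
      have "(\<integral>\<^sup>+s. G (1 / s) * ennreal (1 / s\<^sup>2) * (ennreal (1 / t) * ?W s t) \<partial>lborel) =
        ennreal (1 / t) * (\<integral>\<^sup>+u. G (1 / (u / t)) * ennreal (1 / (u / t)\<^sup>2) * (ennreal (1 / t) * ?W (u / t) t) \<partial>lborel)"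
        using True by (subst nn_integral_real_affine[where c = "1 / t" and t = 0]) auto
      also have "\<dots> = (\<integral>\<^sup>+u. ennreal (1 / t) * (G (1 / (u / t)) * ennreal (1 / (u / t)\<^sup>2) * (ennreal (1 / t) * ?W (u / t) t)) \<partial>lborel)"
        by (rule nn_integral_cmult[symmetric]) measurable
      also have "\<dots> = (\<integral>\<^sup>+u. G (t / u) * ennreal (1 / u\<^sup>2) * indicator {1<..<2} u * indicator {0<..} t \<partial>lborel)"
      proof (rule nn_integral_cong)
        fix u :: real
        have *: "ennreal (1 / t) * (ennreal (1 / (u / t)\<^sup>2) * ennreal (1 / t)) = ennreal (1 / u\<^sup>2)"
          using True by (simp add: ennreal_mult[symmetric] power_divide power2_eq_square)
        have "?W (u / t) t = indicator {1<..<2} u"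
          using True by (auto simp: indicator_def)
        then have "ennreal (1 / t) * (G (1 / (u / t)) * ennreal (1 / (u / t)\<^sup>2) * (ennreal (1 / t) * ?W (u / t) t)) =
          (ennreal (1 / t) * (ennreal (1 / (u / t)\<^sup>2) * ennreal (1 / t))) * (G (t / u) * indicator {1<..<2} u)"
          by (simp add: mult_ac)
        then show "ennreal (1 / t) * (G (1 / (u / t)) * ennreal (1 / (u / t)\<^sup>2) * (ennreal (1 / t) * ?W (u / t) t)) =
          G (t / u) * ennreal (1 / u\<^sup>2) * indicator {1<..<2} u * indicator {0<..} t"
          unfolding * using True by (simp add: mult_ac)
      qed
      finally show ?thesis .
    qed simp
  qed
  also have "\<dots> = (\<integral>\<^sup>+u. (\<integral>\<^sup>+t. G (t / u) * ennreal (1 / u\<^sup>2) * indicator {1<..<2} u * indicator {0<..} t \<partial>lborel) \<partial>lborel)"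
    by (rule lborel_pair.Fubini') measurable
  also have "\<dots> = (\<integral>\<^sup>+u. (\<integral>\<^sup>+r. G r * indicator {0<..} r \<partial>lborel) * (ennreal (1 / u) * indicator {1<..<2} u) \<partial>lborel)"
  proof (rule nn_integral_cong)
    fix u :: real
    show "(\<integral>\<^sup>+t. G (t / u) * ennreal (1 / u\<^sup>2) * indicator {1<..<2} u * indicator {0<..} t \<partial>lborel) =
      (\<integral>\<^sup>+r. G r * indicator {0<..} r \<partial>lborel) * (ennreal (1 / u) * indicator {1<..<2} u)"
    proof (cases "u \<in> {1<..<2}")
      case True
      have "(\<integral>\<^sup>+t. G (t / u) * ennreal (1 / u\<^sup>2) * indicator {1<..<2} u * indicator {0<..} t \<partial>lborel) =
        ennreal u * (\<integral>\<^sup>+r. G r * ennreal (1 / u\<^sup>2) * indicator {0<..} (u * r) \<partial>lborel)"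
        using True by (subst nn_integral_real_affine[where c = u and t = 0]) auto
      also have "\<dots> = (\<integral>\<^sup>+r. ennreal u * (G r * ennreal (1 / u\<^sup>2) * indicator {0<..} (u * r)) \<partial>lborel)"
        by (rule nn_integral_cmult[symmetric]) measurable
      also have "\<dots> = (\<integral>\<^sup>+r. G r * indicator {0<..} r * ennreal (1 / u) \<partial>lborel)"
      proof (rule nn_integral_cong)
        fix r :: real
        have "ennreal u * ennreal (1 / u\<^sup>2) = ennreal (1 / u)"
          using True by (simp add: ennreal_mult[symmetric] power2_eq_square)
        moreover have "indicator {0<..} (u * r) = (indicator {0<..} r :: ennreal)"
          using True by (auto simp: indicator_def zero_less_mult_iff)
        moreover have "ennreal u * (G r * ennreal (1 / u\<^sup>2) * indicator {0<..} (u * r)) =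
          G r * indicator {0<..} (u * r) * (ennreal u * ennreal (1 / u\<^sup>2))" by (simp only: mult_ac)
        ultimately show "ennreal u * (G r * ennreal (1 / u\<^sup>2) * indicator {0<..} (u * r)) =
          G r * indicator {0<..} r * ennreal (1 / u)" by simp
      qed
      also have "\<dots> = (\<integral>\<^sup>+r. G r * indicator {0<..} r \<partial>lborel) * ennreal (1 / u)"
        by (rule nn_integral_multc) measurable
      finally show ?thesis using True by simp
    qed simp
  qed
  also have "\<dots> = (\<integral>\<^sup>+r. G r * indicator {0<..} r \<partial>lborel) * c"
    unfolding c_def by (rule nn_integral_cmult) measurable
  finally have "c * (\<integral>\<^sup>+s. G (1 / s) * ennreal (1 / s\<^sup>2) * indicator {0<..} s \<partial>lborel) = c * (\<integral>\<^sup>+r. G r * indicator {0<..} r \<partial>lborel)"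
    by (simp add: mult.commute)
  then show ?thesis using c by (simp add: ennreal_mult_cancel_left)
qed

lemma nn_integral_power_exp:
  assumes a: "a > 0"
  shows "(\<integral>\<^sup>+r. ennreal (r ^ j * exp (- a * r)) * indicator {0<..} r \<partial>lborel) = ennreal (fact j / a ^ Suc j)"
proof -
  have "(\<integral>\<^sup>+r. ennreal (r ^ j * exp (- a * r)) * indicator {0<..} r \<partial>lborel) =
    (\<integral>\<^sup>+r. ennreal (r ^ j * exp (- a * r)) * indicator {0..} r \<partial>lborel)"
  proof (rule nn_integral_cong_AE)
    show "AE r in lborel. ennreal (r ^ j * exp (- a * r)) * indicator {0<..} r = ennreal (r ^ j * exp (- a * r)) * indicator {0..} r"
      using AE_lborel_singleton[of "0::real"] by eventually_elim (auto simp: indicator_def)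
  qed
  also have "\<dots> = ennreal (1 / a) * (\<integral>\<^sup>+x. ennreal ((x / a) ^ j * exp (- x)) * indicator {0..} (x / a) \<partial>lborel)"
    using a by (subst nn_integral_real_affine[where c = "1 / a" and t = 0]) auto
  also have "(\<integral>\<^sup>+x. ennreal ((x / a) ^ j * exp (- x)) * indicator {0..} (x / a) \<partial>lborel) =
    (\<integral>\<^sup>+x. ennreal (1 / a ^ j) * (ennreal (x ^ j * exp (- x)) * indicator {0..} x) \<partial>lborel)"
    using a by (intro nn_integral_cong)
      (auto simp: indicator_def power_divide ennreal_mult[symmetric] zero_le_divide_iff)
  also have "\<dots> = ennreal (1 / a ^ j) * ennreal (fact j)"
    by (subst nn_integral_cmult) (auto simp: nn_intergal_power_times_exp_Ici)
  also have "ennreal (1 / a) * (ennreal (1 / a ^ j) * ennreal (fact j)) = ennreal (fact j / a ^ Suc j)"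
    using a by (simp add: ennreal_mult[symmetric])
  finally show ?thesis .
qed

text \<open>A single term of the exponential series.\<close>

lemma power_le_fact_exp: "real k ^ k \<le> fact k * exp (real k)"
proof -
  have "summable (\<lambda>n. real k ^ n /\<^sub>R fact n)" by (rule summable_exp_generic)
  then have "(\<Sum>n\<in>{k}. real k ^ n /\<^sub>R fact n) \<le> exp (real k)"
    unfolding exp_def by (intro sum_le_suminf) auto
  then show ?thesis by (simp add: field_simps)
qed

text \<open>Origin of 6 e^2: (k + 2)(k + 1) \<le> 6 k^2 for k \<ge> 1, with equality at k = 1, and
  the resulting k^(2k) is at most (k! e^k)^2. The point is that the loss is a constant to the power
  \<open>k\<close>.\<close>

lemma moment_constant:
  assumes "k \<ge> 1"
  shows "(fact (k + 2) :: real) ^ k \<le> (6 * exp 2) ^ k * fact k ^ (k + 2)"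
proof -
  have k: "real k \<ge> 1" using assms by simp
  have "(fact (k + 2) :: real) = (real k + 2) * (real k + 1) * fact k"
    by (simp add: algebra_simps)
  also have "\<dots> \<le> (6 * (real k)\<^sup>2) * fact k"
  proof (rule mult_right_mono)
    have "real k \<le> (real k)\<^sup>2" using k by (simp add: power2_eq_square)
    moreover have "1 \<le> (real k)\<^sup>2" using k by simp
    ultimately show "(real k + 2) * (real k + 1) \<le> 6 * (real k)\<^sup>2"
      by (simp add: algebra_simps power2_eq_square)
  qed simp
  finally have "(fact (k + 2) :: real) ^ k \<le> ((6 * (real k)\<^sup>2) * fact k) ^ k" by (rule power_mono) simp
  also have "\<dots> = 6 ^ k * (real k ^ k)\<^sup>2 * fact k ^ k"
    by (simp add: power_mult_distrib power_mult[symmetric] mult.commute)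
  also have "\<dots> \<le> 6 ^ k * (fact k * exp (real k))\<^sup>2 * fact k ^ k"
    by (intro mult_right_mono mult_left_mono power_mono power_le_fact_exp) auto
  also have "\<dots> = (6 * exp 2) ^ k * fact k ^ (k + 2)"
  proof -
    have "(exp (real k))\<^sup>2 = exp 2 ^ k" by (simp add: exp_of_nat_mult[symmetric] exp_double[symmetric] mult.commute)
    then show ?thesis by (simp add: power_mult_distrib power_add power2_eq_square mult_ac)
  qed
  finally show ?thesis .
qed

text \<open>Extremal case \<open>\<psi> r = exp (- a r)\<close>: with \<open>a\<close> chosen such that the moments of order \<open>k - 1\<close> agree,
  \<open>\<psi>\<close> crosses the exponential once, from above.\<close>

lemma moment_comparison:
  fixes \<psi> :: "real \<Rightarrow> real"
  assumes k: "k \<ge> 1" and [measurable]: "\<psi> \<in> borel_measurable borel"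
    and \<psi>: "\<And>r. r > 0 \<Longrightarrow> \<psi> r \<ge> 0" "\<And>r. r > R \<Longrightarrow> \<psi> r = 0" "R > 0"
    and lc: "\<And>r r'. 0 < r \<Longrightarrow> r < r' \<Longrightarrow> 0 < \<psi> r' \<Longrightarrow> \<psi> r' powr (r / r') \<le> \<psi> r"
    and M: "(\<integral>\<^sup>+r. ennreal (r ^ (k - 1) * \<psi> r) * indicator {0<..} r \<partial>lborel) = ennreal M" "M > 0"
    and P: "(\<integral>\<^sup>+r. ennreal (r ^ (k + 1) * \<psi> r) * indicator {0<..} r \<partial>lborel) = ennreal P" "P \<ge> 0"
  shows "((real k + 2) * P) ^ k \<le> (6 * exp 2) ^ k * (real k * M) ^ (k + 2)"
proof -
  obtain k' where k': "k = Suc k'" using k by (cases k) auto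
  define a where "a = root k (fact k' / M)"
  have a: "a > 0" using k M by (simp add: a_def)
  have ak: "a ^ k = fact k' / M" using k M by (simp add: a_def)
  let ?e = "\<lambda>r. exp (- a * r)"
  have E: "(\<integral>\<^sup>+r. ennreal (r ^ (k - 1) * ?e r) * indicator {0<..} r \<partial>lborel) = ennreal M"
    using nn_integral_power_exp[OF a, of k'] ak M by (simp add: k')
  have E2: "(\<integral>\<^sup>+r. ennreal (r ^ (k + 1) * ?e r) * indicator {0<..} r \<partial>lborel) = ennreal (fact (k + 1) / a ^ (k + 2))"
    using nn_integral_power_exp[OF a, of "k + 1"] by simp
  define X where "X = {r. 0 < r \<and> ?e r \<le> \<psi> r}"
  \<comment> \<open>The crossing point. The inserted 0 covers the case in which
    \<open>\<psi>\<close> lies below the exponential everywhere; the bounded support of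
    \<open>\<psi>\<close> makes the supremum finite.\<close>
  define r0 where "r0 = Sup (insert 0 X)"
  have XR: "r \<le> R" if "r \<in> X" for r
  proof (rule ccontr)
    assume "\<not> r \<le> R"
    then have "?e r \<le> 0" using \<psi>(2)[of r] that by (simp add: X_def)
    then show False using exp_gt_zero[of "- a * r"] by linarith
  qed
  have bdd: "bdd_above (insert 0 X)" using XR by (intro bdd_aboveI[of _ "max 0 R"]) (auto simp: le_max_iff_disj)
  have r0: "r0 \<ge> 0" unfolding r0_def by (rule cSup_upper[OF _ bdd]) simp
  have outside: "\<psi> r < ?e r" if "r > r0" for r
  proof (rule ccontr)
    assume "\<not> ?thesis"
    then have "r \<in> X" using that r0 by (simp add: X_def)
    then have "r \<le> r0" unfolding r0_def by (intro cSup_upper[OF _ bdd]) simp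
    then show False using that by simp
  qed
  \<comment> \<open>\<open>lc\<close> is log-concavity against the value 1 at the origin, whereas
    the exponential satisfies it with equality. So domination at \<open>r'\<close> propagates to
    every smaller radius.\<close>
  have inside: "?e r \<le> \<psi> r" if r: "0 < r" "r < r0" for r
  proof -
    obtain r' where r': "r' \<in> insert 0 X" "r < r'"
      using r(2) less_cSup_iff[OF _ bdd, of r] unfolding r0_def by auto
    then have x: "r' \<in> X" using r by auto
    then have pos: "\<psi> r' \<ge> ?e r'" "?e r' > 0" by (auto simp: X_def)
    have "?e r = ?e r' powr (r / r')" using r r' by (simp add: powr_def)
    also have "\<dots> \<le> \<psi> r' powr (r / r')" using pos r r' by (intro powr_mono2) auto
    also have "\<dots> \<le> \<psi> r" using lc[OF r(1) r'(2)] pos by linarith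
    finally show ?thesis .
  qed
  \<comment> \<open>The product of \<open>r\<^sup>2 - r0\<^sup>2\<close> and \<psi> - e is never
    positive. Integrated against r^(k-1), the r0-terms cancel because the moments of order k - 1
    agree. The terms are arranged on both sides so that no subtraction occurs in the extended
    reals.\<close>
  have pt: "r ^ (k + 1) * \<psi> r + r0\<^sup>2 * (r ^ (k - 1) * ?e r) \<le> r ^ (k + 1) * ?e r + r0\<^sup>2 * (r ^ (k - 1) * \<psi> r)"
    if r: "r > 0" for r
  proof -
    have "(r\<^sup>2 - r0\<^sup>2) * (\<psi> r - ?e r) \<le> 0"
    proof (cases r r0 rule: linorder_cases)
      case less
      then have "r\<^sup>2 \<le> r0\<^sup>2" using r by (intro power_mono) auto
      then show ?thesis using inside[OF r less] by (intro mult_nonpos_nonneg) auto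
    next
      case greater
      then have "r0\<^sup>2 \<le> r\<^sup>2" using r0 by (intro power_mono) auto
      then show ?thesis using outside[OF greater] by (intro mult_nonneg_nonpos) auto
    qed simp
    then have "r ^ k' * ((r\<^sup>2 - r0\<^sup>2) * (\<psi> r - ?e r)) \<le> 0"
      by (rule mult_nonneg_nonpos[rotated]) (use r in simp)
    then show ?thesis by (simp add: k' algebra_simps power2_eq_square)
  qed
  have "ennreal P + ennreal (r0\<^sup>2) * ennreal M =
    (\<integral>\<^sup>+r. ennreal (r ^ (k + 1) * \<psi> r) * indicator {0<..} r + ennreal (r0\<^sup>2) * (ennreal (r ^ (k - 1) * ?e r) * indicator {0<..} r) \<partial>lborel)"
    unfolding P(1)[symmetric] E[symmetric] by (subst nn_integral_add) (auto simp: nn_integral_cmult)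
  also have "\<dots> \<le> (\<integral>\<^sup>+r. ennreal (r ^ (k + 1) * ?e r) * indicator {0<..} r + ennreal (r0\<^sup>2) * (ennreal (r ^ (k - 1) * \<psi> r) * indicator {0<..} r) \<partial>lborel)"
  proof (rule nn_integral_mono)
    fix r :: real
    show "ennreal (r ^ (k + 1) * \<psi> r) * indicator {0<..} r + ennreal (r0\<^sup>2) * (ennreal (r ^ (k - 1) * ?e r) * indicator {0<..} r)
      \<le> ennreal (r ^ (k + 1) * ?e r) * indicator {0<..} r + ennreal (r0\<^sup>2) * (ennreal (r ^ (k - 1) * \<psi> r) * indicator {0<..} r)"
    proof (cases "r > 0")
      case True
      have "ennreal (r ^ (k + 1) * \<psi> r + r0\<^sup>2 * (r ^ (k - 1) * ?e r)) \<le> ennreal (r ^ (k + 1) * ?e r + r0\<^sup>2 * (r ^ (k - 1) * \<psi> r))"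
        by (rule ennreal_leI[OF pt[OF True]])
      then show ?thesis using True \<psi>(1)[OF True]
        by (simp add: ennreal_plus ennreal_mult del: mult_minus_left)
    qed simp
  qed
  also have "\<dots> = ennreal (fact (k + 1) / a ^ (k + 2)) + ennreal (r0\<^sup>2) * ennreal M"
    unfolding M(1)[symmetric] E2[symmetric] by (subst nn_integral_add) (auto simp: nn_integral_cmult)
  finally have "P + r0\<^sup>2 * M \<le> fact (k + 1) / a ^ (k + 2) + r0\<^sup>2 * M"
    using P(2) M(2) a by (simp add: ennreal_mult[symmetric] ennreal_plus[symmetric] del: ennreal_plus)
  then have "(real k + 2) * P \<le> (real k + 2) * (fact (k + 1) / a ^ (k + 2))"
    by (intro mult_left_mono) auto
  also have "\<dots> = fact (k + 2) / a ^ (k + 2)" by (simp add: algebra_simps)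
  finally have "((real k + 2) * P) ^ k \<le> (fact (k + 2) / a ^ (k + 2)) ^ k"
    using P by (intro power_mono) auto
  also have "\<dots> = fact (k + 2) ^ k / (a ^ k) ^ (k + 2)"
    by (simp only: power_divide power_mult[symmetric] mult.commute)
  also have "(a ^ k) ^ (k + 2) = fact k ^ (k + 2) / (real k * M) ^ (k + 2)"
  proof -
    have "a ^ k = fact k / (real k * M)" using ak k M by (simp add: k' del: of_nat_Suc)
    then show ?thesis by (simp only: power_divide)
  qed
  also have "fact (k + 2) ^ k / (fact k ^ (k + 2) / (real k * M) ^ (k + 2)) =
     fact (k + 2) ^ k * (real k * M) ^ (k + 2) / fact k ^ (k + 2)" by simp
  also have "\<dots> \<le> ((6 * exp 2) ^ k * fact k ^ (k + 2)) * (real k * M) ^ (k + 2) / fact k ^ (k + 2)"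
    using moment_constant[OF k] M by (intro divide_right_mono mult_right_mono) auto
  also have "\<dots> = (6 * exp 2) ^ k * (real k * M) ^ (k + 2)" by simp
  finally show ?thesis .
qed

section \<open>Ball's convex body of a log-concave function\<close>

text \<open>Tychonoff, with the factor {0} in every coordinate from \<open>k\<close> on.\<close>

lemma compact_box: "compact {x \<in> Rn k. \<forall>i<k. \<bar>x i\<bar> \<le> r}"
proof -
  let ?X = "\<lambda>i. if i < k then {- r..r} else {0::real}"
  have "compactin (product_topology (\<lambda>i. euclidean) UNIV) (Pi\<^sub>E UNIV ?X)"
    by (auto simp: compactin_PiE)
  then have "compact (Pi\<^sub>E UNIV ?X)" by (simp add: euclidean_product_topology)
  moreover have "Pi\<^sub>E UNIV ?X = {x \<in> Rn k. \<forall>i<k. \<bar>x i\<bar> \<le> r}"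
  proof (intro set_eqI iffI)
    fix x assume "x \<in> Pi\<^sub>E UNIV ?X"
    then have *: "x i \<in> ?X i" for i by (rule PiE_mem) simp
    have "x i = 0" if "i \<ge> k" for i using *[of i] that by simp
    moreover have "\<bar>x i\<bar> \<le> r" if "i < k" for i using *[of i] that by (simp add: abs_le_iff)
    ultimately show "x \<in> {x \<in> Rn k. \<forall>i<k. \<bar>x i\<bar> \<le> r}" by (simp add: Rn_def)
  next
    fix x assume x: "x \<in> {x \<in> Rn k. \<forall>i<k. \<bar>x i\<bar> \<le> r}"
    have "x i \<in> ?X i" for i using x by (cases "i < k") (auto simp: Rn_def abs_le_iff minus_le_iff)
    then show "x \<in> Pi\<^sub>E UNIV ?X" by auto
  qed
  ultimately show ?thesis by simp
qed

lemma nn_integral_power_Ioc: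
  assumes "\<rho> \<ge> 0"
  shows "(\<integral>\<^sup>+r. ennreal (r ^ j) * indicator {0<..\<rho>} r \<partial>lborel) = ennreal (\<rho> ^ Suc j / real (Suc j))"
proof -
  have "(\<integral>\<^sup>+r. ennreal (r ^ j) * indicator {0<..\<rho>} r \<partial>lborel) = (\<integral>\<^sup>+r. ennreal (r ^ j) * indicator {0..\<rho>} r \<partial>lborel)"
  proof (rule nn_integral_cong_AE)
    show "AE r in lborel. ennreal (r ^ j) * indicator {0<..\<rho>} r = ennreal (r ^ j) * indicator {0..\<rho>} r"
      using AE_lborel_singleton[of "0::real"] by eventually_elim (auto simp: indicator_def)
  qed
  also have "\<dots> = ennreal (\<rho> ^ Suc j / real (Suc j) - 0 ^ Suc j / real (Suc j))"
  proof (rule nn_integral_FTC_Icc)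
    fix r :: real
    show "((\<lambda>r. r ^ Suc j / real (Suc j)) has_real_derivative r ^ j) (at r)"
      using DERIV_cdivide[OF DERIV_pow[of "Suc j" r UNIV], of "real (Suc j)"] by (simp del: of_nat_Suc power_Suc)
  qed (use assms in auto)
  finally show ?thesis by simp
qed

lemma powr_power_swap: "a > 0 \<Longrightarrow> (a powr b) ^ n = (a ^ n) powr b" for a b :: real
  by (induction n) (simp_all add: powr_mult)

text \<open>The quantitative data \<open>R\<close>, \<open>\<delta>\<close>,
  \<open>\<epsilon>\<close> make every radial moment finite and positive, and later make Ball's body
  bounded with non-empty interior.\<close>

locale logconcave =
  fixes k :: nat and f :: "(nat \<Rightarrow> real) \<Rightarrow> real" and R \<delta> \<epsilon> :: real
  assumes k: "k \<ge> 1"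
    and f_meas [measurable]: "f \<in> borel_measurable borel"
    and f_nonneg: "\<And>y. f y \<ge> 0"
    and f_even: "\<And>y. f (- y) = f y"
    and f_lc: "\<And>x y l. x \<in> Rn k \<Longrightarrow> y \<in> Rn k \<Longrightarrow> 0 < l \<Longrightarrow> l < 1 \<Longrightarrow> f x > 0 \<Longrightarrow> f y > 0 \<Longrightarrow>
      f x powr (1 - l) * f y powr l \<le> f ((1 - l) *\<^sub>R x + l *\<^sub>R y)"
    and f_supp: "\<And>y. y \<in> Rn k \<Longrightarrow> f y > 0 \<Longrightarrow> nrm k y \<le> R"
    and f_low: "\<And>y. y \<in> Rn k \<Longrightarrow> nrm k y \<le> \<delta> \<Longrightarrow> \<epsilon> \<le> f y"
    and pos: "R > 0" "\<delta> > 0" "\<epsilon> > 0"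
begin

section \<open>Radial moments\<close>

lemma f0_pos: "f 0 > 0"
  using f_low[of 0] pos by simp

text \<open>The origin is the midpoint of \<open>y\<close> and \<open>- y\<close>, where
  \<open>f\<close> takes equal values.\<close>

lemma f_le_f0:
  assumes y: "y \<in> Rn k" shows "f y \<le> f 0"
proof (cases "f y > 0")
  case True
  have "f (- y) powr (1 - 1 / 2) * f y powr (1 / 2) \<le> f ((1 - 1 / 2) *\<^sub>R (- y) + (1 / 2) *\<^sub>R y)"
    by (rule f_lc) (use y True in \<open>auto simp: f_even\<close>)
  then show ?thesis using True by (simp add: f_even powr_add[symmetric])
next
  case False
  then show ?thesis using f0_pos by linarith
qed

text \<open>Homogeneous of degree \<open>- (j + 1)\<close> in \<open>y\<close>
  (\<open>ray_scale\<close>). The order \<open>j = k - 1\<close> belongs to the integral of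
  \<open>f\<close>, and \<open>j = k + 1\<close> to its second moments.\<close>

definition ray :: "nat \<Rightarrow> (nat \<Rightarrow> real) \<Rightarrow> ennreal"
  where "ray j y = (\<integral>\<^sup>+r. ennreal (f (r *\<^sub>R y) * r ^ j) * indicator {0<..} r \<partial>lborel)"

lemma measurable_ray [measurable]: "ray j \<in> borel_measurable borel"
  unfolding ray_def by measurable

lemma ray_finite:
  assumes y: "y \<in> Rn k" "y \<noteq> 0"
  shows "ray j y \<le> ennreal (f 0 * (R / nrm k y) ^ Suc j)"
proof -
  have ny: "nrm k y > 0" using nrm_pos[OF y] .
  let ?\<rho> = "R / nrm k y"
  have "ray j y \<le> (\<integral>\<^sup>+r. ennreal (f 0) * (ennreal (r ^ j) * indicator {0<..?\<rho>} r) \<partial>lborel)"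
    unfolding ray_def
  proof (rule nn_integral_mono)
    fix r :: real
    show "ennreal (f (r *\<^sub>R y) * r ^ j) * indicator {0<..} r \<le> ennreal (f 0) * (ennreal (r ^ j) * indicator {0<..?\<rho>} r)"
    proof (cases "0 < r \<and> f (r *\<^sub>R y) > 0")
      case True
      then have "nrm k (r *\<^sub>R y) \<le> R" using y by (intro f_supp) auto
      then have "r \<le> ?\<rho>" using True ny by (simp add: nrm_scale field_simps)
      moreover have "ennreal (f (r *\<^sub>R y) * r ^ j) \<le> ennreal (f 0 * r ^ j)"
        using True y by (intro ennreal_leI mult_right_mono f_le_f0) auto
      ultimately show ?thesis using True f0_pos by (simp add: ennreal_mult)
    next
      case False
      then have "0 < r \<Longrightarrow> f (r *\<^sub>R y) = 0" using f_nonneg[of "r *\<^sub>R y"] by linarith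
      then show ?thesis by (cases "0 < r") auto
    qed
  qed
  also have "\<dots> = ennreal (f 0) * ennreal (?\<rho> ^ Suc j / real (Suc j))"
    using pos ny by (subst nn_integral_cmult) (auto simp: nn_integral_power_Ioc simp del: of_nat_Suc power_Suc)
  also have "\<dots> = ennreal (f 0 * (?\<rho> ^ Suc j / real (Suc j)))"
    using f0_pos pos ny by (subst ennreal_mult[symmetric]) (auto simp del: of_nat_Suc power_Suc)
  also have "\<dots> \<le> ennreal (f 0 * ?\<rho> ^ Suc j)"
  proof (intro ennreal_leI mult_left_mono)
    have "?\<rho> ^ Suc j / real (Suc j) \<le> ?\<rho> ^ Suc j / 1"
      using pos ny by (intro divide_left_mono) auto
    then show "?\<rho> ^ Suc j / real (Suc j) \<le> ?\<rho> ^ Suc j" by simp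
  qed (use f0_pos in auto)
  finally show ?thesis .
qed

lemma ray_lower:
  assumes y: "y \<in> Rn k" "y \<noteq> 0"
  shows "ennreal (\<epsilon> * (\<delta> / nrm k y) ^ Suc j / real (Suc j)) \<le> ray j y"
proof -
  have ny: "nrm k y > 0" using nrm_pos[OF y] .
  let ?\<rho> = "\<delta> / nrm k y"
  have "ennreal (\<epsilon> * ?\<rho> ^ Suc j / real (Suc j)) = ennreal \<epsilon> * ennreal (?\<rho> ^ Suc j / real (Suc j))"
    using pos ny by (simp add: ennreal_mult[symmetric] del: of_nat_Suc power_Suc)
  also have "\<dots> = (\<integral>\<^sup>+r. ennreal \<epsilon> * (ennreal (r ^ j) * indicator {0<..?\<rho>} r) \<partial>lborel)"
    using pos ny by (subst nn_integral_cmult) (auto simp: nn_integral_power_Ioc simp del: of_nat_Suc power_Suc)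
  also have "\<dots> \<le> ray j y"
    unfolding ray_def
  proof (rule nn_integral_mono)
    fix r :: real
    show "ennreal \<epsilon> * (ennreal (r ^ j) * indicator {0<..?\<rho>} r) \<le> ennreal (f (r *\<^sub>R y) * r ^ j) * indicator {0<..} r"
    proof (cases "r \<in> {0<..?\<rho>}")
      case True
      then have "nrm k (r *\<^sub>R y) \<le> \<delta>" using ny by (simp add: nrm_scale field_simps)
      then have "\<epsilon> * r ^ j \<le> f (r *\<^sub>R y) * r ^ j"
        using True y by (intro mult_right_mono f_low) auto
      from ennreal_leI[OF this] show ?thesis using True pos by (simp add: ennreal_mult)
    qed simp
  qed
  finally show ?thesis .
qed

lemma ray_real:
  assumes y: "y \<in> Rn k" "y \<noteq> 0"
  shows "ray j y = ennreal (enn2real (ray j y))" "enn2real (ray j y) > 0"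
proof -
  have "ray j y < \<infinity>" using ray_finite[OF y, of j] by (simp add: le_less_trans)
  then show *: "ray j y = ennreal (enn2real (ray j y))" by simp
  have "0 < \<epsilon> * (\<delta> / nrm k y) ^ Suc j / real (Suc j)" using pos nrm_pos[OF y] by simp
  then have "0 < ennreal (\<epsilon> * (\<delta> / nrm k y) ^ Suc j / real (Suc j))" by (simp only: ennreal_less_zero_iff)
  also have "\<dots> \<le> ray j y" by (rule ray_lower[OF y])
  finally show "enn2real (ray j y) > 0" using * by (metis ennreal_less_zero_iff)
qed

lemma ray_scale:
  assumes c: "c > 0"
  shows "ray j (c *\<^sub>R y) = ennreal (1 / c ^ Suc j) * ray j y"
proof -
  have "ray j y = ennreal c * (\<integral>\<^sup>+r. ennreal (f ((c * r) *\<^sub>R y) * (c * r) ^ j) * indicator {0<..} (c * r) \<partial>lborel)"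
    unfolding ray_def using c by (subst nn_integral_real_affine[where c = c and t = 0]) auto
  also have "\<dots> = ennreal c * (\<integral>\<^sup>+r. ennreal (c ^ j) * (ennreal (f (r *\<^sub>R (c *\<^sub>R y)) * r ^ j) * indicator {0<..} r) \<partial>lborel)"
    using c f_nonneg
    by (intro arg_cong[where f = "(*) (ennreal c)"] nn_integral_cong)
      (auto simp: indicator_def zero_less_mult_iff power_mult_distrib ennreal_mult[symmetric] mult_ac)
  also have "\<dots> = ennreal c * (ennreal (c ^ j) * ray j (c *\<^sub>R y))"
    unfolding ray_def by (subst nn_integral_cmult) auto
  finally have "ennreal (1 / c ^ Suc j) * ray j y = (ennreal (1 / c ^ Suc j) * (ennreal c * ennreal (c ^ j))) * ray j (c *\<^sub>R y)"
    by (simp add: mult.assoc)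
  also have "ennreal (1 / c ^ Suc j) * (ennreal c * ennreal (c ^ j)) = 1"
    using c by (simp add: ennreal_mult[symmetric])
  finally show ?thesis by (simp only: mult_1_left)
qed

lemma ray_minus: "ray j (- y) = ray j y"
proof -
  have "f (r *\<^sub>R (- y)) = f (r *\<^sub>R y)" for r using f_even[of "r *\<^sub>R y"] by simp
  then show ?thesis unfolding ray_def by (simp only:)
qed

text \<open>The \<open>(k + 2)\<close>-nd radial moment, written in the variable \<open>s = 1 / r\<close>, is a marginal of \<open>F\<close>, which is
  jointly quasi-concave and homogeneous. Normalising the suprema of \<open>F y\<close>
  makes \<open>quasi_concave_marginal\<close> applicable.\<close>

definition F :: "(nat \<Rightarrow> real) \<Rightarrow> real \<Rightarrow> real"
  where "F y s = (if s > 0 then f ((1 / s) *\<^sub>R y) / s ^ (k + 3) else 0)"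

lemma F_nonneg: "F y s \<ge> 0"
  by (simp add: F_def f_nonneg)

lemma measurable_F [measurable]: "F y \<in> borel_measurable borel"
  unfolding F_def by measurable

lemma ray_eq_F: "ray (k + 1) y = (\<integral>\<^sup>+s. ennreal (F y s) \<partial>lborel)"
proof -
  have "ray (k + 1) y = (\<integral>\<^sup>+s. ennreal (f ((1 / s) *\<^sub>R y) * (1 / s) ^ (k + 1)) * ennreal (1 / s\<^sup>2) * indicator {0<..} s \<partial>lborel)"
    unfolding ray_def
    by (rule nn_integral_inverse_substitution[symmetric, where G = "\<lambda>r. ennreal (f (r *\<^sub>R y) * r ^ (k + 1))"]) measurable
  also have "\<dots> = (\<integral>\<^sup>+s. ennreal (F y s) \<partial>lborel)"
  proof (rule nn_integral_cong)
    fix s :: real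
    show "ennreal (f ((1 / s) *\<^sub>R y) * (1 / s) ^ (k + 1)) * ennreal (1 / s\<^sup>2) * indicator {0<..} s = ennreal (F y s)"
    proof (cases "s > 0")
      case True
      \<comment> \<open>The exponent \<open>k + 3\<close> is k + 1 from the moment plus 2 from dr =
        ds / s^2.\<close>
      have "f ((1 / s) *\<^sub>R y) * (1 / s) ^ (k + 1) * (1 / s\<^sup>2) = f ((1 / s) *\<^sub>R y) / s ^ (k + 3)"
        using True by (simp add: power_divide power_add power2_eq_square power3_eq_cube)
      then show ?thesis using True f_nonneg by (simp add: F_def ennreal_mult[symmetric])
    qed (simp add: F_def)
  qed
  finally show ?thesis .
qed

text \<open>The combination divided by \<open>w\<close> is a convex combination of x / s and y / t
  whose weights are proportional to (1 - l) s and l t. Log-concavity of \<open>f\<close> handles the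
  numerator; in the denominator \<open>w\<close> is the harmonic mean of \<open>s\<close> and
  \<open>t\<close> for these weights, hence at most their geometric mean.\<close>

lemma F_quasi_concave:
  assumes x: "x \<in> Rn k" and y: "y \<in> Rn k" and l: "0 < l" "l < 1"
  shows "min (F x s) (F y t) \<le> F ((1 - l) *\<^sub>R x + l *\<^sub>R y) ((1 - l) * s + l * t)"
proof (cases "min (F x s) (F y t) > 0")
  case True
  define c where "c = min (F x s) (F y t)"
  have c: "c > 0" "c \<le> F x s" "c \<le> F y t" using True by (auto simp: c_def)
  have st: "s > 0" "t > 0" using True by (auto simp: F_def split: if_splits)
  define w where "w = (1 - l) * s + l * t"
  have w: "w > 0" using st l by (simp add: w_def add_pos_pos)
  define \<mu> where "\<mu> = l * t / w"
  have m1: "1 - \<mu> = (1 - l) * s / w" using w by (simp add: \<mu>_def w_def field_simps)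
  have \<mu>: "0 < \<mu>" using st w l by (simp add: \<mu>_def)
  have "0 < 1 - \<mu>" unfolding m1 using st w l by simp
  then have \<mu>': "\<mu> < 1" by simp
  let ?p = "k + 3"
  have fx: "c * s ^ ?p \<le> f ((1 / s) *\<^sub>R x)" and fy: "c * t ^ ?p \<le> f ((1 / t) *\<^sub>R y)"
    using c(2,3) st by (auto simp: F_def field_simps)
  have cs: "0 < c * s ^ ?p" "0 < c * t ^ ?p" using c st by auto
  have arg: "(1 - \<mu>) *\<^sub>R ((1 / s) *\<^sub>R x) + \<mu> *\<^sub>R ((1 / t) *\<^sub>R y) = (1 / w) *\<^sub>R ((1 - l) *\<^sub>R x + l *\<^sub>R y)"
    unfolding m1 unfolding \<mu>_def using st w by (simp add: scaleR_right_distrib)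
  have hm: "w \<le> s powr (1 - \<mu>) * t powr \<mu>"
  proof -
    have "(1 / s) powr (1 - \<mu>) * (1 / t) powr \<mu> \<le> (1 - \<mu>) * (1 / s) + \<mu> * (1 / t)"
      by (rule Youngs_inequality_0) (use \<mu> \<mu>' st in auto)
    also have "\<dots> = 1 / w" unfolding m1 unfolding \<mu>_def using st w l by (simp add: field_simps)
    finally have "1 / (s powr (1 - \<mu>) * t powr \<mu>) \<le> 1 / w" using st by (simp add: powr_divide)
    then show ?thesis using w st by (simp add: field_simps)
  qed
  have "c * w ^ ?p \<le> c * (s powr (1 - \<mu>) * t powr \<mu>) ^ ?p"
    using c w hm by (intro mult_left_mono power_mono) auto
  also have "(s powr (1 - \<mu>) * t powr \<mu>) ^ ?p = (s ^ ?p) powr (1 - \<mu>) * (t ^ ?p) powr \<mu>"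
    using st by (simp only: power_mult_distrib powr_power_swap)
  also have "c * \<dots> = (c * s ^ ?p) powr (1 - \<mu>) * (c * t ^ ?p) powr \<mu>"
    by (rule powr_scale[symmetric]) (use c st in auto)
  also have "\<dots> \<le> f ((1 / s) *\<^sub>R x) powr (1 - \<mu>) * f ((1 / t) *\<^sub>R y) powr \<mu>"
    using cs fx fy \<mu> \<mu>' by (intro mult_mono powr_mono2) auto
  also have "\<dots> \<le> f ((1 - \<mu>) *\<^sub>R ((1 / s) *\<^sub>R x) + \<mu> *\<^sub>R ((1 / t) *\<^sub>R y))"
    by (rule f_lc) (use x y \<mu> \<mu>' cs fx fy in auto)
  finally have "c * w ^ ?p \<le> f ((1 / w) *\<^sub>R ((1 - l) *\<^sub>R x + l *\<^sub>R y))" unfolding arg .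
  then have "c \<le> f ((1 / w) *\<^sub>R ((1 - l) *\<^sub>R x + l *\<^sub>R y)) / w ^ ?p"
    using w by (simp add: field_simps)
  then show ?thesis using w unfolding c_def[symmetric] w_def[symmetric] by (simp only: F_def if_True)
next
  case False
  then show ?thesis using F_nonneg[of "(1 - l) *\<^sub>R x + l *\<^sub>R y" "(1 - l) * s + l * t"] by linarith
qed

text \<open>The height by which vectors are normalised before comparing marginals. Its degree of
  homogeneity is \<open>- (k + 3)\<close>, so every nonzero vector of \<open>Rn k\<close> has a
  multiple of peak 1.\<close>

definition peak :: "(nat \<Rightarrow> real) \<Rightarrow> ennreal"
  where "peak y = (SUP s. ennreal (F y s))"

text \<open>Finite because bounded support makes \<open>F y s\<close> vanish for small
  \<open>s\<close>; positive because \<open>f\<close> is at least \<open>\<epsilon>\<close> near the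
  origin.\<close>

lemma peak_real:
  assumes y: "y \<in> Rn k" "y \<noteq> 0"
  obtains a where "a > 0" "peak y = ennreal a"
proof -
  have ny: "nrm k y > 0" using nrm_pos[OF y] .
  have "F y s \<le> f 0 * (R / nrm k y) ^ (k + 3)" for s
  proof (cases "s > 0 \<and> f ((1 / s) *\<^sub>R y) > 0")
    case True
    then have "nrm k ((1 / s) *\<^sub>R y) \<le> R" using y by (intro f_supp) auto
    then have "1 / s \<le> R / nrm k y" using True ny by (simp add: nrm_scale field_simps)
    then have "(1 / s) ^ (k + 3) \<le> (R / nrm k y) ^ (k + 3)" using True by (intro power_mono) auto
    then have "f ((1 / s) *\<^sub>R y) * (1 / s) ^ (k + 3) \<le> f 0 * (R / nrm k y) ^ (k + 3)"
      using True y f0_pos by (intro mult_mono f_le_f0) auto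
    then show ?thesis using True by (simp add: F_def power_divide)
  next
    case False
    then have "F y s = 0" using f_nonneg[of "(1 / s) *\<^sub>R y"] by (auto simp: F_def)
    then show ?thesis using f0_pos pos ny by simp
  qed
  then have "peak y \<le> ennreal (f 0 * (R / nrm k y) ^ (k + 3))"
    unfolding peak_def by (intro SUP_least ennreal_leI)
  then have "peak y < \<infinity>" by (simp add: le_less_trans)
  moreover have "0 < peak y"
  proof -
    have "\<epsilon> \<le> f ((1 / (nrm k y / \<delta>)) *\<^sub>R y)"
      using y ny pos by (intro f_low) (auto simp: nrm_scale)
    then have "F y (nrm k y / \<delta>) > 0" using ny pos by (auto simp: F_def)
    then have "0 < ennreal (F y (nrm k y / \<delta>))" by simp
    also have "\<dots> \<le> peak y" unfolding peak_def by (rule SUP_upper) simp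
    finally show ?thesis .
  qed
  ultimately show thesis
    using that[of "enn2real (peak y)"] by (cases "peak y") (auto simp: enn2real_positive_iff)
qed

lemma peak_scale:
  assumes c: "c > 0" shows "peak (c *\<^sub>R y) = ennreal (1 / c ^ (k + 3)) * peak y"
proof -
  have "F (c *\<^sub>R y) s = 1 / c ^ (k + 3) * F y (s / c)" for s
    using c by (auto simp: F_def power_divide zero_less_divide_iff)
  then have "ennreal (F (c *\<^sub>R y) s) = ennreal (1 / c ^ (k + 3)) * ennreal (F y (s / c))" for s
    using c F_nonneg[of y] by (simp only: ennreal_mult[symmetric] zero_le_divide_1_iff zero_le_power less_imp_le)
  then have "peak (c *\<^sub>R y) = (SUP s. ennreal (1 / c ^ (k + 3)) * ennreal (F y (s / c)))"
    unfolding peak_def by (simp only:)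
  also have "\<dots> = ennreal (1 / c ^ (k + 3)) * (SUP s. ennreal (F y (s / c)))"
    by (rule SUP_mult_left_ennreal[symmetric])
  also have "range (\<lambda>s. ennreal (F y (s / c))) = range (\<lambda>s. ennreal (F y s))"
  proof (intro equalityI subsetI)
    fix z assume "z \<in> range (\<lambda>s. ennreal (F y s))"
    then obtain s where "z = ennreal (F y s)" by auto
    then have "z = ennreal (F y ((c * s) / c))" using c by simp
    then show "z \<in> range (\<lambda>s. ennreal (F y (s / c)))" by blast
  qed auto
  finally show ?thesis by (simp only: peak_def)
qed

lemma ray_concave:
  assumes "x \<in> Rn k" "y \<in> Rn k" "0 < l" "l < 1" "peak x = peak y"
  shows "ennreal (1 - l) * ray (k + 1) x + ennreal l * ray (k + 1) y \<le> ray (k + 1) ((1 - l) *\<^sub>R x + l *\<^sub>R y)"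
  unfolding ray_eq_F
proof (rule quasi_concave_marginal)
  show "(SUP s. ennreal (F x s)) = (SUP s. ennreal (F y s))" using assms(5) by (simp add: peak_def)
  fix s t
  have "ennreal (min (F x s) (F y t)) \<le> ennreal (F ((1 - l) *\<^sub>R x + l *\<^sub>R y) ((1 - l) * s + l * t))"
    by (rule ennreal_leI) (rule F_quasi_concave[OF assms(1-4)])
  then show "min (ennreal (F x s)) (ennreal (F y t)) \<le> ennreal (F ((1 - l) *\<^sub>R x + l *\<^sub>R y) ((1 - l) * s + l * t))"
    by (auto simp: min_def F_nonneg split: if_splits)
qed (use assms in auto)

definition \<Phi> :: "(nat \<Rightarrow> real) \<Rightarrow> real"
  where "\<Phi> y = enn2real (ray (k + 1) y)"

text \<open>The gauge of Ball's body up to a constant: \<open>\<Phi>\<close> has degree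
  \<open>- (k + 2)\<close>, so the root makes \<open>N\<close> homogeneous of degree 1.\<close>

definition N :: "(nat \<Rightarrow> real) \<Rightarrow> real"
  where "N y = (if y = 0 then 0 else 1 / root (k + 2) (\<Phi> y))"

section \<open>The gauge satisfies the triangle inequality\<close>

lemma \<Phi>_pos: "y \<in> Rn k \<Longrightarrow> y \<noteq> 0 \<Longrightarrow> \<Phi> y > 0"
  unfolding \<Phi>_def by (rule ray_real)

lemma ray_\<Phi>: "y \<in> Rn k \<Longrightarrow> y \<noteq> 0 \<Longrightarrow> ray (k + 1) y = ennreal (\<Phi> y)"
  unfolding \<Phi>_def by (rule ray_real)

lemma N_pos: "y \<in> Rn k \<Longrightarrow> y \<noteq> 0 \<Longrightarrow> N y > 0"
  using \<Phi>_pos[of y] by (simp add: N_def)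

lemma N_nonneg: "y \<in> Rn k \<Longrightarrow> N y \<ge> 0"
  using N_pos[of y] by (cases "y = 0") (auto simp: N_def)

lemma N_power: "y \<in> Rn k \<Longrightarrow> y \<noteq> 0 \<Longrightarrow> N y ^ (k + 2) * \<Phi> y = 1"
  using \<Phi>_pos[of y] by (simp add: N_def power_divide del: power_Suc add_2_eq_Suc add_2_eq_Suc')

lemma \<Phi>_scale: "c > 0 \<Longrightarrow> \<Phi> (c *\<^sub>R y) = \<Phi> y / c ^ (k + 2)"
  by (simp add: \<Phi>_def ray_scale enn2real_mult)

lemma N_scale: "c \<ge> 0 \<Longrightarrow> N (c *\<^sub>R y) = c * N y"
  by (cases "c = 0") (auto simp: N_def \<Phi>_scale real_root_divide real_root_pos2 simp del: add_2_eq_Suc')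

lemma N_minus: "N (- y) = N y"
  by (simp add: N_def \<Phi>_def ray_minus)

text \<open>Rescale \<open>x\<close> and \<open>y\<close> separately to peak 1. Then
  \<open>ray_concave\<close> applies although the original peaks differ, and homogeneity transfers
  the resulting bound back to \<open>x + y\<close>.\<close>

lemma N_triangle:
  assumes x: "x \<in> Rn k" and y: "y \<in> Rn k"
  shows "N (x + y) \<le> N x + N y"
proof (cases "x = 0 \<or> y = 0 \<or> x + y = 0")
  case True
  then show ?thesis using N_nonneg[OF x] N_nonneg[OF y] by (auto simp: N_def)
next
  case False
  then have nz: "x \<noteq> 0" "y \<noteq> 0" "x + y \<noteq> 0" by auto
  have xy: "x + y \<in> Rn k" using x y by simp
  have norm: "\<exists>\<alpha>>0. peak ((1 / \<alpha>) *\<^sub>R z) = 1" if z: "z \<in> Rn k" "z \<noteq> 0" for z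
  proof -
    obtain a where a: "a > 0" "peak z = ennreal a" using peak_real[OF z] .
    let ?\<alpha> = "root (k + 3) (1 / a)"
    have "?\<alpha> > 0" using a by simp
    moreover have "?\<alpha> ^ (k + 3) = 1 / a" using a by (intro real_root_pow_pos) auto
    then have "peak ((1 / ?\<alpha>) *\<^sub>R z) = 1"
      using a \<open>?\<alpha> > 0\<close> by (subst peak_scale) (simp_all add: power_divide ennreal_mult[symmetric])
    ultimately show ?thesis by blast
  qed
  obtain \<alpha> where \<alpha>: "\<alpha> > 0" "peak ((1 / \<alpha>) *\<^sub>R x) = 1" using norm[OF x nz(1)] by auto
  obtain \<beta> where \<beta>: "\<beta> > 0" "peak ((1 / \<beta>) *\<^sub>R y) = 1" using norm[OF y nz(2)] by auto
  \<comment> \<open>Chosen so that the convex combination of x / \<alpha> and y / \<beta> is a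
    multiple of \<open>x + y\<close>.\<close>
  define l where "l = \<beta> / (\<alpha> + \<beta>)"
  have l: "0 < l" "l < 1" "1 - l = \<alpha> / (\<alpha> + \<beta>)" using \<alpha> \<beta> by (auto simp: l_def field_simps)
  let ?q = "k + 2"
  define z where "z = N x / \<alpha>"
  define w where "w = N y / \<beta>"
  have zw: "z > 0" "w > 0" using N_pos[OF x nz(1)] N_pos[OF y nz(2)] \<alpha> \<beta> by (auto simp: z_def w_def)
  have \<Phi>x: "\<Phi> ((1 / \<alpha>) *\<^sub>R x) = 1 / z ^ ?q"
    using N_power[OF x nz(1)] N_pos[OF x nz(1)] \<alpha> by (simp add: \<Phi>_scale z_def power_divide field_simps)
  have \<Phi>y: "\<Phi> ((1 / \<beta>) *\<^sub>R y) = 1 / w ^ ?q"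
    using N_power[OF y nz(2)] N_pos[OF y nz(2)] \<beta> by (simp add: \<Phi>_scale w_def power_divide field_simps)
  have arg: "(1 - l) *\<^sub>R ((1 / \<alpha>) *\<^sub>R x) + l *\<^sub>R ((1 / \<beta>) *\<^sub>R y) = (1 / (\<alpha> + \<beta>)) *\<^sub>R (x + y)"
    unfolding l(3) unfolding l_def using \<alpha> \<beta> by (simp add: scaleR_right_distrib)
  have "ennreal (1 - l) * ray (k + 1) ((1 / \<alpha>) *\<^sub>R x) + ennreal l * ray (k + 1) ((1 / \<beta>) *\<^sub>R y)
    \<le> ray (k + 1) ((1 / (\<alpha> + \<beta>)) *\<^sub>R (x + y))"
    unfolding arg[symmetric] by (rule ray_concave) (use x y l \<alpha> \<beta> in auto)
  moreover have "ray (k + 1) ((1 / \<alpha>) *\<^sub>R x) = ennreal (1 / z ^ ?q)"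
    unfolding \<Phi>x[symmetric] by (rule ray_\<Phi>) (use x nz \<alpha> in auto)
  moreover have "ray (k + 1) ((1 / \<beta>) *\<^sub>R y) = ennreal (1 / w ^ ?q)"
    unfolding \<Phi>y[symmetric] by (rule ray_\<Phi>) (use y nz \<beta> in auto)
  moreover have "ray (k + 1) ((1 / (\<alpha> + \<beta>)) *\<^sub>R (x + y)) = ennreal (\<Phi> ((1 / (\<alpha> + \<beta>)) *\<^sub>R (x + y)))"
    by (rule ray_\<Phi>) (use xy nz \<alpha> \<beta> in auto)
  ultimately have "ennreal (1 - l) * ennreal (1 / z ^ ?q) + ennreal l * ennreal (1 / w ^ ?q) \<le> ennreal (\<Phi> ((1 / (\<alpha> + \<beta>)) *\<^sub>R (x + y)))"
    by (simp only:)
  then have conc: "(1 - l) * (1 / z ^ ?q) + l * (1 / w ^ ?q) \<le> \<Phi> ((1 / (\<alpha> + \<beta>)) *\<^sub>R (x + y))"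
    using l zw \<Phi>_pos[of "(1 / (\<alpha> + \<beta>)) *\<^sub>R (x + y)"] xy nz \<alpha> \<beta>
    by (simp add: ennreal_mult[symmetric] ennreal_plus[symmetric] del: ennreal_plus)
  have am: "z powr (1 - l) * w powr l \<le> (1 - l) * z + l * w"
    by (rule Youngs_inequality_0) (use l zw in auto)
  have pw: "0 < z powr (1 - l) * w powr l" using zw by simp
  \<comment> \<open>Two applications of Young's inequality with the geometric mean in between, one
    to \<open>z\<close>, \<open>w\<close> and one to their inverse powers; in short, convexity of
    the inverse power. Since (1 - l) z + l w equals (N x + N y) / (\<alpha> + \<beta>), this bounds
    \<Phi> (x + y) from below.\<close>
  have "1 / ((1 - l) * z + l * w) ^ ?q \<le> 1 / (z powr (1 - l) * w powr l) ^ ?q"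
    using am pw by (intro divide_left_mono power_mono mult_pos_pos zero_less_power) auto
  also have "\<dots> = (1 / z ^ ?q) powr (1 - l) * (1 / w ^ ?q) powr l"
    using zw by (simp only: power_mult_distrib powr_power_swap) (simp add: powr_divide)
  also have "\<dots> \<le> (1 - l) * (1 / z ^ ?q) + l * (1 / w ^ ?q)"
    by (rule Youngs_inequality_0) (use l zw in auto)
  also note conc
  also have "(1 - l) * z + l * w = (N x + N y) / (\<alpha> + \<beta>)"
    unfolding l(3) unfolding l_def z_def w_def using \<alpha> \<beta> by (simp add: add_divide_distrib)
  also have "\<Phi> ((1 / (\<alpha> + \<beta>)) *\<^sub>R (x + y)) = \<Phi> (x + y) * (\<alpha> + \<beta>) ^ ?q"
    using \<alpha> \<beta> by (simp add: \<Phi>_scale power_divide)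
  finally have "(\<alpha> + \<beta>) ^ ?q * (1 / (N x + N y) ^ ?q) \<le> (\<alpha> + \<beta>) ^ ?q * \<Phi> (x + y)"
    unfolding power_divide by (simp only: divide_divide_eq_right mult_1_left times_divide_eq_right mult_1_right mult.commute)
  then have "1 / (N x + N y) ^ ?q \<le> \<Phi> (x + y)"
    by (rule mult_left_le_imp_le) (use \<alpha> \<beta> in simp)
  also have "\<Phi> (x + y) = 1 / N (x + y) ^ ?q"
    using N_power[OF xy nz(3)] N_pos[OF xy nz(3)] by (simp add: field_simps)
  finally have "inverse ((N x + N y) ^ ?q) \<le> inverse (N (x + y) ^ ?q)" by (simp only: inverse_eq_divide)
  then have "N (x + y) ^ ?q \<le> (N x + N y) ^ ?q"
    by (rule inverse_le_imp_le) (intro zero_less_power add_pos_pos N_pos x y nz)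
  then show ?thesis
    using N_nonneg[OF x] N_nonneg[OF y] by (rule_tac power_le_imp_le_base[of _ "k + 1"]) auto
qed

text \<open>With \<open>N_lower\<close>, equivalence of \<open>N\<close> with the Euclidean norm.
  The upper bound yields closedness and an interior point of Ball's body, the lower one its
  boundedness.\<close>

lemma N_upper: "\<exists>C>0. \<forall>y\<in>Rn k. N y \<le> C * nrm k y"
proof -
  let ?q = "k + 2"
  define c where "c = root ?q (\<epsilon> / real ?q)"
  have cp: "c > 0" using pos by (simp add: c_def)
  have cq: "c ^ ?q = \<epsilon> / real ?q" unfolding c_def using pos by (intro real_root_pow_pos) auto
  show ?thesis
  proof (intro exI[of _ "1 / (c * \<delta>)"] conjI ballI)
    show "1 / (c * \<delta>) > 0" using cp pos by simp
    fix y assume y: "y \<in> Rn k"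
    show "N y \<le> 1 / (c * \<delta>) * nrm k y"
    proof (cases "y = 0")
      case False
      have ny: "nrm k y > 0" using nrm_pos[OF y False] .
      have "ennreal (\<epsilon> * (\<delta> / nrm k y) ^ Suc (k + 1) / real (Suc (k + 1))) \<le> ennreal (\<Phi> y)"
        using ray_lower[OF y False, of "k + 1"] ray_\<Phi>[OF y False] by simp
      then have "\<epsilon> * (\<delta> / nrm k y) ^ Suc (k + 1) / real (Suc (k + 1)) \<le> \<Phi> y"
        using \<Phi>_pos[OF y False] by (subst (asm) ennreal_le_iff) auto
      moreover have "Suc (k + 1) = ?q" by simp
      ultimately have "c ^ ?q * (\<delta> / nrm k y) ^ ?q \<le> \<Phi> y" by (simp only: cq times_divide_eq_left)
      also have "\<dots> = 1 / N y ^ ?q" using N_power[OF y False] N_pos[OF y False] by (simp add: field_simps)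
      finally have "(c * (\<delta> / nrm k y)) ^ ?q \<le> (1 / N y) ^ ?q" by (simp only: power_mult_distrib power_divide power_one)
      then have "c * (\<delta> / nrm k y) \<le> 1 / N y"
        using N_pos[OF y False] by (rule_tac power_le_imp_le_base[of _ "k + 1"]) auto
      then show ?thesis using N_pos[OF y False] cp pos ny by (simp add: field_simps)
    qed (simp add: N_def)
  qed
qed

lemma N_lower: "\<exists>c>0. \<forall>y\<in>Rn k. c * nrm k y \<le> N y"
proof -
  let ?q = "k + 2"
  define b where "b = root ?q (f 0)"
  have bp: "b > 0" using f0_pos by (simp add: b_def)
  have bq: "b ^ ?q = f 0" unfolding b_def using f0_pos by (intro real_root_pow_pos) auto
  show ?thesis
  proof (intro exI[of _ "1 / (b * R)"] conjI ballI)
    show "1 / (b * R) > 0" using bp pos by simp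
    fix y assume y: "y \<in> Rn k"
    show "1 / (b * R) * nrm k y \<le> N y"
    proof (cases "y = 0")
      case False
      have ny: "nrm k y > 0" using nrm_pos[OF y False] .
      have "ennreal (\<Phi> y) \<le> ennreal (f 0 * (R / nrm k y) ^ Suc (k + 1))"
        using ray_finite[OF y False, of "k + 1"] ray_\<Phi>[OF y False] by simp
      then have "\<Phi> y \<le> f 0 * (R / nrm k y) ^ Suc (k + 1)"
        using f0_pos pos ny by (subst (asm) ennreal_le_iff) auto
      moreover have "Suc (k + 1) = ?q" by simp
      ultimately have "\<Phi> y \<le> b ^ ?q * (R / nrm k y) ^ ?q" by (simp only: bq)
      moreover have "\<Phi> y = 1 / N y ^ ?q" using N_power[OF y False] N_pos[OF y False] by (simp add: field_simps)
      ultimately have "(1 / N y) ^ ?q \<le> (b * (R / nrm k y)) ^ ?q" by (simp only: power_mult_distrib power_divide power_one)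
      then have "1 / N y \<le> b * (R / nrm k y)"
        using bp pos ny by (rule_tac power_le_imp_le_base[of _ "k + 1"]) auto
      then show ?thesis using N_pos[OF y False] bp pos ny by (simp add: field_simps)
    qed (simp add: N_def)
  qed
qed

text \<open>Along the ray through \<open>y\<close> the body contributes (radius / N y)^(k+2) / (k+2)
  to the moment of order k + 1. This radius makes the contribution equal to \<open>\<Phi> y\<close>,
  not only proportional.\<close>

definition B :: "(nat \<Rightarrow> real) set"
  where "B = {y \<in> Rn k. N y \<le> root (k + 2) (real k + 2)}"

abbreviation "radius \<equiv> root (k + 2) (real k + 2)"

lemma radius_pos: "radius > 0" by simp

lemma radius_power: "radius ^ (k + 2) = real k + 2"
  by (rule real_root_pow_pos) auto

text \<open>The triangle inequality and \<open>N_upper\<close> make \<open>N\<close> Lipschitz for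
  the Euclidean norm, so around each point outside a whole \<open>nball\<close> stays
  outside.\<close>

lemma closed_B: "closed B"
proof -
  obtain C where C: "C > 0" "\<And>y. y \<in> Rn k \<Longrightarrow> N y \<le> C * nrm k y" using N_upper by blast
  let ?U = "\<Union>x\<in>Rn k \<inter> {x. N x > radius}. nball k x ((N x - radius) / C)"
  have "B = Rn k - ?U"
  proof (intro equalityI subsetI DiffI)
    fix y assume y: "y \<in> B"
    then show "y \<in> Rn k" by (simp add: B_def)
    show "y \<notin> ?U"
    proof
      assume "y \<in> ?U"
      then obtain x where x: "x \<in> Rn k" "y \<in> nball k x ((N x - radius) / C)" by auto
      have yR: "y \<in> Rn k" "N y \<le> radius" using y by (auto simp: B_def)
      have "N (y + (x - y)) \<le> N y + N (x - y)" using x yR by (intro N_triangle) auto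
      also have "y + (x - y) = x" by simp
      also have "N (x - y) \<le> C * nrm k (x - y)" using x yR by (intro C) auto
      also have "C * nrm k (x - y) < N x - radius"
        using x(2) C(1) nrm_commute[of x y k] by (simp add: nball_def field_simps)
      finally show False using yR by simp
    qed
  next
    fix y assume y: "y \<in> Rn k - ?U"
    show "y \<in> B"
    proof (rule ccontr)
      assume "y \<notin> B"
      then have n: "N y > radius" using y by (simp add: B_def)
      then have "y \<in> nball k y ((N y - radius) / C)" using C(1) by (simp add: nball_def)
      then show False using y n by blast
    qed
  qed
  moreover have "open ?U" by (intro open_UN ballI open_nball)
  ultimately show ?thesis using closed_Rn by (simp only: closed_Diff)
qed

lemma sym_convex_body_B: "sym_convex_body k B"
  unfolding sym_convex_body_def
proof (intro conjI)
  show "B \<subseteq> Rn k" by (auto simp: B_def)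
  show "convex B"
    unfolding convex_def
  proof (intro ballI allI impI)
    fix x y :: "nat \<Rightarrow> real" and u v :: real
    assume xy: "x \<in> B" "y \<in> B" and uv: "0 \<le> u" "0 \<le> v" "u + v = 1"
    have R: "x \<in> Rn k" "y \<in> Rn k" "N x \<le> radius" "N y \<le> radius" using xy by (auto simp: B_def)
    have "N (u *\<^sub>R x + v *\<^sub>R y) \<le> N (u *\<^sub>R x) + N (v *\<^sub>R y)" using R by (intro N_triangle) auto
    also have "\<dots> = u * N x + v * N y" using uv by (simp add: N_scale)
    also have "\<dots> \<le> u * radius + v * radius" using uv R by (intro add_mono mult_left_mono) auto
    also have "\<dots> = radius" using uv by (simp add: distrib_right[symmetric])
    finally show "u *\<^sub>R x + v *\<^sub>R y \<in> B" using R by (simp add: B_def)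
  qed
  show "uminus ` B = B"
  proof -
    have "- x \<in> B" if "x \<in> B" for x using that by (auto simp: B_def N_minus)
    then show ?thesis by (auto simp: image_iff) (metis minus_minus)
  qed
  show "compact B"
  proof -
    obtain c where c: "c > 0" "\<And>y. y \<in> Rn k \<Longrightarrow> c * nrm k y \<le> N y" using N_lower by blast
    have "B \<subseteq> {x \<in> Rn k. \<forall>i<k. \<bar>x i\<bar> \<le> radius / c}"
    proof
      fix y assume y: "y \<in> B"
      then have yR: "y \<in> Rn k" "N y \<le> radius" by (auto simp: B_def)
      have "c * nrm k y \<le> radius" using c(2)[OF yR(1)] yR(2) by linarith
      then have "nrm k y \<le> radius / c" using c(1) by (simp add: field_simps)
      then show "y \<in> {x \<in> Rn k. \<forall>i<k. \<bar>x i\<bar> \<le> radius / c}"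
        using yR coord_le_nrm[of _ k y] by (auto intro: order.trans)
    qed
    then have "B \<inter> {x \<in> Rn k. \<forall>i<k. \<bar>x i\<bar> \<le> radius / c} = B" by (rule Int_absorb2)
    moreover have "compact (B \<inter> {x \<in> Rn k. \<forall>i<k. \<bar>x i\<bar> \<le> radius / c})"
      by (rule closed_Int_compact[OF closed_B compact_box])
    ultimately show ?thesis by (simp only:)
  qed
  show "top_of_set (Rn k) interior_of B \<noteq> {}"
  proof -
    obtain C where C: "C > 0" "\<And>y. y \<in> Rn k \<Longrightarrow> N y \<le> C * nrm k y" using N_upper by blast
    let ?T = "Rn k \<inter> nball k 0 (radius / C)"
    have "?T \<subseteq> B"
    proof
      fix y assume y: "y \<in> ?T"
      then have "C * nrm k y \<le> radius" using C(1) by (simp add: nball_def field_simps)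
      then show "y \<in> B" using y C(2)[of y] by (simp add: B_def)
    qed
    moreover have "openin (top_of_set (Rn k)) ?T" by (intro openin_open_Int open_nball)
    moreover have "0 \<in> ?T" using C(1) by (simp add: nball_def)
    ultimately have "0 \<in> top_of_set (Rn k) interior_of B" unfolding interior_of_def by blast
    then show ?thesis by blast
  qed
qed

section \<open>Second moments and volume of Ball's body\<close>

lemma compact_B: "compact B"
  using sym_convex_body_B by (simp add: sym_convex_body_def)

lemma B_borel [measurable]: "B \<in> sets borel"
  using closed_B by simp

lemma ray_B:
  assumes y: "y \<in> Rn k" "y \<noteq> 0" and r: "r > 0"
  shows "r *\<^sub>R y \<in> B \<longleftrightarrow> r \<le> radius / N y"
  using N_pos[OF y] y r by (simp add: B_def N_scale field_simps)

text \<open>Both integrals agree ray by ray in polar coordinates, since the square of the linear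
  form raises the weight r^(k-1) to r^(k+1), the order defining \<open>\<Phi>\<close>.\<close>

lemma mom_B: "mom k B \<theta> = (\<integral>\<^sup>+y. ennreal (f y * (ip k y \<theta>)\<^sup>2) \<partial>lebesgue_Rn k)"
proof -
  have "(\<integral>\<^sup>+r. indicator B (r *\<^sub>R y) * ennreal ((ip k (r *\<^sub>R y) \<theta>)\<^sup>2) * ennreal (r ^ (k - 1)) * indicator {0<..} r \<partial>lborel)
    = (\<integral>\<^sup>+r. ennreal (f (r *\<^sub>R y) * (ip k (r *\<^sub>R y) \<theta>)\<^sup>2) * ennreal (r ^ (k - 1)) * indicator {0<..} r \<partial>lborel)"
    if y: "y \<in> Rn k" "y \<noteq> 0" for y
  proof -
    obtain k' where k': "k = Suc k'" using k by (cases k) auto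
    let ?a = "(ip k y \<theta>)\<^sup>2"
    have pw: "(ip k (r *\<^sub>R y) \<theta>)\<^sup>2 * r ^ (k - 1) = ?a * r ^ (k + 1)" for r
      by (simp add: ip_lin power_mult_distrib k' power2_eq_square)
    have "(\<integral>\<^sup>+r. indicator B (r *\<^sub>R y) * ennreal ((ip k (r *\<^sub>R y) \<theta>)\<^sup>2) * ennreal (r ^ (k - 1)) * indicator {0<..} r \<partial>lborel)
      = (\<integral>\<^sup>+r. ennreal ?a * (ennreal (r ^ (k + 1)) * indicator {0<..radius / N y} r) \<partial>lborel)"
    proof (rule nn_integral_cong)
      fix r :: real
      show "indicator B (r *\<^sub>R y) * ennreal ((ip k (r *\<^sub>R y) \<theta>)\<^sup>2) * ennreal (r ^ (k - 1)) * indicator {0<..} r =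
        ennreal ?a * (ennreal (r ^ (k + 1)) * indicator {0<..radius / N y} r)"
      proof (cases "r > 0")
        case True
        have "ennreal ((ip k (r *\<^sub>R y) \<theta>)\<^sup>2) * ennreal (r ^ (k - 1)) = ennreal ?a * ennreal (r ^ (k + 1))"
          using True by (simp only: ennreal_mult[symmetric] zero_le_power2 zero_le_power less_imp_le pw)
        then show ?thesis using True by (simp add: indicator_def ray_B[OF y] del: power_Suc)
      qed simp
    qed
    also have "\<dots> = ennreal ?a * ennreal ((radius / N y) ^ Suc (k + 1) / real (Suc (k + 1)))"
      using N_pos[OF y] radius_pos by (subst nn_integral_cmult) (auto simp: nn_integral_power_Ioc simp del: of_nat_Suc power_Suc)
    also have "(radius / N y) ^ Suc (k + 1) / real (Suc (k + 1)) = \<Phi> y"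
    proof -
      have "(radius / N y) ^ (k + 2) / (real k + 2) = 1 / N y ^ (k + 2)"
        unfolding power_divide radius_power by simp
      also have "\<dots> = \<Phi> y" using N_power[OF y] N_pos[OF y] by (simp add: field_simps)
      finally show ?thesis by (simp add: add.commute)
    qed
    also have "ennreal ?a * ennreal (\<Phi> y) = ennreal ?a * ray (k + 1) y" by (simp only: ray_\<Phi>[OF y])
    also have "\<dots> = (\<integral>\<^sup>+r. ennreal ?a * (ennreal (f (r *\<^sub>R y) * r ^ (k + 1)) * indicator {0<..} r) \<partial>lborel)"
      unfolding ray_def by (rule nn_integral_cmult[symmetric]) measurable
    also have "\<dots> = (\<integral>\<^sup>+r. ennreal (f (r *\<^sub>R y) * (ip k (r *\<^sub>R y) \<theta>)\<^sup>2) * ennreal (r ^ (k - 1)) * indicator {0<..} r \<partial>lborel)"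
    proof (rule nn_integral_cong)
      fix r :: real
      show "ennreal ?a * (ennreal (f (r *\<^sub>R y) * r ^ (k + 1)) * indicator {0<..} r) =
        ennreal (f (r *\<^sub>R y) * (ip k (r *\<^sub>R y) \<theta>)\<^sup>2) * ennreal (r ^ (k - 1)) * indicator {0<..} r"
      proof (cases "r > 0")
        case True
        have "?a * (f (r *\<^sub>R y) * r ^ (k + 1)) = f (r *\<^sub>R y) * (ip k (r *\<^sub>R y) \<theta>)\<^sup>2 * r ^ (k - 1)"
          using pw[of r] by (simp only: mult.assoc) (simp only: mult.left_commute mult.commute)
        then show ?thesis using True f_nonneg by (simp add: ennreal_mult[symmetric] del: power_Suc)
      qed simp
    qed
    finally show ?thesis .
  qed
  note eq = this
  have "mom k B \<theta> = of_nat k * (\<integral>\<^sup>+y. (\<integral>\<^sup>+r. indicator B (r *\<^sub>R dirn k y) * ennreal ((ip k (r *\<^sub>R dirn k y) \<theta>)\<^sup>2) * ennreal (r ^ (k - 1)) * indicator {0<..} r \<partial>lborel)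
      * indicator (unit_ball k) y \<partial>lebesgue_Rn k)"
    unfolding mom_def by (rule nn_integral_polar[OF k]) measurable
  also have "\<dots> = of_nat k * (\<integral>\<^sup>+y. (\<integral>\<^sup>+r. ennreal (f (r *\<^sub>R dirn k y) * (ip k (r *\<^sub>R dirn k y) \<theta>)\<^sup>2) * ennreal (r ^ (k - 1)) * indicator {0<..} r \<partial>lborel)
      * indicator (unit_ball k) y \<partial>lebesgue_Rn k)"
  proof -
    have "dirn k y \<noteq> 0" for y using dirn_sphere(2)[OF k, of y] by auto
    then show ?thesis by (subst eq) (use dirn_sphere[OF k] in auto)
  qed
  also have "\<dots> = (\<integral>\<^sup>+y. ennreal (f y * (ip k y \<theta>)\<^sup>2) \<partial>lebesgue_Rn k)"
    by (rule nn_integral_polar[OF k, symmetric]) measurable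
  finally show ?thesis .
qed

text \<open>\<open>moment_comparison\<close> for \<open>f\<close> along one ray, normalised by
  \<open>f 0\<close>, followed by a root of order \<open>k + 2\<close>. The normalisation enters
  with power k on one side and k + 2 on the other, which leaves the factor
  \<open>1 / (f 0)\<^sup>2\<close>.\<close>

lemma radius_moment:
  assumes y: "y \<in> Rn k" "y \<noteq> 0"
  shows "ennreal ((radius / N y) ^ k) \<le> ennreal (root (k + 2) ((6 * exp 2) ^ k / (f 0)\<^sup>2)) * (of_nat k * ray (k - 1) y)"
proof -
  define V where "V = enn2real (ray (k - 1) y)"
  have V: "ray (k - 1) y = ennreal V" "V > 0" unfolding V_def by (rule ray_real[OF y])+
  define \<psi> where "\<psi> r = f (r *\<^sub>R y) / f 0" for r
  have ny: "nrm k y > 0" using nrm_pos[OF y] .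
  have ray\<psi>: "(\<integral>\<^sup>+r. ennreal (r ^ j * \<psi> r) * indicator {0<..} r \<partial>lborel) = ennreal (v / f 0)"
    if "ray j y = ennreal v" "v \<ge> 0" for j v
  proof -
    have "(\<integral>\<^sup>+r. ennreal (r ^ j * \<psi> r) * indicator {0<..} r \<partial>lborel) =
      (\<integral>\<^sup>+r. ennreal (1 / f 0) * (ennreal (f (r *\<^sub>R y) * r ^ j) * indicator {0<..} r) \<partial>lborel)"
      using f0_pos f_nonneg
      by (intro nn_integral_cong) (auto simp: indicator_def \<psi>_def ennreal_mult[symmetric] mult.commute)
    also have "\<dots> = ennreal (1 / f 0) * ray j y"
      unfolding ray_def by (rule nn_integral_cmult) measurable
    finally show ?thesis using that f0_pos by (simp add: ennreal_mult[symmetric])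
  qed
  let ?C = "6 * exp 2 :: real"
  have "((real k + 2) * (\<Phi> y / f 0)) ^ k \<le> ?C ^ k * (real k * (V / f 0)) ^ (k + 2)"
  proof (rule moment_comparison[OF k, where \<psi> = \<psi> and R = "R / nrm k y"])
    show "\<psi> \<in> borel_measurable borel" unfolding \<psi>_def by measurable
    show "\<psi> r \<ge> 0" for r using f_nonneg f0_pos by (simp add: \<psi>_def)
    show "\<psi> r = 0" if "r > R / nrm k y" for r
    proof -
      have "r > 0" using that pos ny by (meson divide_pos_pos less_trans)
      have "\<not> f (r *\<^sub>R y) > 0"
      proof
        assume "f (r *\<^sub>R y) > 0"
        then have "nrm k (r *\<^sub>R y) \<le> R" using y by (intro f_supp) auto
        then show False using that \<open>r > 0\<close> ny by (simp add: nrm_scale field_simps)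
      qed
      then show ?thesis using f_nonneg[of "r *\<^sub>R y"] by (simp add: \<psi>_def)
    qed
    show "R / nrm k y > 0" using pos ny by simp
    show "\<psi> r' powr (r / r') \<le> \<psi> r" if r: "0 < r" "r < r'" "0 < \<psi> r'" for r r'
    proof -
      have f': "f (r' *\<^sub>R y) > 0" using r(3) f0_pos by (simp add: \<psi>_def zero_less_divide_iff)
      have "f 0 powr (1 - r / r') * f (r' *\<^sub>R y) powr (r / r') \<le> f ((1 - r / r') *\<^sub>R 0 + (r / r') *\<^sub>R (r' *\<^sub>R y))"
        by (rule f_lc) (use y r f' f0_pos in auto)
      also have "(1 - r / r') *\<^sub>R 0 + (r / r') *\<^sub>R (r' *\<^sub>R y) = r *\<^sub>R y" using r by simp
      also have "f 0 powr (1 - r / r') * f (r' *\<^sub>R y) powr (r / r') = f 0 * \<psi> r' powr (r / r')"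
        using f0_pos f_nonneg by (simp add: \<psi>_def powr_divide powr_diff)
      finally show ?thesis using f0_pos unfolding \<psi>_def[of r] by (simp only: pos_le_divide_eq mult.commute)
    qed
    show "(\<integral>\<^sup>+r. ennreal (r ^ (k - 1) * \<psi> r) * indicator {0<..} r \<partial>lborel) = ennreal (V / f 0)"
      by (rule ray\<psi>[OF V(1)]) (use V in simp)
    show "V / f 0 > 0" using V f0_pos by simp
    show "(\<integral>\<^sup>+r. ennreal (r ^ (k + 1) * \<psi> r) * indicator {0<..} r \<partial>lborel) = ennreal (\<Phi> y / f 0)"
      by (rule ray\<psi>[OF ray_\<Phi>[OF y]]) (use \<Phi>_pos[OF y] in simp)
    show "\<Phi> y / f 0 \<ge> 0" using \<Phi>_pos[OF y] f0_pos by simp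
  qed
  then have "((real k + 2) * \<Phi> y) ^ k / f 0 ^ k \<le> ?C ^ k * ((real k * V) ^ (k + 2) / f 0 ^ (k + 2))"
    by (simp only: times_divide_eq_right power_divide)
  then have "f 0 ^ k * (((real k + 2) * \<Phi> y) ^ k / f 0 ^ k) \<le> f 0 ^ k * (?C ^ k * ((real k * V) ^ (k + 2) / f 0 ^ (k + 2)))"
    using f0_pos by (intro mult_left_mono) auto
  also have "f 0 ^ k * (((real k + 2) * \<Phi> y) ^ k / f 0 ^ k) = ((real k + 2) * \<Phi> y) ^ k" using f0_pos by simp
  also have "f 0 ^ k * (?C ^ k * ((real k * V) ^ (k + 2) / f 0 ^ (k + 2))) = ?C ^ k / (f 0)\<^sup>2 * (real k * V) ^ (k + 2)"
  proof -
    have "a ^ k * (c * (X / (a ^ k * a\<^sup>2))) = c / a\<^sup>2 * X" if "a > 0" for a c X :: real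
      using that by simp
    from this[OF f0_pos] show ?thesis unfolding power_add[of "f 0"] .
  qed
  also have "((real k + 2) * \<Phi> y) ^ k = ((radius / N y) ^ k) ^ (k + 2)"
  proof -
    have "(radius / N y) ^ (k + 2) = (real k + 2) * \<Phi> y"
      unfolding power_divide radius_power using N_power[OF y] N_pos[OF y] by (simp add: field_simps)
    then have "((real k + 2) * \<Phi> y) ^ k = ((radius / N y) ^ (k + 2)) ^ k" by (simp only:)
    also have "\<dots> = ((radius / N y) ^ k) ^ (k + 2)" by (simp only: power_mult[symmetric] mult.commute)
    finally show ?thesis .
  qed
  finally have le: "((radius / N y) ^ k) ^ (k + 2) \<le> ?C ^ k / (f 0)\<^sup>2 * (real k * V) ^ (k + 2)" .
  define \<kappa> where "\<kappa> = root (k + 2) (?C ^ k / (f 0)\<^sup>2)"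
  have \<kappa>: "\<kappa> > 0" using f0_pos by (simp add: \<kappa>_def)
  have "\<kappa> ^ (k + 2) = ?C ^ k / (f 0)\<^sup>2" unfolding \<kappa>_def using f0_pos by (intro real_root_pow_pos) auto
  then have "((radius / N y) ^ k) ^ (k + 2) \<le> (\<kappa> * (real k * V)) ^ (k + 2)"
    using le by (simp only: power_mult_distrib)
  then have "(radius / N y) ^ k \<le> \<kappa> * (real k * V)"
    using \<kappa> V k by (rule_tac power_le_imp_le_base[of _ "k + 1"]) auto
  from ennreal_leI[OF this] show ?thesis
    unfolding \<kappa>_def[symmetric] V(1) ennreal_of_nat_eq_real_of_nat
    using \<kappa> V(2) by (simp add: ennreal_mult)
qed

text \<open>Integrates \<open>radius_moment\<close> over all directions in polar
  coordinates.\<close>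

lemma emeasure_B:
  "emeasure (lebesgue_Rn k) B \<le> ennreal (root (k + 2) ((6 * exp 2) ^ k / (f 0)\<^sup>2)) * (\<integral>\<^sup>+y. ennreal (f y) \<partial>lebesgue_Rn k)"
proof -
  let ?\<kappa> = "ennreal (root (k + 2) ((6 * exp 2) ^ k / (f 0)\<^sup>2))"
  have D: "dirn k y \<in> Rn k" "dirn k y \<noteq> 0" for y using dirn_sphere[OF k, of y] by auto
  have Sk: "Suc (k - 1) = k" using k by simp
  have inner: "(\<integral>\<^sup>+r. indicator B (r *\<^sub>R y) * ennreal (r ^ (k - 1)) * indicator {0<..} r \<partial>lborel)
    \<le> ?\<kappa> * ray (k - 1) y" if y: "y \<in> Rn k" "y \<noteq> 0" for y
  proof -
    have "(\<integral>\<^sup>+r. indicator B (r *\<^sub>R y) * ennreal (r ^ (k - 1)) * indicator {0<..} r \<partial>lborel) =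
      (\<integral>\<^sup>+r. ennreal (r ^ (k - 1)) * indicator {0<..radius / N y} r \<partial>lborel)"
      by (rule nn_integral_cong) (auto simp: indicator_def ray_B[OF y])
    also have "\<dots> = ennreal ((radius / N y) ^ k / real k)"
      using N_pos[OF y] radius_pos by (subst nn_integral_power_Ioc) (auto simp only: Sk intro!: less_imp_le divide_pos_pos)
    also have "\<dots> = ennreal (1 / real k) * ennreal ((radius / N y) ^ k)"
      using N_pos[OF y] radius_pos by (subst ennreal_mult[symmetric]) auto
    also have "\<dots> \<le> ennreal (1 / real k) * (?\<kappa> * (of_nat k * ray (k - 1) y))"
      by (intro mult_left_mono radius_moment[OF y]) simp
    also have "\<dots> = (ennreal (1 / real k) * of_nat k) * (?\<kappa> * ray (k - 1) y)" by (simp only: mult_ac)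
    also have "ennreal (1 / real k) * of_nat k = 1"
      using k by (simp add: ennreal_of_nat_eq_real_of_nat ennreal_mult[symmetric])
    finally show ?thesis by (simp only: mult_1_left)
  qed
  have ray: "?\<kappa> * ray (k - 1) y = (\<integral>\<^sup>+r. ?\<kappa> * ennreal (f (r *\<^sub>R y)) * ennreal (r ^ (k - 1)) * indicator {0<..} r \<partial>lborel)" for y
  proof -
    have "?\<kappa> * ray (k - 1) y = (\<integral>\<^sup>+r. ?\<kappa> * (ennreal (f (r *\<^sub>R y) * r ^ (k - 1)) * indicator {0<..} r) \<partial>lborel)"
      unfolding ray_def by (rule nn_integral_cmult[symmetric]) measurable
    also have "\<dots> = (\<integral>\<^sup>+r. ?\<kappa> * ennreal (f (r *\<^sub>R y)) * ennreal (r ^ (k - 1)) * indicator {0<..} r \<partial>lborel)"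
      by (intro nn_integral_cong) (auto simp: indicator_def ennreal_mult f_nonneg mult_ac)
    finally show ?thesis .
  qed
  have "emeasure (lebesgue_Rn k) B = (\<integral>\<^sup>+y. indicator B y \<partial>lebesgue_Rn k)" by simp
  also have "\<dots> = of_nat k * (\<integral>\<^sup>+y. (\<integral>\<^sup>+r. indicator B (r *\<^sub>R dirn k y) * ennreal (r ^ (k - 1)) * indicator {0<..} r \<partial>lborel)
      * indicator (unit_ball k) y \<partial>lebesgue_Rn k)"
    by (rule nn_integral_polar[OF k]) measurable
  also have "\<dots> \<le> of_nat k * (\<integral>\<^sup>+y. (\<integral>\<^sup>+r. ?\<kappa> * ennreal (f (r *\<^sub>R dirn k y)) * ennreal (r ^ (k - 1)) * indicator {0<..} r \<partial>lborel)
      * indicator (unit_ball k) y \<partial>lebesgue_Rn k)"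
    unfolding ray[symmetric] by (intro mult_left_mono nn_integral_mono mult_right_mono inner D) auto
  also have "\<dots> = (\<integral>\<^sup>+y. ?\<kappa> * ennreal (f y) \<partial>lebesgue_Rn k)"
    by (rule nn_integral_polar[OF k, symmetric]) measurable
  also have "\<dots> = ?\<kappa> * (\<integral>\<^sup>+y. ennreal (f y) \<partial>lebesgue_Rn k)"
    by (rule nn_integral_cmult) measurable
  finally show ?thesis .
qed

end

section \<open>Orthonormal bases\<close>

lemma orthonormal_independent:
  assumes on: "orthonormal n m u"
  shows "independent (u ` {..<m})" "inj_on u {..<m}"
proof -
  have ipu: "ip n (u i) (u j) = of_bool (i = j)" if "i < m" "j < m" for i j
    using on that by (simp add: orthonormal_def)
  show inj: "inj_on u {..<m}"
  proof (rule inj_onI)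
    fix i j assume "i \<in> {..<m}" "j \<in> {..<m}" "u i = u j"
    then show "i = j" using ipu[of i i] ipu[of i j] by (auto split: if_splits)
  qed
  show "independent (u ` {..<m})"
    unfolding independent_explicit_module
  proof (intro allI impI)
    fix t c v assume t: "finite t" "t \<subseteq> u ` {..<m}" "(\<Sum>v\<in>t. c v *\<^sub>R v) = 0" "v \<in> t"
    have "ip n w v = of_bool (w = v)" if w: "w \<in> t" for w
    proof -
      obtain i j where "w = u i" "v = u j" "i < m" "j < m" using w t(2,4) by blast
      then show ?thesis using ipu[of i j] inj by (auto dest: inj_onD)
    qed
    then have "(\<Sum>w\<in>t. c w * ip n w v) = (\<Sum>w\<in>t. if w = v then c w else 0)"
      by (intro sum.cong) auto
    moreover have "(\<Sum>w\<in>t. c w * ip n w v) = ip n (\<Sum>w\<in>t. c w *\<^sub>R w) v"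
      by (simp add: ip_sum ip_lin)
    ultimately show "c v = 0" using t by simp
  qed
qed

text \<open>One Gram-Schmidt step: subtract the projection of a vector outside the span, then
  normalise.\<close>

lemma orthonormal_extend:
  assumes on: "orthonormal n j u" and V: "subspace V" "V \<subseteq> Rn n" "\<And>i. i < j \<Longrightarrow> u i \<in> V"
    and ns: "\<not> V \<subseteq> lmap j u ` Rn j"
  obtains a where "a \<in> V" "orthonormal n (Suc j) (u(j := a))"
proof -
  obtain b where b: "b \<in> V" "b \<notin> lmap j u ` Rn j" using ns by blast
  define a' where "a' = b - lmap j u (coords n j u b)"
  have lV: "lmap j u x \<in> V" for x
    unfolding lmap_def by (intro subspace_sum subspace_scale V) auto
  have a'V: "a' \<in> V" unfolding a'_def using b lV V(1) by (intro subspace_diff)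
  have "a' \<noteq> 0" using b coords_Rn[of n j u b] by (auto simp: a'_def)
  then have na: "nrm n a' > 0" using nrm_pos[of a' n] a'V V by auto
  have orth: "ip n a' (u i) = 0" if "i < j" for i
    using that by (simp add: a'_def ip_lin orthonormal_ip_left[OF on that]) (simp add: coords_def cutoff_def)
  define a where "a = (1 / nrm n a') *\<^sub>R a'"
  have aV: "a \<in> V" unfolding a_def using a'V V(1) by (rule subspace_scale[rotated])
  have "ip n a' a' = (nrm n a')\<^sup>2" by (simp add: nrm_pow2)
  then have aa: "ip n a a = 1" using na by (simp add: a_def ip_lin power2_eq_square)
  have au: "ip n a (u i) = 0" "ip n (u i) a = 0" if "i < j" for i
    using orth[OF that] by (auto simp: a_def ip_lin ip_sym[of n "u i"])
  have "orthonormal n (Suc j) (u(j := a))"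
    using on aV V(2) aa au by (auto simp: orthonormal_def less_Suc_eq)
  then show thesis using aV that by blast
qed

lemma span_image_lmap: "lmap j u ` Rn j \<subseteq> span (u ` {..<j})"
  by (auto simp: lmap_def intro!: span_sum span_scale intro: span_base)

lemma lmap_image_span: "span (u ` {..<j}) \<subseteq> lmap j u ` Rn j"
proof (rule span_minimal)
  show "u ` {..<j} \<subseteq> lmap j u ` Rn j"
    using lmap_evec[of _ j u] evec_Rn[of _ j] by (metis image_eqI image_subsetI lessThan_iff)
  show "subspace (lmap j u ` Rn j)"
    by (rule linear_subspace_image[OF linear_lmap subspace_Rn])
qed

text \<open>Gram-Schmidt from a given orthonormal system; \<open>dim V\<close> bounds the length of
  any orthonormal system in \<open>V\<close>, so the extension must stop, and it stops only when the
  span is all of \<open>V\<close>.\<close>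

lemma orthonormal_complete:
  assumes on: "orthonormal n j u" and V: "subspace V" "V \<subseteq> Rn n" "\<And>i. i < j \<Longrightarrow> u i \<in> V" "dim V = d"
  shows "\<exists>w. orthonormal n d w \<and> (\<forall>i<j. w i = u i) \<and> V = lmap d w ` Rn d" "j \<le> d"
proof -
  \<comment> \<open>The type is infinite-dimensional, so a basis of \<open>V\<close> must first be
    shown finite; this follows from its inclusion in the span of \<open>n\<close> unit
    vectors.\<close>
  have card: "l \<le> d" if o: "orthonormal n l w" and wV: "\<And>i. i < l \<Longrightarrow> w i \<in> V" for l w
  proof -
    obtain S where S: "S \<subseteq> V" "independent S" "V \<subseteq> span S" "card S = dim V" using basis_exists[of V] by blast
    have "Rn n \<subseteq> span (evec ` {..<n})"
      using lmap_evec_image[of n] span_image_lmap[of n evec] by simp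
    then have "S \<subseteq> span (evec ` {..<n})" using S V by blast
    then have "finite S" using independent_span_bound[OF _ S(2)] by blast
    moreover have "w ` {..<l} \<subseteq> span S" using wV S by auto
    ultimately have "card (w ` {..<l}) \<le> card S"
      using independent_span_bound[OF _ orthonormal_independent(1)[OF o]] by blast
    then show ?thesis using S V card_image[OF orthonormal_independent(2)[OF o]] by simp
  qed
  have "\<exists>w. orthonormal n d w \<and> (\<forall>i<j. w i = u i) \<and> (\<forall>i<d. w i \<in> V)"
    using on V(3) card[OF on V(3)]
  proof (induction "d - j" arbitrary: j u)
    case 0
    then have "j = d" by simp
    then show ?case using 0 by blast
  next
    case (Suc l)
    have jd: "j < d" using Suc.hyps(2) by simp
    have "\<not> V \<subseteq> lmap j u ` Rn j"
    proof
      assume "V \<subseteq> lmap j u ` Rn j"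
      then have "V \<subseteq> span (u ` {..<j})" using span_image_lmap by blast
      then have "dim V \<le> card (u ` {..<j})" by (rule dim_le_card) simp
      also have "\<dots> \<le> j" using card_image_le[of "{..<j}" u] by simp
      finally show False using V(4) jd by simp
    qed
    then obtain a where a: "a \<in> V" "orthonormal n (Suc j) (u(j := a))"
      using orthonormal_extend[OF Suc.prems(1) V(1,2) Suc.prems(2)] by blast
    have "\<exists>w. orthonormal n d w \<and> (\<forall>i<Suc j. w i = (u(j := a)) i) \<and> (\<forall>i<d. w i \<in> V)"
    proof (rule Suc.hyps(1)[OF _ a(2)])
      show "l = d - Suc j" "Suc j \<le> d" using Suc.hyps(2) jd by auto
      show "(u(j := a)) i \<in> V" if "i < Suc j" for i
        using that a(1) Suc.prems(2) by (cases "i = j") auto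
    qed
    then show ?case by (auto simp: less_Suc_eq)
  qed
  then obtain w where w: "orthonormal n d w" "\<forall>i<j. w i = u i" "\<forall>i<d. w i \<in> V" by blast
  have "V \<subseteq> lmap d w ` Rn d"
  proof (rule ccontr)
    assume "\<not> ?thesis"
    then obtain a where a: "a \<in> V" "orthonormal n (Suc d) (w(d := a))"
      using orthonormal_extend[OF w(1) V(1,2)] w(3) by blast
    have "Suc d \<le> d" by (rule card[OF a(2)]) (use a w in \<open>auto simp: less_Suc_eq\<close>)
    then show False by simp
  qed
  moreover have "lmap d w ` Rn d \<subseteq> V"
    unfolding lmap_def using w(3) by (auto intro!: subspace_sum subspace_scale V)
  ultimately show "\<exists>w. orthonormal n d w \<and> (\<forall>i<j. w i = u i) \<and> V = lmap d w ` Rn d"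
    using w by (intro exI[of _ w]) auto
  show "j \<le> d" by (rule card[OF on V(3)])
qed

lemma dim_Rn: "dim (Rn n) = n"
proof -
  have on: "orthonormal n n evec" by (rule orthonormal_evec)
  have "Rn n = span (evec ` {..<n})"
    using lmap_evec_image[of n] span_image_lmap[of n evec] lmap_image_span[of evec n] by auto
  then have "dim (Rn n) = card (evec ` {..<n})"
    using orthonormal_independent(1)[OF on] by (simp add: dim_eq_card_independent)
  then show ?thesis using card_image[OF orthonormal_independent(2)[OF on]] by simp
qed

text \<open>Coordinates in which \<open>E\<close> consists of the first \<open>m\<close> axes and
  Lebesgue measure is unchanged, so that sections parallel to \<open>E\<close> become inner
  integrals of \<open>nn_integral_glue\<close>.\<close>

lemma adapted_basis:
  assumes E: "E \<in> grassmannian n m"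
  obtains u where "orthonormal n n u" "orthonormal n m u" "E = lmap m u ` Rn m" "m \<le> n"
    "bij_betw (lmap n u) (Rn n) (Rn n)"
proof -
  have E': "subspace E" "E \<subseteq> Rn n" "dim E = m" using E by (auto simp: grassmannian_def)
  have "orthonormal n 0 evec" by (simp add: orthonormal_def)
  then obtain w where w: "orthonormal n m w" "E = lmap m w ` Rn m"
    using orthonormal_complete(1)[of n 0 evec E m] E' by auto
  have wR: "w i \<in> Rn n" if "i < m" for i using w(1) that by (simp add: orthonormal_def)
  obtain u where u: "orthonormal n n u" "\<And>i. i < m \<Longrightarrow> u i = w i" "Rn n = lmap n u ` Rn n"
    using orthonormal_complete(1)[OF w(1) subspace_Rn order_refl wR dim_Rn] by auto
  have mn: "m \<le> n" by (rule orthonormal_complete(2)[OF w(1) subspace_Rn order_refl wR dim_Rn])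
  have "lmap m u = lmap m w" unfolding lmap_def using u(2) by (intro ext sum.cong) auto
  then have "E = lmap m u ` Rn m" using w by simp
  moreover have "orthonormal n m u" using w(1) u(2) by (simp add: orthonormal_def)
  moreover have "bij_betw (lmap n u) (Rn n) (Rn n)"
    unfolding bij_betw_def
  proof
    show "inj_on (lmap n u) (Rn n)"
      using coords_lmap[OF u(1)] by (intro inj_on_inverseI[where g = "coords n n u"])
  qed (use u(3) in simp)
  ultimately show thesis using that u(1) mn by simp
qed

section \<open>Convex bodies and radial functions\<close>

text \<open>Averaging a ball around an interior point with its mirror image gives a ball around the
  origin.\<close>

lemma sym_convex_body_ball:
  assumes K: "sym_convex_body n K"
  shows "\<exists>r>0. \<forall>x\<in>Rn n. nrm n x \<le> r \<longrightarrow> x \<in> K"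
proof -
  have K': "K \<subseteq> Rn n" "convex K" "uminus ` K = K" using K by (auto simp: sym_convex_body_def)
  have "top_of_set (Rn n) interior_of K \<noteq> {}" using K by (simp add: sym_convex_body_def)
  then obtain T x0 where T: "openin (top_of_set (Rn n)) T" "x0 \<in> T" "T \<subseteq> K"
    unfolding interior_of_def by blast
  then obtain U where U: "open U" "T = Rn n \<inter> U" by (auto simp: openin_open)
  have x0: "x0 \<in> Rn n" "x0 \<in> U" using T U by auto
  obtain e where e: "e > 0" "nball n x0 e \<inter> Rn n \<subseteq> U" using open_contains_nball[OF U(1) x0(2,1)] .
  have near: "x0 + z \<in> K" if "z \<in> Rn n" "nrm n z < e" for z
  proof -
    have "x0 + z \<in> nball n x0 e \<inter> Rn n" using that x0 by (simp add: nball_def)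
    then show ?thesis using e U T that x0 by blast
  qed
  show ?thesis
  proof (intro exI[of _ "e / 2"] conjI ballI impI)
    show "e / 2 > 0" using e by simp
    fix z assume z: "z \<in> Rn n" "nrm n z \<le> e / 2"
    then have ze: "nrm n z < e" using e by simp
    have "x0 + - z \<in> K" by (rule near) (use z ze in auto)
    then have "- (x0 + - z) \<in> uminus ` K" by blast
    then have "- (x0 + - z) \<in> K" using K'(3) by simp
    then have "(1 / 2) *\<^sub>R (x0 + z) + (1 / 2) *\<^sub>R (- (x0 + - z)) \<in> K"
      using near[OF z(1) ze] K'(2) by (intro convexD) auto
    moreover have "(1 / 2) *\<^sub>R (x0 + z) + (1 / 2) *\<^sub>R (- (x0 + - z)) = z"
      by (rule ext) (simp add: field_simps)
    ultimately show "z \<in> K" by (simp only:)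
  qed
qed

text \<open>Compactness makes the set of admissible \<open>r\<close> closed and bounded, and 0
  belongs to it; so the greatest element exists and the definition of \<open>radial\<close> is
  meaningful.\<close>

lemma radial_props:
  assumes L: "compact L" "0 \<in> L" and th: "nrm n \<theta> = 1"
  shows "0 \<le> radial L \<theta>" "radial L \<theta> *\<^sub>R \<theta> \<in> L" "\<And>r. 0 \<le> r \<Longrightarrow> r *\<^sub>R \<theta> \<in> L \<Longrightarrow> r \<le> radial L \<theta>"
proof -
  obtain R where R: "R > 0" "\<And>x. x \<in> L \<Longrightarrow> nrm n x \<le> R" using compact_nrm_bounded[OF L(1)] by metis
  let ?X = "{r. 0 \<le> r \<and> r *\<^sub>R \<theta> \<in> L}"
  have XR: "r \<le> R" if "r \<in> ?X" for r using that R(2)[of "r *\<^sub>R \<theta>"] th by (simp add: nrm_scale)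
  have bdd: "bdd_above ?X" using XR by (intro bdd_aboveI)
  have "0 \<in> ?X" using L(2) by simp
  have "continuous_on UNIV (\<lambda>r. r *\<^sub>R \<theta>)"
    by (intro continuous_on_coordinatewise_then_product) (auto intro!: continuous_intros)
  moreover have "closed L" using L(1) by (rule compact_imp_closed)
  ultimately have "closed ((\<lambda>r. r *\<^sub>R \<theta>) -` L)" by (metis closed_vimage)
  then have "closed ({0..} \<inter> (\<lambda>r. r *\<^sub>R \<theta>) -` L)" by (intro closed_Int) auto
  moreover have "{0..} \<inter> (\<lambda>r. r *\<^sub>R \<theta>) -` L = ?X" by auto
  ultimately have "closed ?X" by (simp only:)
  from closed_contains_Sup[OF _ bdd this] have "Sup ?X \<in> ?X" using \<open>0 \<in> ?X\<close> by blast
  then have "radial L \<theta> = Sup ?X"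
    unfolding radial_def by (intro Greatest_equality) (auto intro!: cSup_upper bdd)
  then show "0 \<le> radial L \<theta>" "radial L \<theta> *\<^sub>R \<theta> \<in> L" "\<And>r. 0 \<le> r \<Longrightarrow> r *\<^sub>R \<theta> \<in> L \<Longrightarrow> r \<le> radial L \<theta>"
    using \<open>Sup ?X \<in> ?X\<close> by (auto intro!: cSup_upper bdd)
qed

lemma radial_le:
  assumes "compact L" "0 \<in> L" "nrm n \<theta> = 1" "\<And>x. x \<in> L \<Longrightarrow> nrm n x \<le> R"
  shows "radial L \<theta> \<le> R"
  using assms(4)[OF radial_props(2)[OF assms(1-3)]] radial_props(1)[OF assms(1-3)] assms(3)
  by (simp add: nrm_scale)

lemma radial_mono:
  assumes "compact L" "compact K" "0 \<in> K" "K \<subseteq> L" "nrm n \<theta> = 1"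
  shows "radial K \<theta> \<le> radial L \<theta>"
  using radial_props[OF assms(2,3,5)] radial_props(3)[OF assms(1) _ assms(5)] assms(3,4) by blast

text \<open>\<open>nrm\<close> is continuous for the product topology, so a Lipschitz bound in the
  Euclidean norm is enough.\<close>

lemma continuous_on_nrm_lipschitz:
  fixes g :: "(nat \<Rightarrow> real) \<Rightarrow> real"
  assumes "\<And>x y. x \<in> S \<Longrightarrow> y \<in> S \<Longrightarrow> \<bar>g y - g x\<bar> \<le> C * nrm n (y - x)"
  shows "continuous_on S g"
  unfolding continuous_on_def
proof
  fix x assume x: "x \<in> S"
  have "((\<lambda>y. nrm n (y - x)) \<longlongrightarrow> nrm n (x - x)) (at x within S)"
    using continuous_on_nrm[where S = S and n = n and y = x] x by (auto simp: continuous_on_def)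
  then have "((\<lambda>y. C * nrm n (y - x)) \<longlongrightarrow> C * 0) (at x within S)"
    by (intro tendsto_mult tendsto_const) simp
  then have "((\<lambda>y. C * nrm n (y - x)) \<longlongrightarrow> 0) (at x within S)" by simp
  then have "((\<lambda>y. g y - g x) \<longlongrightarrow> 0) (at x within S)"
    by (rule Lim_null_comparison[rotated])
      (use assms x in \<open>auto simp: eventually_at_filter\<close>)
  then show "(g \<longlongrightarrow> g x) (at x within S)" by (rule LIM_zero_cancel)
qed

context
  fixes n K assumes K: "sym_convex_body n K"
begin

lemma sym_convex_body_props: "K \<subseteq> Rn n" "compact K" "convex K" "uminus ` K = K" "K \<in> sets borel"
  using K by (auto simp: sym_convex_body_def borel_compact)

lemma sym_convex_body_zero: "0 \<in> K"
proof -
  obtain r where "r > 0" "\<forall>x\<in>Rn n. nrm n x \<le> r \<longrightarrow> x \<in> K" using sym_convex_body_ball[OF K] by blast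
  then show ?thesis by (auto dest!: bspec[of _ _ 0])
qed

lemma sym_convex_body_radial_iff:
  assumes "nrm n \<theta> = 1" "r \<ge> 0"
  shows "r *\<^sub>R \<theta> \<in> K \<longleftrightarrow> r \<le> radial K \<theta>"
proof
  assume "r *\<^sub>R \<theta> \<in> K"
  then show "r \<le> radial K \<theta>" using radial_props(3)[OF sym_convex_body_props(2) sym_convex_body_zero assms(1)] assms(2) by blast
next
  assume le: "r \<le> radial K \<theta>"
  note p = radial_props[OF sym_convex_body_props(2) sym_convex_body_zero assms(1)]
  show "r *\<^sub>R \<theta> \<in> K"
  proof (cases "r = 0")
    case False
    then have rp: "radial K \<theta> > 0" using le assms(2) by linarith
    let ?t = "r / radial K \<theta>"
    have "(1 - ?t) *\<^sub>R 0 + ?t *\<^sub>R (radial K \<theta> *\<^sub>R \<theta>) \<in> K"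
      by (rule convexD[OF sym_convex_body_props(3) sym_convex_body_zero p(2)]) (use rp assms(2) le in auto)
    moreover have "(1 - ?t) *\<^sub>R 0 + ?t *\<^sub>R (radial K \<theta> *\<^sub>R \<theta>) = r *\<^sub>R \<theta>" using rp by simp
    ultimately show ?thesis by (simp only:)
  qed (use sym_convex_body_zero in simp)
qed

lemma radial_lower_bound:
  "\<exists>r>0. (\<forall>\<theta>\<in>unit_sphere n (Rn n). r \<le> radial K \<theta>) \<and> (\<forall>x\<in>Rn n. nrm n x \<le> r \<longrightarrow> x \<in> K)"
proof -
  obtain r where r: "r > 0" "\<And>x. x \<in> Rn n \<Longrightarrow> nrm n x \<le> r \<Longrightarrow> x \<in> K" using sym_convex_body_ball[OF K] by blast
  have "r \<le> radial K \<theta>" if "\<theta> \<in> unit_sphere n (Rn n)" for \<theta>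
  proof -
    have "r *\<^sub>R \<theta> \<in> K" by (rule r(2)) (use that r(1) in \<open>auto simp: unit_sphere_def nrm_scale\<close>)
    then show ?thesis using sym_convex_body_radial_iff[of \<theta> r] that r(1) by (simp add: unit_sphere_def)
  qed
  then show ?thesis using r by blast
qed

text \<open>The reciprocal of the radial function is the gauge of \<open>K\<close>. It is
  subadditive by convexity and at most |x| / r by the inscribed ball, hence Lipschitz on the
  sphere.\<close>

lemma continuous_on_radial: "continuous_on (unit_sphere n (Rn n)) (radial K)"
proof -
  let ?S = "unit_sphere n (Rn n)"
  obtain r where r: "r > 0" "\<And>\<theta>. \<theta> \<in> ?S \<Longrightarrow> r \<le> radial K \<theta>"
    "\<And>x. x \<in> Rn n \<Longrightarrow> nrm n x \<le> r \<Longrightarrow> x \<in> K" using radial_lower_bound by blast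
  have le: "1 / radial K y \<le> 1 / radial K x + 1 / r * nrm n (y - x)" if x: "x \<in> ?S" and y: "y \<in> ?S" for x y
  proof (cases "y = x")
    case False
    have xy: "x \<in> Rn n" "y \<in> Rn n" "nrm n x = 1" "nrm n y = 1" using x y by (auto simp: unit_sphere_def)
    have d: "nrm n (y - x) > 0" using xy False by (intro nrm_pos) auto
    have px: "radial K x > 0" "radial K y > 0" using r(1) r(2)[OF x] r(2)[OF y] by auto
    \<comment> \<open>\<open>p\<close> is the gauge of \<open>x\<close> and \<open>t\<close> bounds
      the gauge of \<open>y - x\<close>; \<open>a\<close> and \<open>b\<close> are the corresponding
      points of \<open>K\<close>, whose combination with weights proportional to \<open>p\<close>
      and \<open>t\<close> is a multiple of \<open>y\<close>.\<close>
    define p where "p = 1 / radial K x"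
    define t where "t = nrm n (y - x) / r"
    define a where "a = radial K x *\<^sub>R x"
    define b where "b = (1 / t) *\<^sub>R (y - x)"
    have pt: "p > 0" "t > 0" using px d r(1) by (auto simp: p_def t_def)
    have aK: "a \<in> K" unfolding a_def by (rule radial_props(2)[OF sym_convex_body_props(2) sym_convex_body_zero xy(3)])
    have bK: "b \<in> K"
    proof (rule r(3))
      show "b \<in> Rn n" using xy by (simp add: b_def)
      have "nrm n b = r" using pt d r(1) by (simp add: b_def nrm_scale t_def)
      then show "nrm n b \<le> r" by simp
    qed
    have "(p / (p + t)) *\<^sub>R a + (t / (p + t)) *\<^sub>R b \<in> K"
      by (rule convexD[OF sym_convex_body_props(3) aK bK]) (use pt in \<open>auto simp: add_divide_distrib[symmetric]\<close>)
    moreover have "(p / (p + t)) *\<^sub>R a + (t / (p + t)) *\<^sub>R b = (1 / (p + t)) *\<^sub>R y"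
    proof -
      have "(p / (p + t)) *\<^sub>R a = (1 / (p + t)) *\<^sub>R x" using px by (simp add: a_def p_def)
      moreover have "(t / (p + t)) *\<^sub>R b = (1 / (p + t)) *\<^sub>R (y - x)" using pt by (simp add: b_def)
      moreover have "(1 / (p + t)) *\<^sub>R x + (1 / (p + t)) *\<^sub>R (y - x) = (1 / (p + t)) *\<^sub>R y"
        by (simp only: scaleR_right_distrib[symmetric] add_diff_cancel_left') simp
      ultimately show ?thesis by (simp only:)
    qed
    ultimately have "(1 / (p + t)) *\<^sub>R y \<in> K" by (simp only:)
    then have "1 / (p + t) \<le> radial K y" using sym_convex_body_radial_iff[of y "1 / (p + t)"] xy pt by simp
    then have "1 / radial K y \<le> p + t" using px pt by (simp add: field_simps)
    then show ?thesis by (simp add: p_def t_def)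
  qed simp
  have "continuous_on ?S (\<lambda>\<theta>. 1 / radial K \<theta>)"
  proof (rule continuous_on_nrm_lipschitz[where C = "1 / r" and n = n])
    fix x y assume xy: "x \<in> ?S" "y \<in> ?S"
    show "\<bar>1 / radial K y - 1 / radial K x\<bar> \<le> 1 / r * nrm n (y - x)"
      using le[OF xy] le[OF xy(2,1)] unfolding nrm_commute[of x y n] by linarith
  qed
  moreover have "\<forall>\<theta>\<in>?S. 1 / radial K \<theta> \<noteq> 0" using r(1,2) by force
  ultimately have "continuous_on ?S (\<lambda>\<theta>. 1 / (1 / radial K \<theta>))"
    by (rule continuous_on_divide[OF continuous_on_const])
  then show ?thesis by simp
qed

lemma measurable_radial:
  assumes "orthonormal n m u"
  shows "radial K \<in> borel_measurable (restrict_space borel (unit_sphere n (lmap m u ` Rn m)))"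
proof (rule borel_measurable_continuous_on_restrict)
  show "continuous_on (unit_sphere n (lmap m u ` Rn m)) (radial K)"
    by (rule continuous_on_subset[OF continuous_on_radial]) (use orthonormal_lmap_Rn[OF assms] in \<open>auto simp: unit_sphere_def\<close>)
qed

text \<open>Polar coordinates inside the subspace, where \<open>sph\<close> is by construction the
  distribution of the direction. For m = n it also expresses the volume of \<open>K\<close>
  itself.\<close>

lemma section_radial:
  assumes on: "orthonormal n m u" and m: "m \<ge> 1"
  shows "(\<integral>\<^sup>+z. indicator K (lmap m u z) \<partial>lebesgue_Rn m) =
    ennreal (unit_ball_vol (real m) * (LINT \<theta>|sphere_measure n (lmap m u ` Rn m). radial K \<theta> ^ m))"
proof -
  let ?\<omega> = "unit_ball_vol (real m)"
  have KB [measurable]: "K \<in> sets borel" by (rule sym_convex_body_props)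
  let ?g = "\<lambda>y. ennreal (radial K (lmap m u (dirn m y)) ^ m)"
  have nrmd: "nrm n (lmap m u (dirn m y)) = 1" for y using orthonormal_nrm[OF on] dirn_sphere[OF m] by simp
  have rnn: "radial K (lmap m u (dirn m y)) \<ge> 0" for y by (rule radial_props(1)[OF sym_convex_body_props(2) sym_convex_body_zero nrmd])
  have [measurable]: "(\<lambda>y. radial K (lmap m u (dirn m y))) \<in> borel_measurable borel"
    using measurable_compose[OF measurable_sph[OF on m] measurable_radial[OF on]] .
  have inner: "(\<integral>\<^sup>+r. indicator K (lmap m u (r *\<^sub>R dirn m y)) * ennreal (r ^ (m - 1)) * indicator {0<..} r \<partial>lborel) =
    ennreal (1 / real m) * ?g y" for y
  proof -
    let ?\<rho> = "radial K (lmap m u (dirn m y))"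
    have "(\<integral>\<^sup>+r. indicator K (lmap m u (r *\<^sub>R dirn m y)) * ennreal (r ^ (m - 1)) * indicator {0<..} r \<partial>lborel) =
      (\<integral>\<^sup>+r. ennreal (r ^ (m - 1)) * indicator {0<..?\<rho>} r \<partial>lborel)"
    proof (rule nn_integral_cong)
      fix r :: real
      have "lmap m u (r *\<^sub>R dirn m y) \<in> K \<longleftrightarrow> r \<le> ?\<rho>" if "r > 0"
        using sym_convex_body_radial_iff[OF nrmd, of r y] that by (simp add: lmap_lin)
      then show "indicator K (lmap m u (r *\<^sub>R dirn m y)) * ennreal (r ^ (m - 1)) * indicator {0<..} r =
        ennreal (r ^ (m - 1)) * indicator {0<..?\<rho>} r" by (auto simp: indicator_def)
    qed
    also have "\<dots> = ennreal (?\<rho> ^ Suc (m - 1) / real (Suc (m - 1)))" by (rule nn_integral_power_Ioc[OF rnn])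
    also have "Suc (m - 1) = m" using m by simp
    also have "ennreal (?\<rho> ^ m / real m) = ennreal (1 / real m) * ?g y"
      using rnn[of y] by (subst ennreal_mult[symmetric]) auto
    finally show ?thesis .
  qed
  have "(\<integral>\<^sup>+z. indicator K (lmap m u z) \<partial>lebesgue_Rn m) = of_nat m *
    (\<integral>\<^sup>+y. ennreal (1 / real m) * ?g y * indicator (unit_ball m) y \<partial>lebesgue_Rn m)"
    by (subst nn_integral_polar[OF m]) (simp_all only: inner, measurable)
  also have "\<dots> = (of_nat m * ennreal (1 / real m)) * (\<integral>\<^sup>+y. ?g y * indicator (unit_ball m) y \<partial>lebesgue_Rn m)"
    by (simp add: mult.assoc nn_integral_cmult)
  also have "of_nat m * ennreal (1 / real m) = 1"
    using m by (simp add: ennreal_of_nat_eq_real_of_nat ennreal_mult[symmetric])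
  finally have X: "(\<integral>\<^sup>+z. indicator K (lmap m u z) \<partial>lebesgue_Rn m) = (\<integral>\<^sup>+y. ?g y * indicator (unit_ball m) y \<partial>lebesgue_Rn m)"
    by simp
  define Y where "Y = (\<integral>\<^sup>+z. indicator K (lmap m u z) \<partial>lebesgue_Rn m)"
  have Yfin: "Y < \<infinity>"
  proof -
    obtain R where R: "R > 0" "\<And>x. x \<in> K \<Longrightarrow> nrm n x \<le> R" using compact_nrm_bounded[OF sym_convex_body_props(2)] by metis
    have "Y \<le> (\<integral>\<^sup>+z. indicator {z. nrm m z \<le> R} z \<partial>lebesgue_Rn m)"
      unfolding Y_def by (rule nn_integral_mono) (use R(2) orthonormal_nrm[OF on] in \<open>force simp: indicator_def\<close>)
    also have "\<dots> < \<infinity>" using emeasure_nrm_le[OF R(1), of m] by simp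
    finally show ?thesis .
  qed
  have "(LINT \<theta>|sphere_measure n (lmap m u ` Rn m). radial K \<theta> ^ m) = (LINT \<theta>|sph n m u. radial K \<theta> ^ m)"
    by (simp only: sphere_measure_eq[OF on m])
  also have "\<dots> = enn2real (\<integral>\<^sup>+\<theta>. ennreal (radial K \<theta> ^ m) \<partial>sph n m u)"
  proof (rule integral_eq_nn_integral)
    have s: "sets (sph n m u) = sets (restrict_space borel (unit_sphere n (lmap m u ` Rn m)))" by (simp add: sph_def)
    have sp: "space (sph n m u) = unit_sphere n (lmap m u ` Rn m)"
      by (simp add: sph_def space_restrict_space)
    show "(\<lambda>\<theta>. radial K \<theta> ^ m) \<in> borel_measurable (sph n m u)"
      unfolding measurable_cong_sets[OF s refl] using measurable_radial[OF on] by measurable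
    show "AE \<theta> in sph n m u. 0 \<le> radial K \<theta> ^ m"
    proof (rule AE_I2)
      fix \<theta> assume "\<theta> \<in> space (sph n m u)"
      then have "nrm n \<theta> = 1" by (simp add: sp unit_sphere_def)
      then show "0 \<le> radial K \<theta> ^ m" using radial_props(1)[OF sym_convex_body_props(2) sym_convex_body_zero] by simp
    qed
  qed
  also have "(\<integral>\<^sup>+\<theta>. ennreal (radial K \<theta> ^ m) \<partial>sph n m u) = Y / ennreal ?\<omega>"
    unfolding Y_def X by (rule nn_integral_sph[OF on m]) (use measurable_radial[OF on] in measurable)
  finally have L: "(LINT \<theta>|sphere_measure n (lmap m u ` Rn m). radial K \<theta> ^ m) = enn2real (Y / ennreal ?\<omega>)" .
  obtain y where y: "Y = ennreal y" "y \<ge> 0" using Yfin by (cases Y) auto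
  have \<omega>: "?\<omega> > 0" by simp
  have "enn2real (Y / ennreal ?\<omega>) = y / ?\<omega>" using y \<omega> by (simp add: divide_ennreal)
  then show ?thesis using L y \<omega> unfolding Y_def[symmetric] by simp
qed

end

section \<open>Sections of isotropic bodies\<close>

text \<open>The powers of pi cancel, and what remains is log-convexity of Gamma between 1, where it
  equals 1, and n/2 + 1.\<close>

lemma unit_ball_vol_power_le:
  assumes "1 \<le> m" "m \<le> n"
  shows "unit_ball_vol (real n) ^ m \<le> unit_ball_vol (real m) ^ n"
proof -
  let ?g = "\<lambda>j::nat. real j / 2 + 1"
  have Gp: "Gamma (?g j) > 0" for j by (intro Gamma_real_pos) simp
  define t where "t = real m / real n"
  have t: "0 \<le> t" "t \<le> 1" using assms by (auto simp: t_def)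
  have "(ln \<circ> Gamma) ((1 - t) *\<^sub>R 1 + t *\<^sub>R ?g n) \<le> (1 - t) * (ln \<circ> Gamma) 1 + t * (ln \<circ> Gamma) (?g n)"
    by (rule convex_onD[OF log_convex_Gamma_real]) (use t in auto)
  moreover have "(1 - t) *\<^sub>R 1 + t *\<^sub>R ?g n = ?g m"
    using assms by (simp add: t_def field_simps)
  ultimately have "(ln \<circ> Gamma) (?g m) \<le> (1 - t) * (ln \<circ> Gamma) 1 + t * (ln \<circ> Gamma) (?g n)"
    by (simp only:)
  then have "ln (Gamma (?g m)) \<le> t * ln (Gamma (?g n))" by simp
  then have "real n * ln (Gamma (?g m)) \<le> real m * ln (Gamma (?g n))"
    using assms by (simp add: t_def field_simps)
  then have "ln (Gamma (?g m) ^ n) \<le> ln (Gamma (?g n) ^ m)"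
    using Gp by (simp add: ln_realpow)
  then have G: "Gamma (?g m) ^ n \<le> Gamma (?g n) ^ m"
    using Gp by (subst (asm) ln_le_cancel_iff) auto
  have pw: "(pi powr (real n / 2)) ^ m = (pi powr (real m / 2)) ^ n"
    by (simp add: powr_power mult.commute)
  have "unit_ball_vol (real n) ^ m = (pi powr (real m / 2)) ^ n / Gamma (?g n) ^ m"
    by (simp only: unit_ball_vol_def power_divide pw)
  also have "\<dots> \<le> (pi powr (real m / 2)) ^ n / Gamma (?g m) ^ n"
    using G Gp[of m] Gp[of n] by (intro divide_left_mono mult_pos_pos zero_less_power) auto
  also have "\<dots> = unit_ball_vol (real m) ^ n" by (simp only: unit_ball_vol_def power_divide)
  finally show ?thesis .
qed

section \<open>Parallel sections as a log-concave function\<close>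

lemma nn_integral_uminus:
  assumes g: "g \<in> borel_measurable borel"
  shows "(\<integral>\<^sup>+x. g (- x) \<partial>lebesgue_Rn n) = (\<integral>\<^sup>+x. g x \<partial>lebesgue_Rn n)"
proof -
  let ?u = "\<lambda>i. - evec i"
  have "linear (uminus :: (nat \<Rightarrow> real) \<Rightarrow> nat \<Rightarrow> real)"
    by (rule linearI) simp_all
  then have eq: "lmap n ?u x = - x" if "x \<in> Rn n" for x
    using linear_eq_lmap[OF _ that, of uminus] by simp
  have "(\<integral>\<^sup>+x. g (- x) \<partial>lebesgue_Rn n) = (\<integral>\<^sup>+x. g (lmap n ?u x) \<partial>lebesgue_Rn n)"
    by (rule nn_integral_cong_AE, rule eventually_mono[OF AE_lebesgue_Rn]) (simp only: eq)
  also have "\<dots> = (\<integral>\<^sup>+x. g x \<partial>lebesgue_Rn n)"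
  proof (rule nn_integral_isometry[OF _ _ g])
    have "bij_betw uminus (Rn n) (Rn n)" by (rule bij_betw_byWitness[where f' = uminus]) auto
    then show "bij_betw (lmap n ?u) (Rn n) (Rn n)" by (subst bij_betw_cong[OF eq]) auto
  qed (simp add: eq)
  finally show ?thesis .
qed

lemma nrm_glue_sq: "(nrm (m + k) (glue m z y))\<^sup>2 = (nrm m z)\<^sup>2 + (nrm k y)\<^sup>2"
  by (simp add: nrm_pow2 ip_glue)

lemma nrm_le_nrm_glue: "nrm m z \<le> nrm (m + k) (glue m z y)" "nrm k y \<le> nrm (m + k) (glue m z y)"
  by (rule power2_le_imp_le[OF _ L2_set_nonneg], simp only: nrm_glue_sq, simp)+

lemma nrm_glue_le: "nrm (m + k) (glue m z y) \<le> nrm m z + nrm k y"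
proof (rule power2_le_imp_le)
  show "(nrm (m + k) (glue m z y))\<^sup>2 \<le> (nrm m z + nrm k y)\<^sup>2"
    unfolding nrm_glue_sq by (simp add: power2_sum)
qed simp

lemma lmap_glue_0: "lmap (m + k) u (glue m z 0) = lmap m u z"
  unfolding lmap_def sum_glue by (simp add: glue_def)

text \<open>In the coordinates of an adapted basis, \<open>z\<close> runs along \<open>E\<close> and
  \<open>y\<close> is the position in its orthogonal complement.\<close>

definition slice_fun :: "nat \<Rightarrow> nat \<Rightarrow> (nat \<Rightarrow> nat \<Rightarrow> real) \<Rightarrow> (nat \<Rightarrow> real) set \<Rightarrow> (nat \<Rightarrow> real) \<Rightarrow> real"
  where "slice_fun m k u K y = enn2real (\<integral>\<^sup>+z. indicator K (lmap (m + k) u (glue m z y)) \<partial>lebesgue_Rn m)"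

context
  fixes m k u K
  assumes K: "sym_convex_body (m + k) K" and on: "orthonormal (m + k) (m + k) u"
    and bij: "bij_betw (lmap (m + k) u) (Rn (m + k)) (Rn (m + k))" and k: "k \<ge> 1"
begin

lemma slice_measurable: "(\<lambda>z. indicator K (lmap (m + k) u (glue m z y)) :: ennreal) \<in> borel_measurable borel"
proof -
  have [measurable]: "K \<in> sets borel" by (rule sym_convex_body_props[OF K])
  show ?thesis by measurable
qed

lemma slice_eq: "(\<integral>\<^sup>+z. indicator K (lmap (m + k) u (glue m z y)) \<partial>lebesgue_Rn m) = ennreal (slice_fun m k u K y)"
proof -
  obtain R where R: "R > 0" "\<And>x. x \<in> K \<Longrightarrow> nrm (m + k) x \<le> R" using compact_nrm_bounded[OF sym_convex_body_props(2)[OF K]] by metis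
  have "(\<integral>\<^sup>+z. indicator K (lmap (m + k) u (glue m z y)) \<partial>lebesgue_Rn m) \<le> (\<integral>\<^sup>+z. indicator {z. nrm m z \<le> R} z \<partial>lebesgue_Rn m)"
  proof (rule nn_integral_mono)
    fix z
    have "nrm m z \<le> R" if "lmap (m + k) u (glue m z y) \<in> K"
      using R(2)[OF that] nrm_le_nrm_glue(1)[where m = m and k = k and z = z and y = y] by (simp add: orthonormal_nrm[OF on])
    then show "indicator K (lmap (m + k) u (glue m z y)) \<le> (indicator {z. nrm m z \<le> R} z :: ennreal)"
      by (auto simp: indicator_def)
  qed
  also have "\<dots> < \<infinity>" using emeasure_nrm_le[OF R(1), of m] by simp
  finally show ?thesis by (simp add: slice_fun_def)
qed

text \<open>Convexity of \<open>K\<close> is precisely the Prekopa-Leindler hypothesis for the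
  indicators of the slices; the remaining data of the locale come from a circumscribed and an
  inscribed ball of \<open>K\<close>.\<close>

lemma slice_logconcave: "\<exists>R \<delta> \<epsilon>. logconcave k (slice_fun m k u K) R \<delta> \<epsilon>"
proof -
  let ?f = "slice_fun m k u K"
  let ?n = "m + k"
  let ?i = "\<lambda>y z. indicator K (lmap ?n u (glue m z y)) :: ennreal"
  have [measurable]: "K \<in> sets borel" by (rule sym_convex_body_props[OF K])
  obtain R where R: "R > 0" "\<And>x. x \<in> K \<Longrightarrow> nrm ?n x \<le> R" using compact_nrm_bounded[OF sym_convex_body_props(2)[OF K]] by metis
  obtain r where r: "r > 0" "\<And>x. x \<in> Rn ?n \<Longrightarrow> nrm ?n x \<le> r \<Longrightarrow> x \<in> K" using sym_convex_body_ball[OF K] by blast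
  \<comment> \<open>The volume of an m-dimensional ball of radius r / 2: if \<open>z\<close> and
    \<open>y\<close> both have norm at most r / 2, the glued point has norm at most \<open>r\<close>
    and lies in \<open>K\<close>.\<close>
  define \<epsilon> where "\<epsilon> = unit_ball_vol (real m) * (r / 2) ^ m"
  have "logconcave k ?f R (r / 2) \<epsilon>"
  proof
    show "1 \<le> k" by (rule k)
    show "?f \<in> borel_measurable borel" unfolding slice_fun_def by measurable
    show "?f y \<ge> 0" for y by (simp add: slice_fun_def)
    show "?f (- y) = ?f y" for y
    proof -
      have "lmap ?n u (glue m z (- y)) \<in> K \<longleftrightarrow> lmap ?n u (glue m (- z) y) \<in> K" for z
      proof -
        have "lmap ?n u (glue m z (- y)) = - lmap ?n u (glue m (- z) y)"
          using glue_lin(3)[of m "- z" y] by (simp add: lmap_lin)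
        moreover have "- x \<in> K \<longleftrightarrow> x \<in> K" for x using sym_convex_body_props(4)[OF K] by (metis image_iff minus_minus)
        ultimately show ?thesis by (simp only:)
      qed
      then have "(\<integral>\<^sup>+z. ?i (- y) z \<partial>lebesgue_Rn m) = (\<integral>\<^sup>+z. ?i y (- z) \<partial>lebesgue_Rn m)"
        by (simp only: indicator_def)
      also have "\<dots> = (\<integral>\<^sup>+z. ?i y z \<partial>lebesgue_Rn m)" by (rule nn_integral_uminus) (rule slice_measurable)
      finally show ?thesis by (simp only: slice_fun_def)
    qed
    show "?f x powr (1 - l) * ?f y powr l \<le> ?f ((1 - l) *\<^sub>R x + l *\<^sub>R y)"
      if l: "0 < l" "l < 1" and p: "?f x > 0" "?f y > 0" for x y l
    proof -
      have "PLrel l (\<integral>\<^sup>+z. ?i x z \<partial>lebesgue_Rn m) (\<integral>\<^sup>+z. ?i y z \<partial>lebesgue_Rn m)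
        (\<integral>\<^sup>+z. ?i ((1 - l) *\<^sub>R x + l *\<^sub>R y) z \<partial>lebesgue_Rn m)"
      proof (rule prekopa_leindler[OF _ _ _ l])
        fix z w
        show "PLrel l (?i x z) (?i y w) (?i ((1 - l) *\<^sub>R x + l *\<^sub>R y) ((1 - l) *\<^sub>R z + l *\<^sub>R w))"
          unfolding PLrel_def
        proof (intro allI impI)
          fix s t :: real assume st: "0 < s" "0 < t" "ennreal s \<le> ?i x z" "ennreal t \<le> ?i y w"
          have mem: "lmap ?n u (glue m z x) \<in> K" "lmap ?n u (glue m w y) \<in> K"
          proof -
            show "lmap ?n u (glue m z x) \<in> K"
              using st(1,3) by (cases "lmap ?n u (glue m z x) \<in> K") auto
            show "lmap ?n u (glue m w y) \<in> K"
              using st(2,4) by (cases "lmap ?n u (glue m w y) \<in> K") auto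
          qed
          then have "s \<le> 1" "t \<le> 1" using st by (auto simp flip: ennreal_1)
          then have "s powr (1 - l) * t powr l \<le> 1 * 1"
            using st l by (intro mult_mono powr_le1) auto
          moreover have "lmap ?n u (glue m ((1 - l) *\<^sub>R z + l *\<^sub>R w) ((1 - l) *\<^sub>R x + l *\<^sub>R y)) \<in> K"
          proof -
            have "(1 - l) *\<^sub>R lmap ?n u (glue m z x) + l *\<^sub>R lmap ?n u (glue m w y) \<in> K"
              by (rule convexD[OF sym_convex_body_props(3)[OF K] mem]) (use l in auto)
            then show ?thesis by (simp only: glue_lin lmap_lin)
          qed
          ultimately show "ennreal (s powr (1 - l) * t powr l) \<le> ?i ((1 - l) *\<^sub>R x + l *\<^sub>R y) ((1 - l) *\<^sub>R z + l *\<^sub>R w)"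
            by (simp add: ennreal_le_1)
        qed
      qed (rule slice_measurable)+
      then have "ennreal (?f x powr (1 - l) * ?f y powr l) \<le> ennreal (?f ((1 - l) *\<^sub>R x + l *\<^sub>R y))"
        unfolding slice_eq PLrel_def using p by blast
      then show ?thesis by (subst (asm) ennreal_le_iff) (simp_all add: slice_fun_def)
    qed
    show "nrm k y \<le> R" if "?f y > 0" for y
    proof -
      have "\<exists>z. lmap ?n u (glue m z y) \<in> K"
      proof (rule ccontr)
        assume "\<nexists>z. lmap ?n u (glue m z y) \<in> K"
        then have "?f y = 0" by (simp add: slice_fun_def)
        then show False using that by simp
      qed
      then obtain z where "lmap ?n u (glue m z y) \<in> K" by blast
      then have "nrm ?n (lmap ?n u (glue m z y)) \<le> R" by (rule R(2))
      then have "nrm ?n (glue m z y) \<le> R" by (simp only: orthonormal_nrm[OF on])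
      then show ?thesis using nrm_le_nrm_glue(2)[where m = m and k = k and z = z and y = y] by linarith
    qed
    show "\<epsilon> \<le> ?f y" if y: "nrm k y \<le> r / 2" for y
    proof -
      have "ennreal \<epsilon> = (\<integral>\<^sup>+z. indicator {z. nrm m z \<le> r / 2} z \<partial>lebesgue_Rn m)"
        using emeasure_nrm_le[of "r / 2" m] r(1) by (simp add: \<epsilon>_def)
      also have "\<dots> \<le> (\<integral>\<^sup>+z. ?i y z \<partial>lebesgue_Rn m)"
      proof (rule nn_integral_mono)
        fix z
        have "lmap ?n u (glue m z y) \<in> K" if "nrm m z \<le> r / 2"
        proof (rule r(2))
          show "lmap ?n u (glue m z y) \<in> Rn ?n" by (rule orthonormal_lmap_Rn[OF on])
          show "nrm ?n (lmap ?n u (glue m z y)) \<le> r"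
            using nrm_glue_le[where m = m and k = k and z = z and y = y] that y by (simp add: orthonormal_nrm[OF on])
        qed
        then show "indicator {z. nrm m z \<le> r / 2} z \<le> ?i y z" by (auto simp: indicator_def)
      qed
      finally have "ennreal \<epsilon> \<le> ennreal (?f y)" by (simp only: slice_eq)
      then show ?thesis by (subst (asm) ennreal_le_iff) (simp_all add: slice_fun_def)
    qed
    show "R > 0" "r / 2 > 0" "\<epsilon> > 0" using R r by (auto simp: \<epsilon>_def)
  qed
  then show ?thesis by blast
qed

lemma nn_integral_glue_isometry:
  assumes "g \<in> borel_measurable borel"
  shows "(\<integral>\<^sup>+y. (\<integral>\<^sup>+z. g (lmap (m + k) u (glue m z y)) \<partial>lebesgue_Rn m) \<partial>lebesgue_Rn k) = (\<integral>\<^sup>+x. g x \<partial>lebesgue_Rn (m + k))"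
proof -
  have [measurable]: "g \<in> borel_measurable borel" by fact
  have "(\<integral>\<^sup>+x. g x \<partial>lebesgue_Rn (m + k)) = (\<integral>\<^sup>+x. g (lmap (m + k) u x) \<partial>lebesgue_Rn (m + k))"
    by (rule nn_integral_isometry[OF bij _ assms, symmetric]) (rule orthonormal_nrm[OF on])
  also have "\<dots> = (\<integral>\<^sup>+y. (\<integral>\<^sup>+z. g (lmap (m + k) u (glue m z y)) \<partial>lebesgue_Rn m) \<partial>lebesgue_Rn k)"
    by (rule nn_integral_glue) measurable
  finally show ?thesis by simp
qed

lemma slice_integral: "(\<integral>\<^sup>+y. ennreal (slice_fun m k u K y) \<partial>lebesgue_Rn k) = emeasure (lebesgue_Rn (m + k)) K"
proof -
  have KB: "K \<in> sets borel" by (rule sym_convex_body_props[OF K])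
  then show ?thesis
    unfolding slice_eq[symmetric] by (subst nn_integral_glue_isometry) auto
qed

text \<open>Fubini in the adapted basis: a direction in the complement does not see the
  \<open>z\<close> part of a point.\<close>

lemma slice_moment:
  "(\<integral>\<^sup>+y. ennreal (slice_fun m k u K y * (ip k y \<theta>)\<^sup>2) \<partial>lebesgue_Rn k) = mom (m + k) K (lmap (m + k) u (glue m 0 \<theta>))"
proof -
  have [measurable]: "K \<in> sets borel" by (rule sym_convex_body_props[OF K])
  let ?\<phi> = "lmap (m + k) u (glue m 0 \<theta>)"
  have "ennreal (slice_fun m k u K y * (ip k y \<theta>)\<^sup>2) =
    (\<integral>\<^sup>+z. indicator K (lmap (m + k) u (glue m z y)) * ennreal ((ip (m + k) (lmap (m + k) u (glue m z y)) ?\<phi>)\<^sup>2) \<partial>lebesgue_Rn m)" for y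
  proof -
    have "ennreal (slice_fun m k u K y * (ip k y \<theta>)\<^sup>2) = ennreal (slice_fun m k u K y) * ennreal ((ip k y \<theta>)\<^sup>2)"
      by (rule ennreal_mult) (simp_all add: slice_fun_def)
    also have "\<dots> = (\<integral>\<^sup>+z. indicator K (lmap (m + k) u (glue m z y)) * ennreal ((ip k y \<theta>)\<^sup>2) \<partial>lebesgue_Rn m)"
      unfolding slice_eq[symmetric] by (rule nn_integral_multc[symmetric]) (simp add: slice_measurable)
    also have "(\<lambda>z. indicator K (lmap (m + k) u (glue m z y)) * ennreal ((ip k y \<theta>)\<^sup>2)) =
      (\<lambda>z. indicator K (lmap (m + k) u (glue m z y)) * ennreal ((ip (m + k) (lmap (m + k) u (glue m z y)) ?\<phi>)\<^sup>2))"
      by (simp add: orthonormal_ip[OF on] ip_glue)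
    finally show ?thesis .
  qed
  then have "(\<integral>\<^sup>+y. ennreal (slice_fun m k u K y * (ip k y \<theta>)\<^sup>2) \<partial>lebesgue_Rn k) =
    (\<integral>\<^sup>+y. (\<integral>\<^sup>+z. indicator K (lmap (m + k) u (glue m z y)) * ennreal ((ip (m + k) (lmap (m + k) u (glue m z y)) ?\<phi>)\<^sup>2) \<partial>lebesgue_Rn m) \<partial>lebesgue_Rn k)"
    by (simp only:)
  also have "\<dots> = mom (m + k) K ?\<phi>"
    unfolding mom_def by (rule nn_integral_glue_isometry[where g = "\<lambda>x. indicator K x * ennreal ((ip (m + k) x ?\<phi>)\<^sup>2)"]) measurable
  finally show ?thesis .
qed

text \<open>Collects what is needed of Ball's body of the section function: it inherits the constant
  \<open>I\<close>, and its volume is bounded through the central section \<open>a\<close>, the root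
  in \<open>emeasure_B\<close> being cleared by a power \<open>k + 2\<close>.\<close>

lemma ball_body:
  assumes v: "emeasure (lebesgue_Rn (m + k)) K = ennreal v" "v > 0"
    and I: "I \<ge> 0" "\<And>\<theta>. \<theta> \<in> unit_sphere (m + k) (Rn (m + k)) \<Longrightarrow> (LINT x:K|lebesgue_Rn (m + k). (ip (m + k) x \<theta>)\<^sup>2) = I"
    and f0: "(\<integral>\<^sup>+z. indicator K (lmap m u z) \<partial>lebesgue_Rn m) = ennreal a" "a > 0"
  shows "\<exists>B b. sym_convex_body k B \<and> emeasure (lebesgue_Rn k) B = ennreal b \<and> b > 0 \<and>
    (\<forall>\<theta>\<in>unit_sphere k (Rn k). (LINT x:B|lebesgue_Rn k. (ip k x \<theta>)\<^sup>2) = I) \<and>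
    b ^ (k + 2) * a\<^sup>2 \<le> (6 * exp 2) ^ k * v ^ (k + 2)"
proof -
  let ?f = "slice_fun m k u K"
  obtain R \<delta> \<epsilon> where "logconcave k ?f R \<delta> \<epsilon>" using slice_logconcave by blast
  then interpret L: logconcave k ?f R \<delta> \<epsilon> .
  let ?B = "L.B"
  have Bb: "sym_convex_body k ?B" by (rule L.sym_convex_body_B)
  have a: "?f 0 = a" using f0 slice_eq[of 0] L.f_nonneg[of 0] by (simp add: lmap_glue_0)
  obtain b where b: "emeasure (lebesgue_Rn k) ?B = ennreal b" "b \<ge> 0"
    using compact_emeasure_finite[OF L.compact_B, of k] by (cases "emeasure (lebesgue_Rn k) ?B") auto
  obtain r where r: "r > 0" "\<And>x. x \<in> Rn k \<Longrightarrow> nrm k x \<le> r \<Longrightarrow> x \<in> ?B" using sym_convex_body_ball[OF Bb] by blast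
  have "emeasure (lebesgue_Rn k) {x \<in> Rn k. nrm k x \<le> r} \<le> emeasure (lebesgue_Rn k) ?B"
    by (rule emeasure_mono) (use r(2) in auto)
  then have "ennreal (unit_ball_vol (real k) * r ^ k) \<le> ennreal b" unfolding emeasure_ball[OF r(1)] b(1) .
  then have "unit_ball_vol (real k) * r ^ k \<le> b" using b(2) by simp
  moreover have "unit_ball_vol (real k) * r ^ k > 0" using r(1) by simp
  ultimately have bp: "b > 0" by linarith
  define \<kappa> where "\<kappa> = root (k + 2) ((6 * exp 2) ^ k / a\<^sup>2)"
  have \<kappa>: "\<kappa> \<ge> 0" "\<kappa> ^ (k + 2) = (6 * exp 2) ^ k / a\<^sup>2"
    unfolding \<kappa>_def by (simp, rule real_root_pow_pos2) auto
  have "ennreal b \<le> ennreal \<kappa> * ennreal v"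
    using L.emeasure_B unfolding slice_integral v(1) b(1) a \<kappa>_def .
  then have "b \<le> \<kappa> * v" using \<kappa>(1) v(2) by (simp add: ennreal_mult[symmetric])
  then have "b ^ (k + 2) \<le> (\<kappa> * v) ^ (k + 2)" using b(2) by (rule power_mono)
  also have "\<dots> = (6 * exp 2) ^ k / a\<^sup>2 * v ^ (k + 2)" by (simp only: power_mult_distrib \<kappa>(2))
  finally have "b ^ (k + 2) * a\<^sup>2 \<le> (6 * exp 2) ^ k / a\<^sup>2 * v ^ (k + 2) * a\<^sup>2" by (rule mult_right_mono) simp
  also have "\<dots> = (6 * exp 2) ^ k * v ^ (k + 2)" using f0(2) by simp
  finally have ineq: "b ^ (k + 2) * a\<^sup>2 \<le> (6 * exp 2) ^ k * v ^ (k + 2)" .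
  have mB: "(LINT x:?B|lebesgue_Rn k. (ip k x \<theta>)\<^sup>2) = I" if \<theta>: "\<theta> \<in> unit_sphere k (Rn k)" for \<theta>
  proof -
    let ?\<phi> = "lmap (m + k) u (glue m 0 \<theta>)"
    have n1: "nrm (m + k) ?\<phi> = 1"
    proof -
      have "(nrm (m + k) ?\<phi>)\<^sup>2 = 1" using \<theta> by (simp add: orthonormal_nrm[OF on] nrm_glue_sq unit_sphere_def)
      then show ?thesis using L2_set_nonneg[of ?\<phi> "{..<m + k}"] by (auto simp: power2_eq_1_iff)
    qed
    have "mom k ?B \<theta> = mom (m + k) K ?\<phi>" by (simp only: L.mom_B slice_moment)
    also have "\<dots> = ennreal (I * (nrm (m + k) ?\<phi>)\<^sup>2)"
      by (rule mom_isotropic[OF sym_convex_body_props(2)[OF K] I(2) orthonormal_lmap_Rn[OF on] I(1)])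
    finally have "mom k ?B \<theta> = ennreal I" by (simp add: n1)
    then show ?thesis using I(1) by (simp add: LINT_mom[OF L.B_borel])
  qed
  show ?thesis
    by (intro exI[of _ ?B] exI[of _ b] conjI Bb b(1) bp ineq ballI mB)
qed

end

text \<open>The squared isotropic constants of \<open>K\<close> and of the Ball body are
  \<open>t ^ (n + 2) * I\<close> and \<open>s ^ (k + 2) * I\<close> with the same \<open>I\<close>,
  so only their volumes and that of the central section have to be compared.\<close>

lemma slicing_inequality:
  assumes K: "sym_convex_body n K" and iso: "isotropic n K" and vol: "vol n K = vol n (unit_ball n)"
    and m: "m \<ge> 1" and k: "k \<ge> 1" and n: "n = m + k"
    and E: "E \<in> grassmannian n m" and W: "W > 0"
    and sec: "radon n (\<lambda>\<theta>. radial K \<theta> ^ m) E \<ge> 1 / (2 * W)"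
  shows "\<exists>B. sym_convex_body k B \<and> isotropic_const n K \<le> 2 * sqrt (6 * exp 2) * (isotropic_const k B * root k W)"
proof -
  obtain u where u: "orthonormal n n u" "orthonormal n m u" "E = lmap m u ` Rn m" "bij_betw (lmap n u) (Rn n) (Rn n)"
    using adapted_basis[OF E] by metis
  have n1: "n \<ge> 1" using m n by simp
  have Kc: "compact K" "K \<subseteq> Rn n" using K by (auto simp: sym_convex_body_def)
  define \<omega> where "\<omega> j = unit_ball_vol (real j)" for j
  have \<omega>: "\<omega> j > 0" for j by (simp add: \<omega>_def)
  have v: "emeasure (lebesgue_Rn n) K = ennreal (\<omega> n)"
  proof -
    have "vol n (unit_ball n) = \<omega> n" using \<omega>[of n] by (simp add: vol_def measure_def emeasure_unit_ball \<omega>_def)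
    then show ?thesis
      using vol compact_emeasure_finite[OF Kc(1), of n] by (simp add: vol_def emeasure_eq_ennreal_measure)
  qed
  define I where "I = (LINT x:K|lebesgue_Rn n. (ip n x (evec 0))\<^sup>2)"
  have e0: "evec 0 \<in> unit_sphere n (Rn n)" using n1 by (simp add: unit_sphere_def evec_Rn nrm_evec)
  have I: "(LINT x:K|lebesgue_Rn n. (ip n x \<theta>)\<^sup>2) = I" if "\<theta> \<in> unit_sphere n (Rn n)" for \<theta>
    unfolding I_def using iso that e0 unfolding isotropic_def by blast
  have I0: "I \<ge> 0"
    unfolding I_def LINT_mom[OF sym_convex_body_props(5)[OF K]] by (rule enn2real_nonneg)
  define a where "a = \<omega> m * radon n (\<lambda>\<theta>. radial K \<theta> ^ m) E"
  have f0: "(\<integral>\<^sup>+z. indicator K (lmap m u z) \<partial>lebesgue_Rn m) = ennreal a"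
    using section_radial[OF K u(2) m] by (simp add: a_def \<omega>_def radon_def u(3))
  have a_low: "\<omega> m / (2 * W) \<le> a"
    using mult_left_mono[OF sec, of "\<omega> m"] \<omega>[of m] by (simp add: a_def)
  moreover have "\<omega> m / (2 * W) > 0" using \<omega> W by simp
  ultimately have ap: "a > 0" by linarith
  obtain B b where B: "sym_convex_body k B" "emeasure (lebesgue_Rn k) B = ennreal b" "b > 0"
    "\<And>\<theta>. \<theta> \<in> unit_sphere k (Rn k) \<Longrightarrow> (LINT x:B|lebesgue_Rn k. (ip k x \<theta>)\<^sup>2) = I"
    "b ^ (k + 2) * a\<^sup>2 \<le> (6 * exp 2) ^ k * \<omega> n ^ (k + 2)"
    using ball_body[of m k K u "\<omega> n" I a] K u k v \<omega>[of n] I I0 f0 ap unfolding n by blast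
  define t where "t = root n (1 / \<omega> n)"
  have t: "t > 0" "t ^ n * \<omega> n = 1"
  proof -
    show "t > 0" using n1 \<omega>[of n] by (simp add: t_def)
    have "t ^ n = 1 / \<omega> n" unfolding t_def using n1 \<omega>[of n] by (intro real_root_pow_pos) auto
    then show "t ^ n * \<omega> n = 1" using \<omega>[of n] by simp
  qed
  define s where "s = root k (1 / b)"
  have s: "s > 0" "s ^ k * b = 1"
  proof -
    show "s > 0" using k B(3) by (simp add: s_def)
    have "s ^ k = 1 / b" unfolding s_def using k B(3) by (intro real_root_pow_pos) auto
    then show "s ^ k * b = 1" using B(3) by simp
  qed
  have LK: "isotropic_const n K = sqrt (t ^ (n + 2) * I)"
    by (rule isotropic_const_eq[OF n1 Kc v \<omega> I0 I t])
  have LB: "isotropic_const k B = sqrt (s ^ (k + 2) * I)"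
    by (rule isotropic_const_eq[OF k _ _ B(2,3) I0 B(4) s]) (use B(1) in \<open>auto simp: sym_convex_body_def\<close>)
  define M where "M = root k W"
  have M: "M > 0" "M ^ k = W" using k W by (auto simp: M_def)
  let ?C = "6 * exp 2 :: real"
  have main: "t ^ (n + 2) \<le> 4 * ?C * s ^ (k + 2) * M\<^sup>2"
  proof -
    \<comment> \<open>The ball of unit volume in R^n has radius \<open>t\<close>; by the comparison
      of ball volumes its central m-dimensional sections have volume at least 1. This yields
      \<open>tk\<close>, which relates the two ball volumes without dimensional loss.\<close>
    have tm: "1 \<le> \<omega> m * t ^ m"
    proof -
      have "1 = (\<omega> n) ^ m * (t ^ n) ^ m" using t(2) by (metis mult.commute power_mult_distrib power_one)
      also have "\<dots> \<le> \<omega> m ^ n * (t ^ n) ^ m"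
        unfolding \<omega>_def using m n t(1) by (intro mult_right_mono unit_ball_vol_power_le) auto
      also have "\<dots> = (\<omega> m * t ^ m) ^ n" by (simp only: power_mult_distrib power_mult[symmetric] mult.commute)
      finally have "1 ^ n \<le> (\<omega> m * t ^ m) ^ n" by simp
      then show ?thesis using n1 \<omega>[of m] t(1) power_mono_iff[of 1 "\<omega> m * t ^ m" n] by simp
    qed
    have tk: "t ^ k * \<omega> n \<le> \<omega> m"
    proof -
      have "t ^ k * \<omega> n \<le> (t ^ k * \<omega> n) * (\<omega> m * t ^ m)"
        using mult_left_mono[OF tm, of "t ^ k * \<omega> n"] t(1) \<omega>[of n] by simp
      also have "\<dots> = \<omega> m * (t ^ n * \<omega> n)" by (simp add: n power_add mult_ac)
      finally show ?thesis by (simp add: t(2))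
    qed
    have "t ^ (2 * k) * \<omega> n ^ 2 \<le> \<omega> m ^ 2"
      using power_mono[OF tk, of 2] t(1) \<omega>[of n] by (simp add: power_mult_distrib power_mult[symmetric] mult.commute)
    moreover have "\<omega> m ^ 2 \<le> (2 * W * a)\<^sup>2"
    proof (rule power_mono)
      show "\<omega> m \<le> 2 * W * a" using a_low W by (simp add: field_simps)
    qed (use \<omega>[of m] in simp)
    ultimately have "t ^ (2 * k) * \<omega> n ^ 2 \<le> 4 * W\<^sup>2 * a\<^sup>2" by (simp add: power_mult_distrib)
    then have "t ^ (2 * k) * \<omega> n ^ 2 * b ^ (k + 2) \<le> 4 * W\<^sup>2 * a\<^sup>2 * b ^ (k + 2)"
      using B(3) by (intro mult_right_mono) auto
    also have "\<dots> = 4 * W\<^sup>2 * (b ^ (k + 2) * a\<^sup>2)" by (simp only: mult_ac)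
    also have "\<dots> \<le> 4 * W\<^sup>2 * (?C ^ k * \<omega> n ^ (k + 2))"
      by (intro mult_left_mono B(5)) simp
    \<comment> \<open>The 4 from the section bound is enlarged to a k-th power so that everything is
      a k-th power in the end.\<close>
    also have "\<dots> \<le> 4 ^ k * W\<^sup>2 * (?C ^ k * \<omega> n ^ (k + 2))"
      using k \<omega>[of n] self_le_power[of "4::real" k] by (intro mult_right_mono) auto
    finally have 1: "t ^ (2 * k) * \<omega> n ^ 2 * b ^ (k + 2) \<le> (4 ^ k * ?C ^ k * W\<^sup>2 * \<omega> n ^ k) * \<omega> n ^ 2"
      by (simp only: power_add mult_ac)
    have 2: "t ^ (2 * k) * b ^ (k + 2) \<le> 4 ^ k * ?C ^ k * W\<^sup>2 * \<omega> n ^ k"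
    proof (rule mult_right_le_imp_le)
      show "t ^ (2 * k) * b ^ (k + 2) * \<omega> n ^ 2 \<le> (4 ^ k * ?C ^ k * W\<^sup>2 * \<omega> n ^ k) * \<omega> n ^ 2"
        using 1 by (simp only: mult_ac)
    qed (use \<omega>[of n] in simp)
    have "(t ^ (n + 2)) ^ k = (t ^ (2 * k) * b ^ (k + 2)) * ((s ^ k) ^ (k + 2) * (t ^ n) ^ k)"
    proof -
      have "(s ^ k) ^ (k + 2) * b ^ (k + 2) = 1" using s(2) by (metis power_mult_distrib power_one)
      then have "(t ^ (2 * k) * b ^ (k + 2)) * ((s ^ k) ^ (k + 2) * (t ^ n) ^ k) = t ^ (2 * k) * (t ^ n) ^ k"
        by (simp add: mult_ac)
      also have "\<dots> = (t ^ (n + 2)) ^ k"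
        by (simp only: power_mult[symmetric] power_add[symmetric] add_mult_distrib add.commute)
      finally show ?thesis by simp
    qed
    also have "\<dots> \<le> (4 ^ k * ?C ^ k * W\<^sup>2 * \<omega> n ^ k) * ((s ^ k) ^ (k + 2) * (t ^ n) ^ k)"
      by (intro mult_right_mono 2) (use s(1) t(1) in auto)
    also have "\<dots> = (4 ^ k * ?C ^ k * W\<^sup>2 * (s ^ k) ^ (k + 2)) * (t ^ n * \<omega> n) ^ k"
      by (simp only: power_mult_distrib mult_ac)
    also have "\<dots> = 4 ^ k * ?C ^ k * (M ^ k)\<^sup>2 * (s ^ k) ^ (k + 2)" by (simp add: t(2) M(2))
    also have "\<dots> = (4 * ?C * s ^ (k + 2) * M\<^sup>2) ^ k"
      by (simp only: power_mult_distrib power_mult[symmetric] mult_ac)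
    finally have "(t ^ (n + 2)) ^ k \<le> (4 * ?C * s ^ (k + 2) * M\<^sup>2) ^ k" .
    then show ?thesis using k s(1) M(1) t(1) by (subst (asm) power_mono_iff) auto
  qed
  have "isotropic_const n K \<le> sqrt (4 * ?C * s ^ (k + 2) * M\<^sup>2 * I)"
    unfolding LK by (intro real_sqrt_le_mono mult_right_mono main I0)
  also have "4 * ?C * s ^ (k + 2) * M\<^sup>2 * I = (2 * M)\<^sup>2 * (?C * (s ^ (k + 2) * I))"
    by (simp add: power_mult_distrib)
  also have "sqrt \<dots> = \<bar>2 * M\<bar> * (sqrt ?C * isotropic_const k B)"
    unfolding LB by (simp only: real_sqrt_mult real_sqrt_abs)
  also have "\<dots> = 2 * sqrt ?C * (isotropic_const k B * M)" using M(1) by simp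
  finally show ?thesis using B(1) unfolding M_def by blast
qed

text \<open>Asking only for half of the average leaves room for a contradiction between 1 and 1 / 2,
  so non-strict integral comparison is enough.\<close>

lemma exists_large_section:
  assumes n: "n \<ge> 2" and K: "sym_convex_body n K" and vol: "vol n K = vol n (unit_ball n)"
    and k: "k \<in> {1..n - 1}" and L: "L \<in> BP n k" "K \<subseteq> L"
  obtains E W where "E \<in> grassmannian n (n - k)" "W > 0" "mean_radius n k L = root k W"
    "radon n (\<lambda>\<theta>. radial K \<theta> ^ (n - k)) E \<ge> 1 / (2 * W)"
proof -
  let ?m = "n - k"
  let ?S = "unit_sphere n (Rn n)"
  let ?R = "restrict_space borel ?S"
  let ?\<sigma> = "sphere_measure n (Rn n)"
  have n1: "n \<ge> 1" "?m \<ge> 1" using n k by auto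
  have nk: "?m + k = n" using k by auto
  have im: "lmap n evec ` Rn n = Rn n" by (rule lmap_evec_image)
  have \<sigma>: "?\<sigma> = sph n n evec" using sphere_measure_eq[OF orthonormal_evec n1(1)] by (simp only: im)
  have s\<sigma>: "sets ?\<sigma> = sets ?R" unfolding \<sigma> by (simp add: sph_def im)
  have sp\<sigma>: "space ?\<sigma> = ?S" unfolding \<sigma> by (simp add: sph_def im space_restrict_space)
  have inv: "invariant_on_sphere n E (sphere_measure n E)" if E: "E \<in> grassmannian n ?m" for E
  proof -
    obtain u where u: "orthonormal n ?m u" "E = lmap ?m u ` Rn ?m" using adapted_basis[OF E] by metis
    show ?thesis unfolding u(2) sphere_measure_eq[OF u(1) n1(2)] by (rule invariant_sph[OF u(1) n1(2)])
  qed
  have "prob_space ?\<sigma>" using invariant_sph[OF orthonormal_evec n1(1)] unfolding \<sigma> invariant_on_sphere_def by simp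
  then interpret \<sigma>: prob_space ?\<sigma> .
  have star: "star_body n L" using L(1) by (simp add: BP_def)
  obtain \<mu> where \<mu>: "is_radon_dual n ?m \<mu> (density ?\<sigma> (\<lambda>\<theta>. ennreal (radial L \<theta> ^ k)))"
    using L(1) by (auto simp: BP_def)
  have \<mu>f: "finite_measure \<mu>" and \<mu>s: "sets \<mu> = sets (grassmannian_borel n ?m)"
    and \<mu>i: "\<And>f. continuous_on ?S f \<Longrightarrow>
      (LINT \<theta>|density ?\<sigma> (\<lambda>\<theta>. ennreal (radial L \<theta> ^ k)). f \<theta>) = (LINT E|\<mu>. radon n f E)"
    using \<mu> by (auto simp: is_radon_dual_def)
  interpret \<mu>: finite_measure \<mu> by (rule \<mu>f)
  have sp\<mu>: "space \<mu> = grassmannian n ?m"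
    using sets_eq_imp_space_eq[OF \<mu>s] by (simp add: grassmannian_borel_def space_measure_of_conv)
  have Kc: "compact K" "0 \<in> K" using sym_convex_body_props(2)[OF K] sym_convex_body_zero[OF K] by auto
  have Lc: "compact L" "continuous_on ?S (radial L)" using star by (auto simp: star_body_def)
  have L0: "0 \<in> L" using Kc(2) L(2) by blast
  obtain R where R: "R > 0" "\<And>x. x \<in> L \<Longrightarrow> nrm n x \<le> R" using compact_nrm_bounded[OF Lc(1)] by metis
  have rL: "0 \<le> radial L \<theta>" "radial L \<theta> \<le> R" "0 \<le> radial K \<theta>" "radial K \<theta> \<le> radial L \<theta>" if "\<theta> \<in> ?S" for \<theta>
  proof -
    have th: "nrm n \<theta> = 1" using that by (simp add: unit_sphere_def)
    show "0 \<le> radial L \<theta>" by (rule radial_props(1)[OF Lc(1) L0 th])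
    show "radial L \<theta> \<le> R" by (rule radial_le[OF Lc(1) L0 th R(2)])
    show "0 \<le> radial K \<theta>" by (rule radial_props(1)[OF Kc th])
    show "radial K \<theta> \<le> radial L \<theta>" by (rule radial_mono[OF Lc(1) Kc L(2) th])
  qed
  \<comment> \<open>The duality defining \<open>BP\<close> is stated for continuous test functions,
    so powers of the radial function of \<open>K\<close> are admissible only because it is
    continuous on the sphere.\<close>
  have cK: "continuous_on ?S (radial K)" by (rule continuous_on_radial[OF K])
  have meas: "f \<in> borel_measurable ?\<sigma>" if "continuous_on ?S f" for f :: "(nat \<Rightarrow> real) \<Rightarrow> real"
    unfolding measurable_cong_sets[OF s\<sigma> refl] by (rule borel_measurable_continuous_on_restrict[OF that])
  have [measurable]: "radial L \<in> borel_measurable ?\<sigma>" "radial K \<in> borel_measurable ?\<sigma>" using meas Lc cK by auto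
  have dens: "(LINT \<theta>|density ?\<sigma> (\<lambda>\<theta>. ennreal (radial L \<theta> ^ k)). f \<theta>) = (LINT \<theta>|?\<sigma>. radial L \<theta> ^ k * f \<theta>)"
    if "continuous_on ?S f" for f
    using meas[OF that] by (subst integral_density) (auto intro!: AE_I2 simp: sp\<sigma> rL)
  have int: "integrable ?\<sigma> (\<lambda>\<theta>. radial L \<theta> ^ k * radial K \<theta> ^ ?m)" "integrable ?\<sigma> (\<lambda>\<theta>. radial K \<theta> ^ n)"
  proof -
    have RK: "radial K \<theta> \<le> R" if "\<theta> \<in> ?S" for \<theta> using rL[OF that] by linarith
    show "integrable ?\<sigma> (\<lambda>\<theta>. radial L \<theta> ^ k * radial K \<theta> ^ ?m)"
    proof (rule \<sigma>.integrable_const_bound[where B = "R ^ k * R ^ ?m"])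
      show "AE \<theta> in ?\<sigma>. norm (radial L \<theta> ^ k * radial K \<theta> ^ ?m) \<le> R ^ k * R ^ ?m"
        by (rule AE_I2) (auto simp: sp\<sigma> rL RK R(1) less_imp_le intro!: mult_mono power_mono)
    qed measurable
    show "integrable ?\<sigma> (\<lambda>\<theta>. radial K \<theta> ^ n)"
    proof (rule \<sigma>.integrable_const_bound[where B = "R ^ n"])
      show "AE \<theta> in ?\<sigma>. norm (radial K \<theta> ^ n) \<le> R ^ n"
        by (rule AE_I2) (auto simp: sp\<sigma> rL RK intro!: power_mono)
    qed measurable
  qed
  have one: "(LINT \<theta>|?\<sigma>. radial K \<theta> ^ n) = 1"
  proof -
    have KB: "K \<in> sets borel" by (rule sym_convex_body_props[OF K])
    have "(\<integral>\<^sup>+z. indicator K (lmap n evec z) \<partial>lebesgue_Rn n) = (\<integral>\<^sup>+z. indicator K z \<partial>lebesgue_Rn n)"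
      by (rule nn_integral_cong_AE, rule eventually_mono[OF AE_lebesgue_Rn]) (simp only: lmap_evec_id)
    also have "\<dots> = emeasure (lebesgue_Rn n) K" using KB by simp
    also have "\<dots> = ennreal (vol n (unit_ball n))"
      using compact_emeasure_finite[OF Kc(1), of n] vol by (simp add: vol_def emeasure_eq_ennreal_measure)
    also have "vol n (unit_ball n) = unit_ball_vol (real n)"
      by (simp add: vol_def measure_def emeasure_unit_ball)
    finally have "ennreal (unit_ball_vol (real n) * (LINT \<theta>|?\<sigma>. radial K \<theta> ^ n)) = ennreal (unit_ball_vol (real n))"
      using section_radial[OF K orthonormal_evec n1(1)] by (simp only: im)
    moreover have "0 \<le> (LINT \<theta>|?\<sigma>. radial K \<theta> ^ n)"
      by (rule integral_nonneg_AE, rule AE_I2) (simp add: sp\<sigma> rL)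
    ultimately have "unit_ball_vol (real n) * (LINT \<theta>|?\<sigma>. radial K \<theta> ^ n) = unit_ball_vol (real n)"
      by (subst (asm) ennreal_inj) auto
    then show ?thesis by simp
  qed
  define W where "W = (LINT \<theta>|?\<sigma>. radial L \<theta> ^ k)"
  \<comment> \<open>The total mass of \<open>\<mu>\<close> is found by testing the duality on the
    constant 1.\<close>
  have W\<mu>: "measure \<mu> (space \<mu>) = W"
  proof -
    have "W = (LINT \<theta>|?\<sigma>. radial L \<theta> ^ k * 1)" by (simp add: W_def)
    also have "\<dots> = (LINT \<theta>|density ?\<sigma> (\<lambda>\<theta>. ennreal (radial L \<theta> ^ k)). 1)"
      by (rule dens[symmetric]) (rule continuous_on_const)
    also have "\<dots> = (LINT E|\<mu>. radon n (\<lambda>_. 1) E)"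
      by (rule \<mu>i) (rule continuous_on_const)
    also have "\<dots> = (LINT E|\<mu>. 1)"
    proof (rule Bochner_Integration.integral_cong)
      fix E assume "E \<in> space \<mu>"
      then have "prob_space (sphere_measure n E)" using inv by (simp add: sp\<mu> invariant_on_sphere_def)
      then show "radon n (\<lambda>_. 1) E = 1" by (simp add: radon_def prob_space.prob_space)
    qed simp
    finally show ?thesis by simp
  qed
  let ?g = "\<lambda>\<theta>. radial K \<theta> ^ ?m"
  have cg: "continuous_on ?S ?g" by (intro continuous_on_power cK)
  have ge: "1 \<le> (LINT E|\<mu>. radon n ?g E)"
  proof -
    have "1 = (LINT \<theta>|?\<sigma>. radial K \<theta> ^ n)" by (rule one[symmetric])
    also have "\<dots> \<le> (LINT \<theta>|?\<sigma>. radial L \<theta> ^ k * radial K \<theta> ^ ?m)"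
    proof (rule integral_mono[OF int(2,1)])
      fix \<theta> assume "\<theta> \<in> space ?\<sigma>"
      then have \<theta>: "\<theta> \<in> ?S" by (simp add: sp\<sigma>)
      have "radial K \<theta> ^ n = radial K \<theta> ^ k * radial K \<theta> ^ ?m" using nk by (simp add: power_add[symmetric] add.commute)
      also have "\<dots> \<le> radial L \<theta> ^ k * radial K \<theta> ^ ?m"
        using rL[OF \<theta>] by (intro mult_right_mono power_mono) auto
      finally show "radial K \<theta> ^ n \<le> radial L \<theta> ^ k * radial K \<theta> ^ ?m" .
    qed
    also have "\<dots> = (LINT E|\<mu>. radon n ?g E)"
      using dens[OF cg] \<mu>i[OF cg] by simp
    finally show ?thesis .
  qed
  \<comment> \<open>If \<open>W\<close> vanished, \<open>\<mu>\<close> would be null and its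
    integrals 0, against the lower bound \<open>ge\<close>.\<close>
  have Wp: "W > 0"
  proof (rule ccontr)
    assume "\<not> W > 0"
    moreover have "W \<ge> 0" using W\<mu> by (metis measure_nonneg)
    ultimately have "measure \<mu> (space \<mu>) = 0" using W\<mu> by simp
    then have "emeasure \<mu> (space \<mu>) = 0" by (simp add: \<mu>.emeasure_eq_measure)
    then have "AE E in \<mu>. radon n ?g E = 0"
      by (intro AE_I[of _ _ "space \<mu>"]) auto
    then have "(LINT E|\<mu>. radon n ?g E) = 0" by (rule integral_eq_zero_AE)
    then show False using ge by simp
  qed
  have "\<exists>E\<in>grassmannian n ?m. radon n ?g E \<ge> 1 / (2 * W)"
  proof (rule ccontr)
    assume no: "\<not> ?thesis"
    \<comment> \<open>A non-integrable function has integral 0 by convention, so the bound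
      \<open>ge\<close> already forces integrability; measurability of the Radon transform on the
      Grassmannian comes with it.\<close>
    have int: "integrable \<mu> (radon n ?g)"
      using ge not_integrable_integral_eq[of \<mu> "radon n ?g"] by fastforce
    have "(LINT E|\<mu>. radon n ?g E) \<le> (LINT E|\<mu>. 1 / (2 * W))"
      by (rule integral_mono[OF int]) (use no sp\<mu> in \<open>auto simp: not_le intro: less_imp_le\<close>)
    also have "\<dots> = 1 / 2" using W\<mu> Wp by simp
    finally show False using ge by simp
  qed
  then obtain E where "E \<in> grassmannian n ?m" "radon n ?g E \<ge> 1 / (2 * W)" by blast
  moreover have "mean_radius n k L = root k W" by (simp add: mean_radius_def W_def)
  ultimately show thesis using Wp that by blast
qed

theorem theorem2:
  shows "\<exists>C::real. C > 0 \<and>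
    (\<forall>(n::nat) (K::(nat \<Rightarrow> real) set).
      n \<ge> 2 \<longrightarrow> sym_convex_body n K \<longrightarrow> isotropic n K \<longrightarrow> vol n K = vol n (unit_ball n) \<longrightarrow>
      ennreal (isotropic_const n K) \<le>
        ennreal C * (INF (k, L) \<in> {(k, L). k \<in> {1..n - 1} \<and> L \<in> BP n k \<and> K \<subseteq> L}.
          max_isotropic_const k * ennreal (mean_radius n k L)))"
proof (intro exI[of _ "2 * sqrt (6 * exp 2)"] conjI allI impI)
  let ?C = "2 * sqrt (6 * exp 2) :: real"
  show Cp: "?C > 0" by simp
  fix n :: nat and K :: "(nat \<Rightarrow> real) set"
  assume n: "n \<ge> 2" and K: "sym_convex_body n K" "isotropic n K" "vol n K = vol n (unit_ball n)"
  \<comment> \<open>The constant is moved to the left first, so that it suffices to bound each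
    member of the family from below; this also covers an empty family. It is multiplied back at the
    end.\<close>
  have "ennreal (1 / ?C) * ennreal (isotropic_const n K) \<le> max_isotropic_const k * ennreal (mean_radius n k L)"
    if k: "k \<in> {1..n - 1}" and L: "L \<in> BP n k" "K \<subseteq> L" for k L
  proof -
    obtain E W where E: "E \<in> grassmannian n (n - k)" "W > 0" "mean_radius n k L = root k W"
      "radon n (\<lambda>\<theta>. radial K \<theta> ^ (n - k)) E \<ge> 1 / (2 * W)"
      using exists_large_section[OF n K(1,3) k L] by blast
    have "n - k \<ge> 1" "k \<ge> 1" "n = n - k + k" using k by auto
    then obtain B where B: "sym_convex_body k B" "isotropic_const n K \<le> ?C * (isotropic_const k B * root k W)"
      using slicing_inequality[OF K _ _ _ E(1,2,4)] by blast
    have rp: "root k W \<ge> 0" by (rule real_root_ge_zero) (use E(2) in simp)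
    have "1 / ?C * isotropic_const n K \<le> isotropic_const k B * root k W"
      using mult_left_mono[OF B(2), of "1 / ?C"] by simp
    then have "ennreal (1 / ?C * isotropic_const n K) \<le> ennreal (isotropic_const k B * root k W)" by (rule ennreal_leI)
    then have "ennreal (1 / ?C) * ennreal (isotropic_const n K) \<le> ennreal (isotropic_const k B) * ennreal (root k W)"
      using Cp rp by (simp only: ennreal_mult' ennreal_mult'' zero_le_divide_1_iff less_imp_le)
    also have "\<dots> \<le> max_isotropic_const k * ennreal (root k W)"
      unfolding max_isotropic_const_def by (intro mult_right_mono SUP_upper) (use B(1) in auto)
    finally show ?thesis by (simp only: E(3))
  qed
  then have "ennreal (1 / ?C) * ennreal (isotropic_const n K) \<le>
    (INF (k, L) \<in> {(k, L). k \<in> {1..n - 1} \<and> L \<in> BP n k \<and> K \<subseteq> L}. max_isotropic_const k * ennreal (mean_radius n k L))"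
    by (intro INF_greatest) auto
  then have "ennreal ?C * (ennreal (1 / ?C) * ennreal (isotropic_const n K)) \<le> ennreal ?C *
    (INF (k, L) \<in> {(k, L). k \<in> {1..n - 1} \<and> L \<in> BP n k \<and> K \<subseteq> L}. max_isotropic_const k * ennreal (mean_radius n k L))"
    by (rule mult_left_mono) simp
  moreover have "ennreal ?C * ennreal (1 / ?C) = 1"
  proof -
    have "ennreal ?C * ennreal (1 / ?C) = ennreal (?C * (1 / ?C))" using Cp by (intro ennreal_mult[symmetric]) auto
    also have "?C * (1 / ?C) = 1"
      by (simp only: times_divide_eq_right mult_1_right divide_self[OF Cp[THEN less_imp_neq, THEN not_sym]])
    finally show ?thesis by simp
  qed
  ultimately show "ennreal (isotropic_const n K) \<le> ennreal ?C *
    (INF (k, L) \<in> {(k, L). k \<in> {1..n - 1} \<and> L \<in> BP n k \<and> K \<subseteq> L}. max_isotropic_const k * ennreal (mean_radius n k L))"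
    by (simp only: mult.assoc[symmetric] mult_1_left)
qed

end
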